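(* Fix an integer $b\ge 2$ and $m\in\mathbb N_0$, and let the approximation classes $N^\alpha_q(L^p)$, $C^\alpha_q(L^p)$, $S^\alpha_q(L^p)$ of tensor networks be defined with $S=\mathbb P_m$ (see context). For any $1\le p<\infty$, any $0<\tau<p$, any $r>1/\tau-1/p$ and any $0<\bar r<r$, $$B^{r}_{\tau,\tau}\hookrightarrow N^{\bar r}_\infty(L^p)\hookrightarrow C^{\bar r/2}_\infty(L^p),\qquad B^{r}_{\tau,\tau}\hookrightarrow S^{\bar r}_\infty(L^p),$$ and for any $0<q\le\infty$ and any $0<\alpha<\bar r$, $$(L^p,B^{r}_{\tau,\tau})_{\alpha/\bar r,q}\hookrightarrow N^{\alpha}_q(L^p)\hookrightarrow C^{\alpha/2}_q(L^p),\qquad (L^p,B^{r}_{\tau,\tau})_{\alpha/\bar r,q}\hookrightarrow S^{\alpha}_q(L^p).$$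
   Context: All function spaces are over $[0,1)$; $\mathbb N=\{1,2,\dots\}$; $\hookrightarrow$ denotes continuous embedding. $\mathbb P_m$ is the space of polynomials of degree at most $m$. Tensor networks. Let $I_b=\{0,\dots,b-1\}$. For $d\in\mathbb N$ and $f:[0,1)\to\mathbb R$, the tensorization is $(T_{b,d}f)(i_1,\dots,i_d,y)=f\big(\sum_{k=1}^d i_kb^{-k}+b^{-d}y\big)$, $i_k\in I_b$, $y\in[0,1)$. Fix a basis $(\varphi_k)_{k=1}^{m+1}$ of $\mathbb P_m$. For $d\in\mathbb N$ and $\boldsymbol r=(r_1,\dots,r_d)\in\mathbb N^d$, a tensor network is a tuple $\mathbf v=(v_1,\dots,v_{d+1})\in\mathbb R^{b\times r_1}\times\mathbb R^{b\times r_1\times r_2}\times\cdots\times\mathbb R^{b\times r_{d-1}\times r_d}\times\mathbb R^{r_d\times(m+1)}$; its realization is the function $f$ with $$(T_{b,d}f)(i_1,\dots,i_d,y)=\sum_{k_1=1}^{r_1}\cdots\sum_{k_d=1}^{r_d}\sum_{k_{d+1}=1}^{m+1}v_1^{k_1}(i_1)v_2^{k_1,k_2}(i_2)\cdots v_d^{k_{d-1},k_d}(i_d)v_{d+1}^{k_d,k_{d+1}}\varphi_{k_{d+1}}(y).$$ Complexities of $\mathbf v$: $\mathrm{compl}_{\mathcal N}(\mathbf v)=\sum_{\nu=1}^d r_\nu$; $\mathrm{compl}_{\mathcal C}(\mathbf v)=br_1+b\sum_{k=2}^d r_{k-1}r_k+r_d(m+1)$; $\mathrm{compl}_{\mathcal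 S}(\mathbf v)=\sum_{\nu=1}^{d+1}\|v_\nu\|_{\ell_0}$ (number of non-zero entries). The complexity of a function is the minimum of the complexity over all tensor networks (all $d$, $\boldsymbol r$) realizing it. For $n\in\mathbb N$, $\Phi_n^{\mathcal N},\Phi_n^{\mathcal C},\Phi_n^{\mathcal S}$ are the sets of functions realizable by tensor networks whose respective complexity is at most $n$; moreover $0\in\Phi_n$ for all $n$ and $\Phi_0=\{0\}$. Approximation classes. For $E_n(f)=\inf_{\varphi\in\Phi_n}\|f-\varphi\|_p$, $\alpha>0$, $0<q\le\infty$, the class $A^\alpha_q(L^p,(\Phi_n))$ consists of $f\in L^p$ with $\|f\|_{A^\alpha_q}<\infty$, where $\|f\|_{A^\alpha_q}=\big(\sum_{n\ge1}[n^\alpha E_{n-1}(f)]^q\frac1n\big)^{1/q}$ for $q<\infty$ and $\|f\|_{A^\alpha_\infty}=\sup_{n\ge1}n^\alpha E_{n-1}(f)$. Then $N^\alpha_q(L^p)$, $C^\alpha_q(L^p)$, $S^\alpha_q(L^p)$ are the classes for $\Phi_n=\Phi_n^{\mathcal N},\Phi_n^{\mathcal C},\Phi_n^{\mathcal S}$ respectively. Besov spaces. $\Delta_h[f]=f(\cdot+h)-f$, $\Delta_h^r=\Delta_h\circ\Delta_h^{r-1}$ (defined on $[0,1-rh)$), $\omega_r(f,t)_p=\sup_{0<h\le t}\|\Delta_h^r[f]\|_p$. For $\alpha>0$, $0<p,q\le\infty$, $r=\lfloor\alpha\rfloor+1$: $|f|_{B^\alpha_{p,q}}=\big(\int_0^1[t^{-\alpha}\omega_r(f,t)_p]^q\frac{dt}{t}\big)^{1/q}$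 for $q<\infty$, $|f|_{B^\alpha_{p,\infty}}=\sup_{0<t\le1}t^{-\alpha}\omega_r(f,t)_p$, and $\|f\|_{B^\alpha_{p,q}}=\|f\|_p+|f|_{B^\alpha_{p,q}}$; $B^\alpha_{p,q}=\{f\in L^p:\|f\|_{B^\alpha_{p,q}}<\infty\}$. Interpolation spaces. For (quasi-)normed $Y\hookrightarrow X$, $K(f,t)=\inf_{g\in Y}\{\|f-g\|_X+t\|g\|_Y\}$, and for $0<\theta<1$, $(X,Y)_{\theta,q}$ is the space of $f\in X$ with finite $\|f\|_{\theta,q}=\big(\int_0^\infty[t^{-\theta}K(f,t)]^q\frac{dt}{t}\big)^{1/q}$ ($q<\infty$), respectively $\|f\|_{\theta,\infty}=\sup_{t>0}t^{-\theta}K(f,t)$. *)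

theory Defs
  imports "HOL-Analysis.Analysis" "HOL-Computational_Algebra.Polynomial"
begin

section \<open>Quasi-normed function spaces and continuous embeddings\<close>

text \<open>A function space is given by its carrier and its (extended-valued) quasi-norm.
  Functions on \<open>[0,1)\<close> are represented by total functions whose values outside \<open>[0,1)\<close> are
  irrelevant, and almost-everywhere equal functions are not identified: every quasi-norm below is
  constant on the classes.\<close>

type_synonym fspace = "(real \<Rightarrow> real) set \<times> ((real \<Rightarrow> real) \<Rightarrow> ennreal)"

definition embeds :: "fspace \<Rightarrow> fspace \<Rightarrow> bool" (infix \<open>\<hookrightarrow>\<close> 50) where
  "X \<hookrightarrow> Y \<longleftrightarrow> fst X \<subseteq> fst Y \<and> (\<exists>C::real. \<forall>f\<in>fst X. snd Y f \<le> ennreal C * snd X f)"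

text \<open>The power \<open>x\<^sup>a\<close> of an extended nonnegative number; only used for \<open>a > 0\<close>.\<close>

definition epowr :: "ennreal \<Rightarrow> real \<Rightarrow> ennreal" where
  "epowr x a = (if x = \<infinity> then \<infinity> else ennreal (enn2real x powr a))"

definition Lp_norm :: "real \<Rightarrow> real set \<Rightarrow> (real \<Rightarrow> real) \<Rightarrow> ennreal" where
  "Lp_norm p A f = epowr (\<integral>\<^sup>+x\<in>A. ennreal (\<bar>f x\<bar> powr p) \<partial>lebesgue) (1 / p)"

definition Lp :: "real \<Rightarrow> fspace" where
  "Lp p = ({f \<in> borel_measurable (lebesgue_on {0..<1}). Lp_norm p {0..<1} f < \<infinity>},
           Lp_norm p {0..<1})"

text \<open>The \<open>L\<^sup>q\<close> quasi-norm on \<open>I\<close> with respect to \<open>dt/t\<close>, the supremum over \<open>I\<close> if \<open>q = \<infinity>\<close>.\<close>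

definition Lq_star_norm :: "ennreal \<Rightarrow> real set \<Rightarrow> (real \<Rightarrow> ennreal) \<Rightarrow> ennreal" where
  "Lq_star_norm q I F =
     (if q = \<infinity> then (SUP t\<in>I. F t)
      else epowr (\<integral>\<^sup>+t\<in>I. epowr (F t) (enn2real q) * ennreal (1 / t) \<partial>lebesgue) (1 / enn2real q))"

section \<open>Besov spaces\<close>

definition difference :: "real \<Rightarrow> (real \<Rightarrow> real) \<Rightarrow> real \<Rightarrow> real" where
  "difference h f = (\<lambda>x. f (x + h) - f x)"

definition modulus_of_smoothness :: "nat \<Rightarrow> real \<Rightarrow> (real \<Rightarrow> real) \<Rightarrow> real \<Rightarrow> ennreal" where
  "modulus_of_smoothness k p f t =
     (SUP h\<in>{0<..t}. Lp_norm p {0..<1 - real k * h} ((difference h ^^ k) f))"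

definition besov_seminorm :: "real \<Rightarrow> real \<Rightarrow> ennreal \<Rightarrow> (real \<Rightarrow> real) \<Rightarrow> ennreal" where
  "besov_seminorm \<alpha> p q f =
     Lq_star_norm q {0<..1}
       (\<lambda>t. ennreal (t powr (- \<alpha>)) * modulus_of_smoothness (nat \<lfloor>\<alpha>\<rfloor> + 1) p f t)"

definition besov_norm :: "real \<Rightarrow> real \<Rightarrow> ennreal \<Rightarrow> (real \<Rightarrow> real) \<Rightarrow> ennreal" where
  "besov_norm \<alpha> p q f = Lp_norm p {0..<1} f + besov_seminorm \<alpha> p q f"

definition Besov :: "real \<Rightarrow> real \<Rightarrow> ennreal \<Rightarrow> fspace" where
  "Besov \<alpha> p q = ({f \<in> fst (Lp p). besov_norm \<alpha> p q f < \<infinity>}, besov_norm \<alpha> p q)"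

section \<open>Real interpolation\<close>

definition K_functional :: "fspace \<Rightarrow> fspace \<Rightarrow> (real \<Rightarrow> real) \<Rightarrow> real \<Rightarrow> ennreal" where
  "K_functional X Y f t = (INF g\<in>fst Y. snd X (\<lambda>x. f x - g x) + ennreal t * snd Y g)"

definition interpolation_norm ::
    "fspace \<Rightarrow> fspace \<Rightarrow> real \<Rightarrow> ennreal \<Rightarrow> (real \<Rightarrow> real) \<Rightarrow> ennreal" where
  "interpolation_norm X Y \<theta> q f =
     Lq_star_norm q {0<..} (\<lambda>t. ennreal (t powr (- \<theta>)) * K_functional X Y f t)"

definition interpolation_space :: "fspace \<Rightarrow> fspace \<Rightarrow> real \<Rightarrow> ennreal \<Rightarrow> fspace" where
  "interpolation_space X Y \<theta> q =
     ({f \<in> fst X. interpolation_norm X Y \<theta> q f < \<infinity>}, interpolation_norm X Y \<theta> q)"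

section \<open>Approximation classes\<close>

definition best_error :: "real \<Rightarrow> (real \<Rightarrow> real) set \<Rightarrow> (real \<Rightarrow> real) \<Rightarrow> ennreal" where
  "best_error p \<Psi> f = (INF g\<in>\<Psi>. Lp_norm p {0..<1} (\<lambda>x. f x - g x))"

text \<open>The index \<open>n \<ge> 1\<close> of the sum (supremum) is written \<open>Suc n\<close>, so that \<open>E\<^sub>n\<^sub>-\<^sub>1\<close> becomes the
  error of best approximation from \<open>\<Phi> n\<close>.\<close>

definition approx_norm ::
    "real \<Rightarrow> ennreal \<Rightarrow> real \<Rightarrow> (nat \<Rightarrow> (real \<Rightarrow> real) set) \<Rightarrow> (real \<Rightarrow> real) \<Rightarrow> ennreal" where
  "approx_norm \<alpha> q p \<Phi> f =
     (if q = \<infinity> then (SUP n. ennreal (real (Suc n) powr \<alpha>) * best_error p (\<Phi> n) f)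
      else epowr (\<Sum>n. epowr (ennreal (real (Suc n) powr \<alpha>) * best_error p (\<Phi> n) f) (enn2real q)
                        * ennreal (1 / real (Suc n)))
             (1 / enn2real q))"

definition approx_class :: "real \<Rightarrow> ennreal \<Rightarrow> real \<Rightarrow> (nat \<Rightarrow> (real \<Rightarrow> real) set) \<Rightarrow> fspace" where
  "approx_class \<alpha> q p \<Phi> = ({f \<in> fst (Lp p). approx_norm \<alpha> q p \<Phi> f < \<infinity>}, approx_norm \<alpha> q p \<Phi>)"

section \<open>Tensor networks\<close>

interpretation poly_vs: vector_space "smult :: real \<Rightarrow> real poly \<Rightarrow> real poly"
  by unfold_locales (simp_all add: smult_add_right smult_add_left)

definition is_poly_basis :: "nat \<Rightarrow> (nat \<Rightarrow> real poly) \<Rightarrow> bool" where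
  "is_poly_basis m \<phi> \<longleftrightarrow>
     inj_on \<phi> {1..m + 1} \<and> poly_vs.independent (\<phi> ` {1..m + 1}) \<and>
     poly_vs.span (\<phi> ` {1..m + 1}) = {g. degree g \<le> m}"

definition tensorization ::
    "nat \<Rightarrow> nat \<Rightarrow> (real \<Rightarrow> real) \<Rightarrow> (nat \<Rightarrow> nat) \<Rightarrow> real \<Rightarrow> real" where
  "tensorization b d f i y = f ((\<Sum>k=1..d. real (i k) / real b ^ k) + y / real b ^ d)"

text \<open>The tuple \<open>(v\<^sub>1,\<dots>,v\<^sub>d\<^sub>+\<^sub>1)\<close> with its depth \<open>d\<close> and ranks \<open>r\<^sub>1,\<dots>,r\<^sub>d\<close>:
  \<open>tn_first v i k\<close> is \<open>v\<^sub>1\<^sup>k(i)\<close>, \<open>tn_mid v \<nu> i k l\<close> is \<open>v\<^sub>\<nu>\<^sup>k\<^sup>,\<^sup>l(i)\<close> for \<open>2 \<le> \<nu> \<le> d\<close>, and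
  \<open>tn_last v k l\<close> is the entry of \<open>v\<^sub>d\<^sub>+\<^sub>1\<close>. Here \<open>i < b\<close>, rank indices start at 1, and entries
  outside these ranges are ignored.\<close>

record tensor_network =
  tn_depth :: nat
  tn_rank :: "nat \<Rightarrow> nat"
  tn_first :: "nat \<Rightarrow> nat \<Rightarrow> real"
  tn_mid :: "nat \<Rightarrow> nat \<Rightarrow> nat \<Rightarrow> nat \<Rightarrow> real"
  tn_last :: "nat \<Rightarrow> nat \<Rightarrow> real"

definition is_tensor_network :: "tensor_network \<Rightarrow> bool" where
  "is_tensor_network v \<longleftrightarrow> 1 \<le> tn_depth v \<and> (\<forall>\<nu>\<in>{1..tn_depth v}. 1 \<le> tn_rank v \<nu>)"

definition tn_value ::
    "nat \<Rightarrow> (nat \<Rightarrow> real poly) \<Rightarrow> tensor_network \<Rightarrow> (nat \<Rightarrow> nat) \<Rightarrow> real \<Rightarrow> real" where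
  "tn_value m \<phi> v i y =
     (\<Sum>k \<in> (\<Pi>\<^sub>E \<nu>\<in>{1..tn_depth v}. {1..tn_rank v \<nu>}). \<Sum>l=1..m + 1.
        tn_first v (i 1) (k 1)
        * (\<Prod>\<nu>=2..tn_depth v. tn_mid v \<nu> (i \<nu>) (k (\<nu> - 1)) (k \<nu>))
        * tn_last v (k (tn_depth v)) l * poly (\<phi> l) y)"

definition realizes ::
    "nat \<Rightarrow> nat \<Rightarrow> (nat \<Rightarrow> real poly) \<Rightarrow> tensor_network \<Rightarrow> (real \<Rightarrow> real) \<Rightarrow> bool" where
  "realizes b m \<phi> v f \<longleftrightarrow>
     (\<forall>i\<in>{1..tn_depth v} \<rightarrow> {0..<b}. \<forall>y\<in>{0..<1}.
        tensorization b (tn_depth v) f i y = tn_value m \<phi> v i y)"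

definition compl_N :: "tensor_network \<Rightarrow> nat" where
  "compl_N v = (\<Sum>\<nu>=1..tn_depth v. tn_rank v \<nu>)"

definition compl_C :: "nat \<Rightarrow> nat \<Rightarrow> tensor_network \<Rightarrow> nat" where
  "compl_C b m v =
     b * tn_rank v 1 + b * (\<Sum>k=2..tn_depth v. tn_rank v (k - 1) * tn_rank v k)
     + tn_rank v (tn_depth v) * (m + 1)"

definition compl_S :: "nat \<Rightarrow> nat \<Rightarrow> tensor_network \<Rightarrow> nat" where
  "compl_S b m v =
     card {(i, k). i \<in> {0..<b} \<and> k \<in> {1..tn_rank v 1} \<and> tn_first v i k \<noteq> 0}
     + (\<Sum>\<nu>=2..tn_depth v.
          card {(i, k, l). i \<in> {0..<b} \<and> k \<in> {1..tn_rank v (\<nu> - 1)} \<and> l \<in> {1..tn_rank v \<nu>}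
                  \<and> tn_mid v \<nu> i k l \<noteq> 0})
     + card {(k, l). k \<in> {1..tn_rank v (tn_depth v)} \<and> l \<in> {1..m + 1} \<and> tn_last v k l \<noteq> 0}"

definition \<Phi>_set ::
    "nat \<Rightarrow> nat \<Rightarrow> (nat \<Rightarrow> real poly) \<Rightarrow> (tensor_network \<Rightarrow> nat) \<Rightarrow> nat \<Rightarrow> (real \<Rightarrow> real) set" where
  "\<Phi>_set b m \<phi> compl n =
     (if n = 0 then {\<lambda>_. 0}
      else insert (\<lambda>_. 0) {f. \<exists>v. is_tensor_network v \<and> realizes b m \<phi> v f \<and> compl v \<le> n})"

definition N_class ::
    "nat \<Rightarrow> nat \<Rightarrow> (nat \<Rightarrow> real poly) \<Rightarrow> real \<Rightarrow> ennreal \<Rightarrow> real \<Rightarrow> fspace" where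
  "N_class b m \<phi> \<alpha> q p = approx_class \<alpha> q p (\<Phi>_set b m \<phi> compl_N)"

definition C_class ::
    "nat \<Rightarrow> nat \<Rightarrow> (nat \<Rightarrow> real poly) \<Rightarrow> real \<Rightarrow> ennreal \<Rightarrow> real \<Rightarrow> fspace" where
  "C_class b m \<phi> \<alpha> q p = approx_class \<alpha> q p (\<Phi>_set b m \<phi> (compl_C b m))"

definition S_class ::
    "nat \<Rightarrow> nat \<Rightarrow> (nat \<Rightarrow> real poly) \<Rightarrow> real \<Rightarrow> ennreal \<Rightarrow> real \<Rightarrow> fspace" where
  "S_class b m \<phi> \<alpha> q p = approx_class \<alpha> q p (\<Phi>_set b m \<phi> (compl_S b m))"

end

theory Submission
  imports Defs
begin

text \<open>
  The embeddings of the \<open>N\<close> classes into the \<open>C\<close> classes are elementary: a network whose ranks sum to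
  \<open>N\<close> has at most a multiple of \<open>N\<^sup>2\<close> parameters, and \<open>quadratic_embedding\<close> turns this into halved
  exponents. All other embeddings follow from one direct inequality (\<open>direct_inequality\<close>): for \<open>f\<close>
  in \<open>B\<^sup>r\<^sub>\<tau>\<^sub>,\<^sub>\<tau>\<close> and every \<open>n\<close> a single function, in \<open>\<Phi>\<^sub>n\<close> both for the rank sum and for the number of
  nonzero entries, has \<open>L\<^sup>p\<close> distance to \<open>f\<close> at most a multiple of \<open>(n + 1) powr - rbar\<close> times the norm
  of \<open>f\<close>. Applied to the functions \<open>g\<close> in the \<open>K\<close>-functional it bounds the error \<open>E\<^sub>n(f)\<close> by a
  multiple of \<open>K(f, (n + 1) powr - rbar)\<close>, and the interpolation spaces embed by comparing a sum over
  \<open>n\<close> with an integral over \<open>t\<close>. The direct inequality is proved in three steps.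

  Sampling. Instead of best local approximations, whose analysis for \<open>\<tau> < 1\<close> rests on Whitney's theorem,
  the proof uses Lagrange interpolation at points of the grids of step \<open>b\<^sup>-\<^sup>j\<^sup>-\<^sup>k\<close> through a common point
  \<open>\<xi>\<close>. These grids are nested, so the interpolants on a cell and on its child interpolate the same
  data on the finer grid, and their difference is controlled by \<open>k\<close>-th differences of \<open>f\<close> at grid
  points (\<open>interpolants_close\<close>, \<open>sample_poly_step\<close>). Averaging over \<open>\<xi>\<close> turns sums of such differences
  into integrals, that is, into moduli of smoothness at the scales \<open>b\<^sup>-\<^sup>j\<close>. Hence some \<open>\<xi>\<close> is good for
  all levels, and the interpolants converge to \<open>f\<close> almost everywhere along a sequence of levels
  (\<open>exists_multiscale\<close>).

  Selection. The difference of the interpolants of levels \<open>j + 1\<close> and \<open>j\<close> is a sum over the cells of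
  level \<open>j\<close>. All cells are kept below level \<open>l\<close>; from there on only those where the difference exceeds
  \<open>b\<^sup>-\<^sup>j\<^sup>r b\<^sup>(\<^sup>j\<^sup>-\<^sup>l\<^sup>)\<^sup>/\<^sup>\<tau>\<close> times the norm of \<open>f\<close>, at most \<open>b\<^sup>l\<close> per level; and none from a level \<open>L = O(l)\<close>
  on. As \<open>r > 1/\<tau> - 1/p\<close>, the discarded parts form a geometric series in \<open>L\<^sup>p\<close> and the error is of
  order \<open>b\<^sup>-\<^sup>l\<^sup>r\<close> (\<open>coarse_error\<close>).

  Encoding. What remains is a sum of \<open>O(l b\<^sup>l)\<close> polynomials restricted to cells. Rounding the argument
  to \<open>d = O(l)\<close> digits changes it by a comparable error (\<open>rounding_error\<close>) and makes it a function of
  these digits alone, constant in the last variable of the tensorization. A network computes it by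
  carrying, for each polynomial, the powers of the number read so far as long as the digits agree with
  those of the cell (\<open>cells_network_realizes\<close>). Its size is \<open>O(l\<^sup>2 b\<^sup>l)\<close>, and \<open>rbar < r\<close> absorbs the
  factor \<open>l\<^sup>2\<close>.
\<close>

section \<open>Polynomials controlled by their values at integer nodes\<close>

definition lagrange_basis :: "real set \<Rightarrow> real \<Rightarrow> real poly" where
  "lagrange_basis S t = (\<Prod>s\<in>S - {t}. smult (1 / (t - s)) [:- s, 1:])"

lemma poly_lagrange_basis:
  "poly (lagrange_basis S t) x = (\<Prod>s\<in>S - {t}. (x - s) / (t - s))"
  by (simp add: lagrange_basis_def poly_prod diff_divide_distrib)

lemma degree_lagrange_basis:
  assumes "finite S" "t \<in> S"
  shows "degree (lagrange_basis S t) < card S"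
proof -
  have "degree (lagrange_basis S t) \<le> (\<Sum>s\<in>S - {t}. degree (smult (1 / (t - s)) [:- s, 1:]))"
    unfolding lagrange_basis_def
    by (rule degree_prod_sum_le[of "S - {t}", unfolded o_def]) (use assms in simp)
  also have "\<dots> \<le> (\<Sum>s\<in>S - {t}. 1)"
    by (intro sum_mono) (simp add: degree_smult_le)
  also have "\<dots> < card S"
    using assms by (simp add: card_Diff1_less del: card_Diff_insert)
  finally show ?thesis .
qed

lemma lagrange_basis_at_node:
  assumes "finite S" "t \<in> S" "u \<in> S"
  shows "poly (lagrange_basis S t) u = (if u = t then 1 else 0)"
proof (cases "u = t")
  case True
  then show ?thesis by (auto simp: poly_lagrange_basis intro!: prod.neutral)
next
  case False
  then show ?thesis using assms
    by (auto simp: poly_lagrange_basis)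
qed

definition lagrange_interpolant :: "real set \<Rightarrow> (real \<Rightarrow> real) \<Rightarrow> real poly" where
  "lagrange_interpolant S g = (\<Sum>t\<in>S. smult (g t) (lagrange_basis S t))"

lemma degree_lagrange_interpolant:
  assumes "finite S" "S \<noteq> {}"
  shows "degree (lagrange_interpolant S g) < card S"
  unfolding lagrange_interpolant_def
proof (rule degree_sum_less)
  show "0 < card S" using assms by (simp add: card_gt_0_iff)
  show "\<And>t. t \<in> S \<Longrightarrow> degree (smult (g t) (lagrange_basis S t)) < card S"
    using degree_lagrange_basis[OF assms(1)] degree_smult_le le_less_trans by blast
qed

lemma poly_lagrange_interpolant:
  assumes "finite S" "u \<in> S"
  shows "poly (lagrange_interpolant S g) u = g u"
proof -
  have "poly (lagrange_interpolant S g) u = (\<Sum>t\<in>S. if u = t then g t else 0)"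
    unfolding lagrange_interpolant_def poly_sum
    using assms by (intro sum.cong) (simp_all add: lagrange_basis_at_node)
  also have "\<dots> = g u" using assms by simp
  finally show ?thesis .
qed

lemma lagrange_formula:
  assumes "finite S" "degree R < card S"
  shows "R = lagrange_interpolant S (poly R)"
proof (rule poly_eqI_degree[of S])
  have "S \<noteq> {}" using assms by auto
  then show "card S > degree (lagrange_interpolant S (poly R))"
    using degree_lagrange_interpolant assms by blast
qed (use assms in \<open>auto simp: poly_lagrange_interpolant\<close>)

text \<open>Distinct integers differ by at least one, so each factor of a Lagrange basis polynomial is
  bounded on the range of the nodes.\<close>

lemma poly_bound_from_integer_nodes:
  fixes T :: "nat set"
  assumes T: "T \<subseteq> {..<M}" and deg: "degree R < card T"
    and bnd: "\<And>n. n \<in> T \<Longrightarrow> \<bar>poly R (real n)\<bar> \<le> A"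
    and y: "-1 \<le> y" "y \<le> real M"
  shows "\<bar>poly R y\<bar> \<le> real (card T) * (real M + 1) ^ card T * A"
proof -
  have finT: "finite T" using T finite_subset by blast
  define S where "S = real ` T"
  have cS: "card S = card T" unfolding S_def by (intro card_image) auto
  have finS: "finite S" using finT S_def by simp
  have "T \<noteq> {}" using deg by auto
  then have A0: "A \<ge> 0" using bnd abs_ge_zero order_trans by (metis ex_in_conv)
  have basis: "\<bar>poly (lagrange_basis S t) y\<bar> \<le> (real M + 1) ^ card T" if t: "t \<in> S" for t
  proof -
    have "\<bar>poly (lagrange_basis S t) y\<bar> = (\<Prod>s\<in>S - {t}. \<bar>(y - s) / (t - s)\<bar>)"
      by (simp add: poly_lagrange_basis abs_prod)
    also have "\<dots> \<le> (\<Prod>s\<in>S - {t}. real M + 1)"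
    proof (intro prod_mono conjI)
      fix s assume s: "s \<in> S - {t}"
      obtain a c where ac: "s = real a" "t = real c" "a \<in> T" "c \<in> T" "a \<noteq> c"
        using s t unfolding S_def by auto
      have "\<bar>t - s\<bar> \<ge> 1" using ac by auto
      moreover have "\<bar>y - s\<bar> \<le> real M + 1" using ac T y by auto
      ultimately show "\<bar>(y - s) / (t - s)\<bar> \<le> real M + 1"
        by (simp add: abs_divide) (smt (verit, ccfv_threshold) divide_le_eq_1 frac_le div_by_1)
    qed auto
    also have "\<dots> = (real M + 1) ^ card (S - {t})" by simp
    also have "\<dots> \<le> (real M + 1) ^ card T"
      by (intro power_increasing) (auto simp: cS[symmetric] finS intro!: card_mono)
    finally show ?thesis .
  qed
  have "poly R y = (\<Sum>t\<in>S. poly R t * poly (lagrange_basis S t) y)"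
    by (subst lagrange_formula[OF finS, of R])
       (use deg cS in \<open>auto simp: lagrange_interpolant_def poly_sum\<close>)
  then have "\<bar>poly R y\<bar> \<le> (\<Sum>t\<in>S. \<bar>poly R t\<bar> * \<bar>poly (lagrange_basis S t) y\<bar>)"
    by (simp add: abs_mult[symmetric])
  also have "\<dots> \<le> (\<Sum>t\<in>S. A * (real M + 1) ^ card T)"
    using bnd basis A0 by (intro sum_mono mult_mono) (auto simp: S_def)
  also have "\<dots> = real (card T) * (real M + 1) ^ card T * A" by (simp add: cS)
  finally show ?thesis .
qed

lemma poly_lipschitz_on_unit_interval:
  fixes p :: "real poly"
  shows "\<exists>C\<ge>0. \<forall>x\<in>{0..1}. \<forall>y\<in>{0..1}. \<bar>poly p x - poly p y\<bar> \<le> C * \<bar>x - y\<bar>"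
proof -
  have "continuous_on {0..1::real} (\<lambda>x. \<bar>poly (pderiv p) x\<bar>)" by (intro continuous_intros)
  then obtain z where z: "\<And>x. x \<in> {0..1} \<Longrightarrow> \<bar>poly (pderiv p) x\<bar> \<le> \<bar>poly (pderiv p) z\<bar>"
    using continuous_attains_sup[of "{0..1::real}" "\<lambda>x. \<bar>poly (pderiv p) x\<bar>"] by fastforce
  have "\<bar>poly p x - poly p y\<bar> \<le> \<bar>poly (pderiv p) z\<bar> * \<bar>x - y\<bar>" if "x \<in> {0..1}" "y \<in> {0..1}" for x y
    using field_differentiable_bound[of "{0..1::real}" "poly p" "poly (pderiv p)" "\<bar>poly (pderiv p) z\<bar>" x y]
      that z by (simp add: has_field_derivative_at_within)
  then show ?thesis by (intro exI[of _ "\<bar>poly (pderiv p) z\<bar>"]) auto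
qed

text \<open>A crude form of Markov's inequality: interpolating at fixed nodes expresses a polynomial
  through finitely many fixed Lipschitz functions.\<close>

lemma poly_markov:
  assumes "0 < k"
  shows "\<exists>C\<ge>0. \<forall>(R :: real poly) B. degree R < k \<longrightarrow> (\<forall>x\<in>{0..<1}. \<bar>poly R x\<bar> \<le> B) \<longrightarrow>
           (\<forall>x\<in>{0..1}. \<forall>y\<in>{0..1}. \<bar>poly R x - poly R y\<bar> \<le> C * B * \<bar>x - y\<bar>)"
proof -
  define S where "S = (\<lambda>i. real i / real k) ` {..<k}"
  have finS: "finite S" and cS: "card S = k" and S01: "S \<subseteq> {0..<1}"
    using assms unfolding S_def by (auto simp: card_image inj_on_def)
  have "\<forall>t. \<exists>C\<ge>0. \<forall>x\<in>{0..1}. \<forall>y\<in>{0..1}.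
      \<bar>poly (lagrange_basis S t) x - poly (lagrange_basis S t) y\<bar> \<le> C * \<bar>x - y\<bar>"
    using poly_lipschitz_on_unit_interval by blast
  then obtain c where c: "\<And>t. c t \<ge> 0" "\<And>t x y. x \<in> {0..1} \<Longrightarrow> y \<in> {0..1} \<Longrightarrow>
      \<bar>poly (lagrange_basis S t) x - poly (lagrange_basis S t) y\<bar> \<le> c t * \<bar>x - y\<bar>"
    by metis
  have lip: "\<bar>poly R x - poly R y\<bar> \<le> (\<Sum>t\<in>S. c t) * B * \<bar>x - y\<bar>"
    if R: "degree R < k" "\<forall>x\<in>{0..<1}. \<bar>poly R x\<bar> \<le> B" and xy: "x \<in> {0..1}" "y \<in> {0..1}" for R B x y
  proof -
    have eq: "poly R z = (\<Sum>t\<in>S. poly R t * poly (lagrange_basis S t) z)" for z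
      by (subst lagrange_formula[OF finS, of R])
         (use R cS in \<open>auto simp: lagrange_interpolant_def poly_sum\<close>)
    have "poly R x - poly R y =
        (\<Sum>t\<in>S. poly R t * (poly (lagrange_basis S t) x - poly (lagrange_basis S t) y))"
      by (subst (1 2) eq) (simp add: sum_subtractf right_diff_distrib)
    also have "\<bar>\<dots>\<bar> \<le> (\<Sum>t\<in>S. \<bar>poly R t\<bar> * \<bar>poly (lagrange_basis S t) x - poly (lagrange_basis S t) y\<bar>)"
      by (simp add: abs_mult[symmetric])
    also have "\<dots> \<le> (\<Sum>t\<in>S. B * (c t * \<bar>x - y\<bar>))"
      using R S01 c xy by (intro sum_mono mult_mono) auto
    also have "\<dots> = (\<Sum>t\<in>S. c t) * B * \<bar>x - y\<bar>"
      by (simp add: sum_distrib_left sum_distrib_right mult_ac)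
    finally show ?thesis .
  qed
  have c0: "(\<Sum>t\<in>S. c t) \<ge> 0" using c by (intro sum_nonneg) auto
  show ?thesis
  proof (intro exI[of _ "\<Sum>t\<in>S. c t"] conjI allI impI ballI)
    show "(\<Sum>t\<in>S. c t) \<ge> 0" by (rule c0)
  qed (rule lip; assumption)
qed

section \<open>Finite differences\<close>

lemma difference_poly:
  assumes "degree R < Suc k"
  shows "\<exists>Q. (k = 0 \<longrightarrow> Q = 0) \<and> (0 < k \<longrightarrow> degree Q < k) \<and> difference 1 (poly R) = poly Q"
proof (intro exI conjI impI)
  let ?Q = "pcompose R [:1, 1:] - R"
  show "difference 1 (poly R) = poly ?Q"
    by (simp add: difference_def fun_eq_iff poly_pcompose add.commute)
  show "?Q = 0" if "k = 0"
  proof -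
    have "degree R = 0" using that assms by simp
    then obtain a where "R = [:a:]" using degree_eq_zeroE by blast
    then show ?thesis by simp
  qed
  show "degree ?Q < k" if k: "0 < k"
  proof (rule degree_lessI)
    show "?Q \<noteq> 0 \<or> k > 0" using k by simp
    show "\<forall>n\<ge>k. coeff ?Q n = 0"
    proof (intro allI impI)
      fix n assume n: "k \<le> n"
      show "coeff ?Q n = 0"
      proof (cases "n = degree R")
        case True
        have "lead_coeff (pcompose R [:1, 1:]) = lead_coeff R"
          by (subst lead_coeff_comp) auto
        then show ?thesis using True by (simp add: degree_pcompose)
      next
        case False
        then have "degree R < n" using n assms by linarith
        then show ?thesis by (simp add: coeff_eq_0 degree_pcompose)
      qed
    qed
  qed
qed

lemma funpow_difference_poly:
  assumes "degree R < k" "0 < k"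
  shows "(difference 1 ^^ k) (poly R) = (\<lambda>_. 0)"
  using assms
proof (induction k arbitrary: R)
  case (Suc k)
  obtain Q where Q: "k = 0 \<longrightarrow> Q = 0" "0 < k \<longrightarrow> degree Q < k" "difference 1 (poly R) = poly Q"
    using difference_poly[OF Suc.prems(1)] by blast
  have "(difference 1 ^^ Suc k) (poly R) = (difference 1 ^^ k) (poly Q)"
    by (simp add: funpow_swap1 Q(3))
  also have "\<dots> = (\<lambda>_. 0)"
  proof (cases "k = 0")
    case True
    then show ?thesis using Q(1) by (simp add: fun_eq_iff)
  next
    case False
    then show ?thesis using Suc.IH[of Q] Q(2) by simp
  qed
  finally show ?case .
qed simp

lemma difference_diff: "difference h (\<lambda>x. f x - g x) = (\<lambda>x. difference h f x - difference h g x)"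
  by (auto simp: difference_def)

lemma funpow_difference_diff:
  "(difference h ^^ k) (\<lambda>x. f x - g x) = (\<lambda>x. (difference h ^^ k) f x - (difference h ^^ k) g x)"
  by (induction k) (simp_all add: difference_diff)

lemma funpow_difference_Suc:
  "(difference h ^^ Suc k) f x = (difference h ^^ k) f (x + h) - (difference h ^^ k) f x"
  unfolding funpow.simps o_def by (subst difference_def) (rule refl)

lemma funpow_difference_rescale:
  "(difference h ^^ k) f (x0 + h * y) = (difference 1 ^^ k) (\<lambda>y. f (x0 + h * y)) y"
proof (induction k arbitrary: y)
  case (Suc k)
  show ?case
    unfolding funpow_difference_Suc Suc.IH[symmetric] by (simp add: algebra_simps)
qed simp

text \<open>If \<open>w\<close> vanishes at the first \<open>k\<close> points, then it is recovered from its \<open>k\<close>-th differences by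
  summing \<open>k\<close> times, and each summation over at most \<open>M\<close> points costs a factor \<open>M\<close>.\<close>

lemma bound_by_differences:
  fixes w :: "real \<Rightarrow> real"
  assumes "\<And>n. n < k \<Longrightarrow> w (real n) = 0"
    and "\<And>n. n + k < M \<Longrightarrow> \<bar>(difference 1 ^^ k) w (real n)\<bar> \<le> A"
    and "n < M" "0 \<le> A"
  shows "\<bar>w (real n)\<bar> \<le> real M ^ k * A"
  using assms
proof (induction k arbitrary: w M n)
  case (Suc k)
  let ?v = "difference 1 w"
  obtain M' where M': "M = Suc M'" using Suc.prems(3) by (cases M) auto
  have v: "\<bar>?v (real i)\<bar> \<le> real M' ^ k * A" if "i < M'" for i
  proof (rule Suc.IH)
    show "?v (real n) = 0" if "n < k" for n
      using Suc.prems(1)[of n] Suc.prems(1)[of "Suc n"] that by (simp add: difference_def add.commute)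
    show "\<bar>(difference 1 ^^ k) ?v (real n)\<bar> \<le> A" if "n + k < M'" for n
      using Suc.prems(2)[of n] that M' by (simp add: funpow_swap1)
  qed (use that Suc.prems in auto)
  have w: "w (real n) = (\<Sum>i<n. ?v (real i))" for n
  proof (induction n)
    case 0
    then show ?case using Suc.prems(1)[of 0] by simp
  next
    case (Suc n)
    then show ?case by (simp add: difference_def add.commute)
  qed
  have "\<bar>w (real n)\<bar> \<le> (\<Sum>i<n. \<bar>?v (real i)\<bar>)" by (simp add: w)
  also have "\<dots> \<le> (\<Sum>i<n. real M' ^ k * A)"
    using v Suc.prems(3) M' by (intro sum_mono) auto
  also have "\<dots> = real n * (real M' ^ k * A)" by simp
  also have "\<dots> \<le> real M * (real M ^ k * A)"
    using Suc.prems M' by (intro mult_mono power_mono) auto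
  finally show ?case by (simp add: mult.assoc)
qed (auto)

text \<open>Two interpolants of the same data at different integer nodes differ by no more than the
  \<open>k\<close>-th differences of the data: both are close to the interpolant at the first \<open>k\<close> nodes, whose
  error vanishes there and has the same \<open>k\<close>-th differences as the data.\<close>

lemma interpolants_close:
  fixes u :: "real \<Rightarrow> real"
  assumes k: "0 < k" "k \<le> M" and T: "T \<subseteq> {..<M}" "card T = k" and T': "T' \<subseteq> {..<M}" "card T' = k"
    and R: "degree R < k" "\<And>n. n \<in> T \<Longrightarrow> poly R (real n) = u (real n)"
    and R': "degree R' < k" "\<And>n. n \<in> T' \<Longrightarrow> poly R' (real n) = u (real n)"
    and A: "\<And>n. n + k < M \<Longrightarrow> \<bar>(difference 1 ^^ k) u (real n)\<bar> \<le> A" "0 \<le> A"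
    and y: "-1 \<le> y" "y \<le> real M"
  shows "\<bar>poly R y - poly R' y\<bar> \<le> 2 * (real k * (real M + 1) ^ k * (real M ^ k * A))"
proof -
  define Q where "Q = lagrange_interpolant (real ` {..<k}) u"
  have cI: "card (real ` {..<k}) = k" by (simp add: card_image)
  have Q: "degree Q < k" "\<And>n. n < k \<Longrightarrow> poly Q (real n) = u (real n)"
    using degree_lagrange_interpolant[of "real ` {..<k}" u] k cI
    by (auto simp: Q_def poly_lagrange_interpolant)
  define w where "w = (\<lambda>x. u x - poly Q x)"
  have w: "\<bar>w (real n)\<bar> \<le> real M ^ k * A" if "n < M" for n
  proof (rule bound_by_differences)
    show "\<bar>(difference 1 ^^ k) w (real n)\<bar> \<le> A" if "n + k < M" for n
      using A(1)[OF that] Q(1) k by (simp add: w_def funpow_difference_diff funpow_difference_poly)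
  qed (use that A Q in \<open>auto simp: w_def\<close>)
  have close: "\<bar>poly U y - poly Q y\<bar> \<le> real k * (real M + 1) ^ k * (real M ^ k * A)"
    if "V \<subseteq> {..<M}" "card V = k" "degree U < k" "\<And>n. n \<in> V \<Longrightarrow> poly U (real n) = u (real n)" for U V
  proof -
    have "\<bar>poly (U - Q) y\<bar> \<le> real (card V) * (real M + 1) ^ card V * (real M ^ k * A)"
    proof (rule poly_bound_from_integer_nodes)
      show "degree (U - Q) < card V" using that Q degree_diff_less by blast
      show "\<bar>poly (U - Q) (real n)\<bar> \<le> real M ^ k * A" if "n \<in> V" for n
        using w[of n] that \<open>V \<subseteq> {..<M}\<close> \<open>\<And>n. n \<in> V \<Longrightarrow> poly U (real n) = u (real n)\<close>[of n]
        by (auto simp: w_def)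
    qed (use that y in auto)
    then show ?thesis using that by simp
  qed
  from close[OF T R] close[OF T' R'] show ?thesis by linarith
qed

section \<open>Tensor networks as products of matrices\<close>

text \<open>Entry \<open>l\<close> of the row vector \<open>v\<^sub>1(i\<^sub>1) v\<^sub>2(i\<^sub>2) \<dots> v\<^sub>n\<^sub>+\<^sub>1(i\<^sub>n\<^sub>+\<^sub>1)\<close>.\<close>

primrec tn_state :: "tensor_network \<Rightarrow> (nat \<Rightarrow> nat) \<Rightarrow> nat \<Rightarrow> nat \<Rightarrow> real" where
  "tn_state v i 0 l = tn_first v (i 1) l"
| "tn_state v i (Suc n) l =
     (\<Sum>k=1..tn_rank v (Suc n). tn_state v i n k * tn_mid v (Suc (Suc n)) (i (Suc (Suc n))) k l)"

lemma sum_PiE_path: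
  "(\<Sum>k \<in> (\<Pi>\<^sub>E \<nu>\<in>{1..Suc n}. {1..tn_rank v \<nu>}).
      tn_first v (i 1) (k 1) * (\<Prod>\<nu>=2..Suc n. tn_mid v \<nu> (i \<nu>) (k (\<nu> - 1)) (k \<nu>)) * h (k (Suc n)))
   = (\<Sum>l=1..tn_rank v (Suc n). tn_state v i n l * h l)"
proof (induction n arbitrary: h)
  case 0
  have "(\<Pi>\<^sub>E \<nu>\<in>{Suc 0..Suc 0}. {Suc 0..tn_rank v \<nu>}) =
      (\<lambda>l. (\<lambda>_. undefined)(Suc 0 := l)) ` {Suc 0..tn_rank v (Suc 0)}"
    by (simp add: PiE_insert_eq[where S="{}", simplified] image_iff) auto
  moreover have "inj_on (\<lambda>l. (\<lambda>_. undefined)(Suc 0 := l)) {Suc 0..tn_rank v (Suc 0)}"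
    by (rule inj_onI) (metis fun_upd_same)
  ultimately show ?case by (simp add: sum.reindex o_def)
next
  case (Suc n)
  let ?A = "\<Pi>\<^sub>E \<nu>\<in>{1..Suc n}. {1..tn_rank v \<nu>}"
  let ?B = "{1..tn_rank v (Suc (Suc n))}"
  let ?P = "\<lambda>k. tn_first v (i 1) (k 1) * (\<Prod>\<nu>=2..Suc n. tn_mid v \<nu> (i \<nu>) (k (\<nu> - 1)) (k \<nu>))"
  let ?m = "tn_mid v (Suc (Suc n)) (i (Suc (Suc n)))"
  have ins: "{1..Suc (Suc n)} = insert (Suc (Suc n)) {1..Suc n}" by auto
  have eq: "(\<Pi>\<^sub>E \<nu>\<in>{1..Suc (Suc n)}. {1..tn_rank v \<nu>}) = (\<lambda>(y, g). g(Suc (Suc n) := y)) ` (?B \<times> ?A)"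
    unfolding ins by (rule PiE_insert_eq)
  have inj: "inj_on (\<lambda>(y, g). g(Suc (Suc n) := y)) (?B \<times> ?A)"
    by (rule inj_combinator) simp
  have "(\<Sum>k \<in> (\<Pi>\<^sub>E \<nu>\<in>{1..Suc (Suc n)}. {1..tn_rank v \<nu>}).
      tn_first v (i 1) (k 1) * (\<Prod>\<nu>=2..Suc (Suc n). tn_mid v \<nu> (i \<nu>) (k (\<nu> - 1)) (k \<nu>)) * h (k (Suc (Suc n))))
    = (\<Sum>(y, g)\<in>?B \<times> ?A. ?P g * (?m (g (Suc n)) y * h y))"
    unfolding eq
  proof (subst sum.reindex[OF inj], intro sum.cong refl, clarify, unfold o_def prod.case)
    fix y g
    have "(\<Prod>\<nu>=2..Suc n. tn_mid v \<nu> (i \<nu>) ((g(Suc (Suc n) := y)) (\<nu> - 1)) ((g(Suc (Suc n) := y)) \<nu>))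
        = (\<Prod>\<nu>=2..Suc n. tn_mid v \<nu> (i \<nu>) (g (\<nu> - 1)) (g \<nu>))"
      by (intro prod.cong refl) auto
    then show "tn_first v (i 1) ((g(Suc (Suc n) := y)) 1) *
        (\<Prod>\<nu>=2..Suc (Suc n). tn_mid v \<nu> (i \<nu>) ((g(Suc (Suc n) := y)) (\<nu> - 1)) ((g(Suc (Suc n) := y)) \<nu>)) *
        h ((g(Suc (Suc n) := y)) (Suc (Suc n))) = ?P g * (?m (g (Suc n)) y * h y)"
      by (simp add: prod.nat_ivl_Suc' mult_ac)
  qed
  also have "\<dots> = (\<Sum>y\<in>?B. \<Sum>g\<in>?A. ?P g * (?m (g (Suc n)) y * h y))"
    by (simp add: sum.cartesian_product)
  also have "\<dots> = (\<Sum>y\<in>?B. tn_state v i (Suc n) y * h y)"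
    by (intro sum.cong refl, subst Suc.IH) (simp add: sum_distrib_right mult.assoc)
  finally show ?case .
qed

lemma tn_value_eq_state:
  assumes "tn_depth v = Suc n"
  shows "tn_value m \<phi> v i y =
    (\<Sum>k=1..tn_rank v (Suc n). tn_state v i n k * (\<Sum>l=1..m + 1. tn_last v k l * poly (\<phi> l) y))"
proof -
  have "tn_value m \<phi> v i y = (\<Sum>k \<in> (\<Pi>\<^sub>E \<nu>\<in>{1..Suc n}. {1..tn_rank v \<nu>}).
      tn_first v (i 1) (k 1) * (\<Prod>\<nu>=2..Suc n. tn_mid v \<nu> (i \<nu>) (k (\<nu> - 1)) (k \<nu>))
        * (\<lambda>k. \<Sum>l=1..m + 1. tn_last v k l * poly (\<phi> l) y) (k (Suc n)))"
    unfolding tn_value_def assms by (simp only: sum_distrib_left mult.assoc)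
  also have "\<dots> = (\<Sum>k=1..tn_rank v (Suc n).
      tn_state v i n k * (\<Sum>l=1..m + 1. tn_last v k l * poly (\<phi> l) y))"
    by (rule sum_PiE_path)
  finally show ?thesis .
qed

section \<open>Base-\<open>b\<close> digits and cells\<close>

text \<open>The index of the cell of level \<open>j\<close> containing \<open>x\<close>, and the integer with the base-\<open>b\<close> digits
  \<open>i\<^sub>1, \<dots>, i\<^sub>n\<close>; both agree at the points with these leading digits (\<open>cell_of_digits\<close>).\<close>

definition cell :: "nat \<Rightarrow> nat \<Rightarrow> real \<Rightarrow> nat" where
  "cell b j x = nat \<lfloor>real b ^ j * x\<rfloor>"

primrec leading :: "nat \<Rightarrow> (nat \<Rightarrow> nat) \<Rightarrow> nat \<Rightarrow> nat" where
  "leading b i 0 = 0"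
| "leading b i (Suc n) = b * leading b i n + i (Suc n)"

lemma real_leading:
  assumes "0 < b"
  shows "real (leading b i n) = real b ^ n * (\<Sum>k=1..n. real (i k) / real b ^ k)"
proof (induction n)
  case (Suc n)
  have "real b ^ Suc n * (\<Sum>k=1..Suc n. real (i k) / real b ^ k)
     = real b * (real b ^ n * (\<Sum>k=1..n. real (i k) / real b ^ k)) + real (i (Suc n))"
    using assms by (simp add: distrib_left)
  then show ?case by (simp add: Suc.IH)
qed simp

lemma leading_div:
  assumes "\<And>k. 1 \<le> k \<Longrightarrow> k \<le> n \<Longrightarrow> i k < b" "l \<le> n"
  shows "leading b i n div b ^ (n - l) = leading b i l"
  using assms
proof (induction n)
  case (Suc n)
  show ?case
  proof (cases "l = Suc n")
    case False
    then have l: "l \<le> n" using Suc.prems by simp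
    have ib: "i (Suc n) < b" using Suc.prems(1)[of "Suc n"] by simp
    have "leading b i (Suc n) div b = leading b i n" using ib by simp
    then have "leading b i (Suc n) div b ^ Suc (n - l) = leading b i n div b ^ (n - l)"
      by (simp only: power_Suc div_mult2_eq)
    then show ?thesis using Suc l by (simp add: Suc_diff_le)
  qed simp
qed simp

lemma cell_0: "x \<in> {0..<1} \<Longrightarrow> cell b 0 x = 0"
  by (simp add: cell_def nat_eq_iff floor_eq_iff)

lemma cell_eq_iff:
  assumes "0 < b" "0 \<le> x"
  shows "cell b j x = a \<longleftrightarrow> real a \<le> real b ^ j * x \<and> real b ^ j * x < real a + 1"
  using assms by (auto simp: cell_def nat_eq_iff floor_eq_iff zero_le_mult_iff)

lemma cell_bounds:
  assumes "0 < b" "0 \<le> x"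
  shows "real (cell b j x) \<le> real b ^ j * x" "real b ^ j * x < real (cell b j x) + 1"
  using cell_eq_iff[OF assms, of j "cell b j x"] by auto

lemma cell_less:
  assumes "0 < b" "x \<in> {0..<1}"
  shows "cell b j x < b ^ j"
proof -
  have "real (cell b j x) \<le> real b ^ j * x" using assms by (intro cell_bounds) auto
  also have "\<dots> < real b ^ j" using assms by simp
  finally show ?thesis by (metis of_nat_less_iff of_nat_power)
qed

lemma cell_div:
  assumes "0 < b" "0 \<le> x" "l \<le> d"
  shows "cell b l x = cell b d x div b ^ (d - l)"
proof -
  have "real b ^ d = real b ^ l * real (b ^ (d - l))"
    using assms by (simp flip: power_add)
  then have "real b ^ l * x = (real b ^ d * x) / real (b ^ (d - l))"
    using assms by simp
  then have "\<lfloor>real b ^ l * x\<rfloor> = \<lfloor>real b ^ d * x\<rfloor> div int (b ^ (d - l))"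
    using floor_divide_real_eq_div[of "int (b ^ (d - l))" "real b ^ d * x"] by simp
  then show ?thesis using assms by (simp add: cell_def nat_div_distrib zero_le_mult_iff nat_power_eq)
qed

lemma cell_Suc_div: "0 < b \<Longrightarrow> 0 \<le> x \<Longrightarrow> cell b (Suc j) x div b = cell b j x"
  using cell_div[of b x j "Suc j"] by simp

lemma cell_of_digits:
  assumes "0 < b" "0 \<le> y" "y < 1"
  shows "cell b d ((\<Sum>k=1..d. real (i k) / real b ^ k) + y / real b ^ d) = leading b i d"
proof -
  have "real b ^ d * ((\<Sum>k=1..d. real (i k) / real b ^ k) + y / real b ^ d) = real (leading b i d) + y"
    using assms by (simp add: distrib_left real_leading)
  then show ?thesis using assms unfolding cell_def by (simp add: nat_eq_iff floor_eq_iff)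
qed

lemma measurable_cell [measurable]: "cell b j \<in> measurable borel (count_space UNIV)"
  unfolding cell_def[abs_def] by measurable

section \<open>Step functions with sparse tensor networks\<close>

lemma basis_expansion_of_one:
  assumes "is_poly_basis m \<phi>"
  obtains c where "\<And>y. (\<Sum>l=1..m + 1. c l * poly (\<phi> l) y) = 1"
proof -
  have inj: "inj_on \<phi> {1..m + 1}" and sp: "poly_vs.span (\<phi> ` {1..m + 1}) = {g. degree g \<le> m}"
    using assms by (auto simp: is_poly_basis_def)
  have "(1::real poly) \<in> poly_vs.span (\<phi> ` {1..m + 1})" unfolding sp by simp
  then obtain u where u: "(1::real poly) = (\<Sum>v\<in>\<phi> ` {1..m + 1}. smult (u v) v)"
    by (auto simp: poly_vs.span_finite)
  then have "(1::real poly) = (\<Sum>l=1..m + 1. smult (u (\<phi> l)) (\<phi> l))"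
    using inj by (simp add: sum.reindex)
  then have "(\<Sum>l=1..m + 1. u (\<phi> l) * poly (\<phi> l) y) = 1" for y
    by (metis (mono_tags, lifting) poly_1 poly_smult poly_sum sum.cong)
  then show ?thesis using that[of "\<lambda>l. u (\<phi> l)"] by blast
qed

text \<open>The states of the network for a sum of \<open>M\<close> polynomials \<open>Q t\<close>, each restricted to a cell \<open>a t\<close> of
  level \<open>L t\<close>, are pairs \<open>(t, s)\<close> encoded as \<open>t * k + s + 1\<close>. After reading \<open>\<nu>\<close> digits the state
  \<open>(t, s)\<close> carries \<open>x\<^sub>\<nu>\<^sup>s\<close>, where \<open>x\<^sub>\<nu>\<close> is the number with these digits, as long as they agree with
  those of the cell. The binomial theorem makes \<open>x\<^sub>\<nu>\<^sup>s\<close> linear in the powers of \<open>x\<^sub>\<nu>\<^sub>-\<^sub>1\<close>; states of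
  different \<open>t\<close> do not interact, which is why the cores are sparse.\<close>

definition digit_ok :: "nat \<Rightarrow> nat \<Rightarrow> nat \<Rightarrow> nat \<Rightarrow> nat \<Rightarrow> bool" where
  "digit_ok b L a \<nu> i \<longleftrightarrow> (\<nu> \<le> L \<longrightarrow> i = (a div b ^ (L - \<nu>)) mod b)"

definition cells_network ::
    "nat \<Rightarrow> nat \<Rightarrow> (nat \<Rightarrow> real) \<Rightarrow> nat \<Rightarrow> nat \<Rightarrow> (nat \<Rightarrow> nat) \<Rightarrow> (nat \<Rightarrow> nat) \<Rightarrow> (nat \<Rightarrow> real poly)
      \<Rightarrow> tensor_network" where
  "cells_network b k c d M L a Q = \<lparr>
     tn_depth = d,
     tn_rank = (\<lambda>_. M * k),
     tn_first = (\<lambda>i l. let t = (l - 1) div k; s = (l - 1) mod k in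
        if digit_ok b (L t) (a t) 1 i then (real i / real b) ^ s else 0),
     tn_mid = (\<lambda>\<nu> i l l'. let t = (l - 1) div k; s = (l - 1) mod k;
                              t' = (l' - 1) div k; s' = (l' - 1) mod k in
        if t = t' \<and> s \<le> s' \<and> digit_ok b (L t) (a t) \<nu> i
        then real (s' choose s) * (real i / real b ^ \<nu>) ^ (s' - s) else 0),
     tn_last = (\<lambda>l n. coeff (Q ((l - 1) div k)) ((l - 1) mod k) * c n) \<rparr>"

lemma sum_pairs_encoded:
  fixes F :: "nat \<Rightarrow> real"
  assumes "0 < k"
  shows "(\<Sum>l=1..M * k. F l) = (\<Sum>t<M. \<Sum>s<k. F (Suc (t * k + s)))"
proof -
  have "(\<Sum>l=1..M * k. F l) = (\<Sum>l<M * k. F (Suc l))"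
    by (rule sum.reindex_bij_witness[of _ Suc "\<lambda>l. l - 1"]) auto
  also have "\<dots> = (\<Sum>t<M. \<Sum>l\<in>{t * k..<t * k + k}. F (Suc l))"
    by (rule sum.nat_group[symmetric])
  also have "\<dots> = (\<Sum>t<M. \<Sum>s<k. F (Suc (t * k + s)))"
  proof (rule sum.cong[OF refl])
    fix t
    show "(\<Sum>l\<in>{t * k..<t * k + k}. F (Suc l)) = (\<Sum>s<k. F (Suc (t * k + s)))"
      by (rule sum.reindex_bij_witness[of _ "\<lambda>s. t * k + s" "\<lambda>l. l - t * k"]) auto
  qed
  finally show ?thesis .
qed

text \<open>Read from the left, the digits agree with those of \<open>a\<close> so far iff their integer is the quotient
  of \<open>a\<close> by a power of \<open>b\<close>.\<close>

lemma digit_ok_step: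
  assumes "i < b" "Suc \<nu> \<le> L"
  shows "a div b ^ (L - Suc \<nu>) = b * N + i \<longleftrightarrow> a div b ^ (L - \<nu>) = N \<and> digit_ok b L a (Suc \<nu>) i"
proof -
  have e: "b ^ (L - \<nu>) = b ^ (L - Suc \<nu>) * b"
    using assms by (metis Suc_diff_Suc Suc_le_lessD power_Suc2)
  let ?A = "a div b ^ (L - Suc \<nu>)"
  have "?A = b * N + i \<longleftrightarrow> ?A div b = N \<and> i = ?A mod b"
  proof
    assume "?A = b * N + i"
    then show "?A div b = N \<and> i = ?A mod b" using assms(1) by simp
  next
    assume "?A div b = N \<and> i = ?A mod b"
    then show "?A = b * N + i" using mult_div_mod_eq[of b ?A] by simp
  qed
  then show ?thesis using assms by (simp add: digit_ok_def e div_mult2_eq)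
qed

text \<open>The minimum stops the comparison once the \<open>L t\<close> digits of the cell have been read.\<close>

lemma cells_network_state:
  fixes i :: "nat \<Rightarrow> nat"
  assumes b: "0 < b" and k: "0 < k" and t: "t < M" and s: "s < k" and a: "a t < b ^ L t"
    and i: "\<And>\<nu>. 1 \<le> \<nu> \<Longrightarrow> \<nu> \<le> Suc n \<Longrightarrow> i \<nu> < b"
  shows "tn_state (cells_network b k c d M L a Q) i n (Suc (t * k + s)) =
    (if a t div b ^ (L t - Suc n) = leading b i (min (Suc n) (L t))
     then (real (leading b i (Suc n)) / real b ^ Suc n) ^ s else 0)"
  using s i
proof (induction n arbitrary: s)
  case 0
  have "digit_ok b (L t) (a t) 1 (i 1) \<longleftrightarrow> a t div b ^ (L t - Suc 0) = leading b i (min (Suc 0) (L t))"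
  proof (cases "L t = 0")
    case True
    then show ?thesis using a by (simp add: digit_ok_def)
  next
    case False
    then have "a t div b ^ (L t - Suc 0) < b"
      using a b by (metis One_nat_def Suc_pred less_mult_imp_div_less neq0_conv power_Suc)
    then show ?thesis using False by (auto simp: digit_ok_def min_def)
  qed
  then show ?case using 0 k by (simp add: cells_network_def)
next
  case (Suc n)
  let ?v = "cells_network b k c d M L a Q"
  let ?ok = "\<lambda>n. a t div b ^ (L t - n) = leading b i (min n (L t))"
  let ?x = "\<lambda>n. real (leading b i n) / real b ^ n"
  let ?i = "i (Suc (Suc n))"
  have ib: "?i < b" using Suc.prems by simp
  have IH: "tn_state ?v i n (Suc (t * k + s')) = (if ?ok (Suc n) then ?x (Suc n) ^ s' else 0)" if "s' < k" for s'
    using Suc.IH[OF that] Suc.prems(2) by simp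
  have ok: "?ok (Suc (Suc n)) \<longleftrightarrow> ?ok (Suc n) \<and> digit_ok b (L t) (a t) (Suc (Suc n)) ?i"
  proof (cases "Suc (Suc n) \<le> L t")
    case True
    then show ?thesis using digit_ok_step[OF ib True, of "a t" "leading b i (Suc n)"]
      by (simp add: min_def)
  next
    case False
    then have "min (Suc (Suc n)) (L t) = L t" "min (Suc n) (L t) = L t" "L t - Suc n = 0" "L t - Suc (Suc n) = 0"
      by auto
    then show ?thesis using False by (simp add: digit_ok_def)
  qed
  have xs: "?x (Suc (Suc n)) = ?x (Suc n) + real ?i / real b ^ Suc (Suc n)"
    using b by (simp add: field_simps)
  have mid: "tn_mid ?v (Suc (Suc n)) ?i (Suc (t' * k + s')) (Suc (t * k + s)) =
      (if t' = t then if s' \<le> s \<and> digit_ok b (L t) (a t) (Suc (Suc n)) ?i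
        then real (s choose s') * (real ?i / real b ^ Suc (Suc n)) ^ (s - s') else 0 else 0)"
    if "s' < k" for t' s'
    using that Suc.prems(1) by (simp add: cells_network_def)
  have "tn_state ?v i (Suc n) (Suc (t * k + s)) =
     (\<Sum>t'<M. \<Sum>s'<k. tn_state ?v i n (Suc (t' * k + s')) *
        tn_mid ?v (Suc (Suc n)) ?i (Suc (t' * k + s')) (Suc (t * k + s)))"
    by (simp add: sum_pairs_encoded[OF k] cells_network_def del: One_nat_def)
  also have "\<dots> = (\<Sum>t'<M. if t' = t then (\<Sum>s'<k. tn_state ?v i n (Suc (t * k + s')) *
      (if s' \<le> s \<and> digit_ok b (L t) (a t) (Suc (Suc n)) ?i
        then real (s choose s') * (real ?i / real b ^ Suc (Suc n)) ^ (s - s') else 0)) else 0)"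
    by (intro sum.cong refl) (auto simp: mid intro!: sum.cong sum.neutral)
  also have "\<dots> = (\<Sum>s'<k. tn_state ?v i n (Suc (t * k + s')) *
      (if s' \<le> s \<and> digit_ok b (L t) (a t) (Suc (Suc n)) ?i
        then real (s choose s') * (real ?i / real b ^ Suc (Suc n)) ^ (s - s') else 0))"
    using t by simp
  also have "\<dots> = (\<Sum>s'<k. if s' \<le> s then (if ?ok (Suc (Suc n))
        then real (s choose s') * ?x (Suc n) ^ s' * (real ?i / real b ^ Suc (Suc n)) ^ (s - s') else 0) else 0)"
    by (intro sum.cong refl) (auto simp only: IH ok lessThan_iff split: if_split; simp add: mult_ac)
  also have "\<dots> = (\<Sum>s'\<le>s. (if ?ok (Suc (Suc n))
        then real (s choose s') * ?x (Suc n) ^ s' * (real ?i / real b ^ Suc (Suc n)) ^ (s - s') else 0))"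
    using Suc.prems(1) by (intro sum.mono_neutral_cong_right) auto
  also have "\<dots> = (if ?ok (Suc (Suc n)) then ?x (Suc (Suc n)) ^ s else 0)"
  proof (cases "?ok (Suc (Suc n))")
    case True
    show ?thesis unfolding if_P[OF True] xs by (rule binomial_ring[symmetric])
  next
    case False
    show ?thesis by (simp only: if_not_P[OF False] sum.neutral_const)
  qed
  finally show ?case .
qed

lemma cells_network_realizes:
  assumes b: "0 < b" and k: "0 < k" and d: "1 \<le> d" and L: "\<And>t. t < M \<Longrightarrow> L t \<le> d"
    and a: "\<And>t. t < M \<Longrightarrow> a t < b ^ L t" and Q: "\<And>t. t < M \<Longrightarrow> degree (Q t) < k"
    and c: "\<And>y. (\<Sum>l=1..m + 1. c l * poly (\<phi> l) y) = 1"
  shows "realizes b m \<phi> (cells_network b k c d M L a Q)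
     (\<lambda>x. \<Sum>t<M. if cell b (L t) x = a t then poly (Q t) (real (cell b d x) / real b ^ d) else 0)"
  unfolding realizes_def tensorization_def
proof (intro ballI)
  let ?v = "cells_network b k c d M L a Q"
  fix i y assume i: "i \<in> {1..tn_depth ?v} \<rightarrow> {0..<b}" and y: "y \<in> {0..<1::real}"
  have dep: "tn_depth ?v = d" by (simp add: cells_network_def)
  obtain n where n: "d = Suc n" using d by (cases d) auto
  have i': "i \<nu> < b" if "1 \<le> \<nu>" "\<nu> \<le> d" for \<nu> using i that by (auto simp: dep)
  define x where "x = (\<Sum>k=1..d. real (i k) / real b ^ k) + y / real b ^ d"
  have x0: "0 \<le> x" using y by (auto simp: x_def intro!: add_nonneg_nonneg sum_nonneg)
  have cd: "cell b d x = leading b i d" using cell_of_digits[OF b] y by (simp add: x_def)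
  have cl: "cell b l x = leading b i l" if "l \<le> d" for l
    using cell_div[OF b x0 that] leading_div[of d i b l] i' that cd by simp
  have lsum: "(\<Sum>l=1..m + 1. tn_last ?v (Suc (t * k + s)) l * poly (\<phi> l) y) = coeff (Q t) s"
    if "s < k" for t s
    using that by (simp add: cells_network_def mult.assoc sum_distrib_left[symmetric] c del: One_nat_def)
  have state: "tn_state ?v i n (Suc (t * k + s)) =
     (if cell b (L t) x = a t then (real (cell b d x) / real b ^ d) ^ s else 0)" if "t < M" "s < k" for t s
  proof -
    have "a t div b ^ (L t - Suc n) = a t" "min (Suc n) (L t) = L t" using L[OF that(1)] n by auto
    moreover have "leading b i (L t) = cell b (L t) x" "leading b i (Suc n) = cell b d x"
      using cl[of "L t"] L[OF that(1)] cd n by auto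
    ultimately show ?thesis
      using cells_network_state[OF b k that, of a L n i c d Q] a[OF that(1)] i' n by auto
  qed
  have "tn_value m \<phi> ?v i y = (\<Sum>t<M. \<Sum>s<k. tn_state ?v i n (Suc (t * k + s)) *
      (\<Sum>l=1..m + 1. tn_last ?v (Suc (t * k + s)) l * poly (\<phi> l) y))"
    by (subst tn_value_eq_state[of _ n])
       (simp_all add: dep n sum_pairs_encoded[OF k] cells_network_def del: One_nat_def)
  also have "\<dots> = (\<Sum>t<M. \<Sum>s<k. (if cell b (L t) x = a t then (real (cell b d x) / real b ^ d) ^ s else 0) * coeff (Q t) s)"
    by (intro sum.cong refl) (simp only: state lsum lessThan_iff)
  also have "\<dots> = (\<Sum>t<M. if cell b (L t) x = a t then poly (Q t) (real (cell b d x) / real b ^ d) else 0)"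
  proof (intro sum.cong refl)
    fix t assume "t \<in> {..<M}"
    then have "poly (Q t) z = (\<Sum>s<k. coeff (Q t) s * z ^ s)" for z :: real
      using Q[of t] unfolding poly_altdef
      by (intro sum.mono_neutral_left) (auto simp: coeff_eq_0)
    then show "(\<Sum>s<k. (if cell b (L t) x = a t then (real (cell b d x) / real b ^ d) ^ s else 0) * coeff (Q t) s)
       = (if cell b (L t) x = a t then poly (Q t) (real (cell b d x) / real b ^ d) else 0)"
      by (simp add: mult.commute)
  qed
  finally show "(\<Sum>t<M. if cell b (L t) ((\<Sum>k=1..tn_depth ?v. real (i k) / real b ^ k) + y / real b ^ tn_depth ?v) = a t
       then poly (Q t) (real (cell b d ((\<Sum>k=1..tn_depth ?v. real (i k) / real b ^ k) + y / real b ^ tn_depth ?v)) / real b ^ d) else 0)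
     = tn_value m \<phi> ?v i y"
    by (simp only: dep x_def)
qed

lemma cells_network_valid:
  "1 \<le> d \<Longrightarrow> 0 < M \<Longrightarrow> 0 < k \<Longrightarrow> is_tensor_network (cells_network b k c d M L a Q)"
  by (auto simp: is_tensor_network_def cells_network_def Suc_le_eq)

lemma compl_N_cells_network: "compl_N (cells_network b k c d M L a Q) = d * (M * k)"
  by (simp add: compl_N_def cells_network_def)

lemma compl_S_cells_network:
  assumes k: "0 < k" and d: "1 \<le> d"
  shows "compl_S b m (cells_network b k c d M L a Q) \<le> d * M * (b * k + b * k * k + k * (m + 1))"
proof -
  let ?v = "cells_network b k c d M L a Q"
  have c1: "card {(i, l). i \<in> {0..<b} \<and> l \<in> {1..tn_rank ?v 1} \<and> tn_first ?v i l \<noteq> 0} \<le> b * (M * k)"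
  proof -
    have "card {(i, l). i \<in> {0..<b} \<and> l \<in> {1..tn_rank ?v 1} \<and> tn_first ?v i l \<noteq> 0}
        \<le> card ({0..<b} \<times> {1..M * k})"
      by (intro card_mono) (auto simp: cells_network_def)
    then show ?thesis by simp
  qed
  have c3: "card {(l, n). l \<in> {1..tn_rank ?v (tn_depth ?v)} \<and> n \<in> {1..m + 1} \<and> tn_last ?v l n \<noteq> 0}
      \<le> M * k * (m + 1)"
  proof -
    have "card {(l, n). l \<in> {1..tn_rank ?v (tn_depth ?v)} \<and> n \<in> {1..m + 1} \<and> tn_last ?v l n \<noteq> 0}
        \<le> card ({1..M * k} \<times> {1..m + 1})"
      by (intro card_mono) (auto simp: cells_network_def)
    then show ?thesis by simp
  qed
  have c2: "card {(i, l, l'). i \<in> {0..<b} \<and> l \<in> {1..tn_rank ?v (\<nu> - 1)} \<and> l' \<in> {1..tn_rank ?v \<nu>}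
                  \<and> tn_mid ?v \<nu> i l l' \<noteq> 0} \<le> b * (M * k) * k" (is "card ?X \<le> _") for \<nu>
  proof -
    have "?X \<subseteq> (\<lambda>(i, l, s'). (i, l, Suc ((l - 1) div k * k + s'))) ` ({0..<b} \<times> {1..M * k} \<times> {..<k})"
    proof
      fix z assume "z \<in> ?X"
      then obtain i l l' where z: "z = (i, l, l')" "i \<in> {0..<b}" "l \<in> {1..M * k}" "l' \<in> {1..M * k}"
        "(l - 1) div k = (l' - 1) div k"
        by (auto simp: cells_network_def Let_def split: if_splits)
      then have "l' = Suc ((l - 1) div k * k + (l' - 1) mod k)" by simp
      then show "z \<in> (\<lambda>(i, l, s'). (i, l, Suc ((l - 1) div k * k + s'))) ` ({0..<b} \<times> {1..M * k} \<times> {..<k})"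
        using z k by (intro image_eqI[of _ _ "(i, l, (l' - 1) mod k)"]) auto
    qed
    then have "card ?X \<le> card ({0..<b} \<times> {1..M * k} \<times> {..<k})"
      by (rule surj_card_le[rotated]) simp
    then show ?thesis by (simp add: mult.assoc)
  qed
  have "compl_S b m ?v \<le> b * (M * k) + (\<Sum>\<nu>=2..d. b * (M * k) * k) + M * k * (m + 1)"
    unfolding compl_S_def
    by (intro add_mono c1 c3 order_trans[OF sum_mono[OF c2]]) (simp add: cells_network_def)
  also have "\<dots> \<le> d * (b * (M * k)) + d * (b * (M * k) * k) + d * (M * k * (m + 1))"
    using d by (intro add_mono) auto
  also have "\<dots> = d * M * (b * k + b * k * k + k * (m + 1))" by (simp add: algebra_simps)
  finally show ?thesis .
qed

section \<open>Integration over the unit interval\<close>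

lemma powr_convex_nonneg:
  fixes u v l p :: real
  assumes "0 \<le> u" "0 \<le> v" "0 < l" "l < 1" "1 \<le> p"
  shows "(l * u + (1 - l) * v) powr p \<le> l * u powr p + (1 - l) * v powr p"
proof -
  have le: "c powr p \<le> c" if "0 < c" "c < 1" for c :: real
    using powr_mono'[of 1 p c] that assms(5) by simp
  consider "u = 0" | "v = 0" | "0 < u" "0 < v" using assms by fastforce
  then show ?thesis
  proof cases
    case 1
    then show ?thesis using assms le[of "1 - l"] by (simp add: powr_mult mult_right_mono)
  next
    case 2
    then show ?thesis using assms le[of l] by (simp add: powr_mult mult_right_mono)
  next
    case 3
    then show ?thesis using convex_onD[OF powr_convex[OF assms(5)], of "1 - l" u v] assms by simp
  qed
qed

text \<open>Minkowski's inequality from convexity: \<open>f + g\<close> is \<open>A + B\<close> times a convex combination of the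
  normalized functions \<open>f / A\<close> and \<open>g / B\<close>.\<close>

lemma minkowski_pos:
  fixes f g :: "'a \<Rightarrow> real"
  assumes [measurable]: "f \<in> borel_measurable M" "g \<in> borel_measurable M"
    and p: "1 \<le> p" and AB: "0 < A" "0 < B"
    and f: "(\<integral>\<^sup>+x. ennreal (\<bar>f x\<bar> powr p) \<partial>M) \<le> ennreal (A powr p)"
    and g: "(\<integral>\<^sup>+x. ennreal (\<bar>g x\<bar> powr p) \<partial>M) \<le> ennreal (B powr p)"
  shows "(\<integral>\<^sup>+x. ennreal (\<bar>f x + g x\<bar> powr p) \<partial>M) \<le> ennreal ((A + B) powr p)"
proof -
  let ?D = "(A + B) powr p"
  let ?a = "?D * (A / (A + B)) / A powr p" and ?b = "?D * (B / (A + B)) / B powr p"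
  have l: "0 < A / (A + B)" "A / (A + B) < 1" "1 - A / (A + B) = B / (A + B)"
    using AB by (auto simp: field_simps)
  have scale: "D * (A / D * (F / A) + B / D * (G / B)) = F + G" if "0 < D" for D F G :: real
    using AB that by (simp add: field_simps)
  have pt: "\<bar>f x + g x\<bar> powr p \<le> ?a * \<bar>f x\<bar> powr p + ?b * \<bar>g x\<bar> powr p" for x
  proof -
    have "\<bar>f x + g x\<bar> powr p \<le> (\<bar>f x\<bar> + \<bar>g x\<bar>) powr p"
      using p by (intro powr_mono2) auto
    also have "\<bar>f x\<bar> + \<bar>g x\<bar> = (A + B) * (A / (A + B) * (\<bar>f x\<bar> / A) + (1 - A / (A + B)) * (\<bar>g x\<bar> / B))"
      using scale[of "A + B" "\<bar>f x\<bar>" "\<bar>g x\<bar>"] AB by (simp only: l)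
    also have "\<dots> powr p = ?D * (A / (A + B) * (\<bar>f x\<bar> / A) + (1 - A / (A + B)) * (\<bar>g x\<bar> / B)) powr p"
      by (rule powr_mult)
    also have "\<dots> \<le> ?D * (A / (A + B) * (\<bar>f x\<bar> / A) powr p + (1 - A / (A + B)) * (\<bar>g x\<bar> / B) powr p)"
      using AB l p by (intro mult_left_mono powr_convex_nonneg) auto
    also have "\<dots> = ?a * \<bar>f x\<bar> powr p + ?b * \<bar>g x\<bar> powr p"
      using AB by (simp only: l) (simp add: powr_divide algebra_simps)
    finally show ?thesis .
  qed
  have "(\<integral>\<^sup>+x. ennreal (\<bar>f x + g x\<bar> powr p) \<partial>M)
      \<le> (\<integral>\<^sup>+x. ennreal ?a * ennreal (\<bar>f x\<bar> powr p) + ennreal ?b * ennreal (\<bar>g x\<bar> powr p) \<partial>M)"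
    using pt AB by (intro nn_integral_mono) (simp flip: ennreal_mult ennreal_plus)
  also have "\<dots> = ennreal ?a * (\<integral>\<^sup>+x. ennreal (\<bar>f x\<bar> powr p) \<partial>M) + ennreal ?b * (\<integral>\<^sup>+x. ennreal (\<bar>g x\<bar> powr p) \<partial>M)"
    by (simp add: nn_integral_add nn_integral_cmult)
  also have "\<dots> \<le> ennreal ?a * ennreal (A powr p) + ennreal ?b * ennreal (B powr p)"
    by (intro add_mono mult_left_mono f g) auto
  also have "\<dots> = ennreal (?a * A powr p + ?b * B powr p)"
    using AB by (simp flip: ennreal_mult ennreal_plus)
  also have "?a * A powr p + ?b * B powr p = ?D * (A / (A + B) + B / (A + B))"
    using AB by (simp add: distrib_left)
  also have "\<dots> = ?D" using AB by (simp flip: add_divide_distrib)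
  finally show ?thesis .
qed

lemma minkowski:
  fixes f g :: "'a \<Rightarrow> real"
  assumes [measurable]: "f \<in> borel_measurable M" "g \<in> borel_measurable M"
    and p: "1 \<le> p" and AB: "0 \<le> A" "0 \<le> B"
    and f: "(\<integral>\<^sup>+x. ennreal (\<bar>f x\<bar> powr p) \<partial>M) \<le> ennreal (A powr p)"
    and g: "(\<integral>\<^sup>+x. ennreal (\<bar>g x\<bar> powr p) \<partial>M) \<le> ennreal (B powr p)"
  shows "(\<integral>\<^sup>+x. ennreal (\<bar>f x + g x\<bar> powr p) \<partial>M) \<le> ennreal ((A + B) powr p)"
proof (rule tendsto_lowerbound)
  show "((\<lambda>e. ennreal ((A + e + (B + e)) powr p)) \<longlongrightarrow> ennreal ((A + B) powr p)) (at_right 0)"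
  proof (rule tendsto_ennrealI)
    have "((\<lambda>e. (A + e + (B + e)) powr p) \<longlongrightarrow> (A + 0 + (B + 0)) powr p) (at_right 0)"
      using p AB by (intro tendsto_powr' tendsto_intros)
        (auto simp: eventually_at_filter intro!: always_eventually)
    then show "((\<lambda>e. (A + e + (B + e)) powr p) \<longlongrightarrow> (A + B) powr p) (at_right 0)" by simp
  qed
  show "\<forall>\<^sub>F e in at_right 0. (\<integral>\<^sup>+x. ennreal (\<bar>f x + g x\<bar> powr p) \<partial>M) \<le> ennreal ((A + e + (B + e)) powr p)"
    using eventually_at_right_less[of 0]
  proof eventually_elim
    case (elim e)
    have "A powr p \<le> (A + e) powr p" "B powr p \<le> (B + e) powr p"
      using elim AB p by (auto intro!: powr_mono2)
    then show ?case
      using AB elim f g by (intro minkowski_pos p) (auto intro: order_trans ennreal_leI)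
  qed
qed simp

lemma minkowski_sum:
  fixes f :: "'b \<Rightarrow> 'a \<Rightarrow> real"
  assumes "finite I" and p: "1 \<le> p"
    and "\<And>i. i \<in> I \<Longrightarrow> f i \<in> borel_measurable M" "\<And>i. i \<in> I \<Longrightarrow> 0 \<le> A i"
    and "\<And>i. i \<in> I \<Longrightarrow> (\<integral>\<^sup>+x. ennreal (\<bar>f i x\<bar> powr p) \<partial>M) \<le> ennreal (A i powr p)"
  shows "(\<integral>\<^sup>+x. ennreal (\<bar>\<Sum>i\<in>I. f i x\<bar> powr p) \<partial>M) \<le> ennreal ((\<Sum>i\<in>I. A i) powr p)"
  using assms(1,3-)
proof (induction I)
  case empty
  then show ?case using p by simp
next
  case (insert i I)
  have "(\<integral>\<^sup>+x. ennreal (\<bar>f i x + (\<Sum>i\<in>I. f i x)\<bar> powr p) \<partial>M) \<le> ennreal ((A i + (\<Sum>i\<in>I. A i)) powr p)"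
    using insert.prems by (intro minkowski p insert.IH borel_measurable_sum sum_nonneg) auto
  then show ?case using insert.hyps by simp
qed

lemma indicator_unit_split:
  assumes "0 < N"
  shows "indicator {0..<1} x = (\<Sum>l<N. indicator {real l / real N..<real (Suc l) / real N} x :: ennreal)"
proof (cases "x \<in> {0..<1}")
  case True
  define a where "a = nat \<lfloor>real N * x\<rfloor>"
  have N0: "0 \<le> real N * x" "real N * x < real N" using True assms by auto
  have a: "a < N" using N0 unfolding a_def by linarith
  have "indicator {real l / real N..<real (Suc l) / real N} x = (if l = a then 1 else 0 :: ennreal)" for l
  proof -
    have "x \<in> {real l / real N..<real (Suc l) / real N} \<longleftrightarrow> real l \<le> real N * x \<and> real N * x < real l + 1"
      using assms by (auto simp: field_simps)
    also have "\<dots> \<longleftrightarrow> l = a" unfolding a_def using N0 by linarith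
    finally show ?thesis by (simp add: indicator_def)
  qed
  then show ?thesis using True a by simp
next
  case False
  have "x \<notin> {real l / real N..<real (Suc l) / real N}" if "l < N" for l
  proof
    assume x: "x \<in> {real l / real N..<real (Suc l) / real N}"
    then have "0 \<le> x" by (auto intro: order_trans[rotated])
    moreover have "real (Suc l) / real N \<le> 1" using that assms by simp
    then have "x < 1" using x by (auto intro: less_le_trans)
    ultimately show False using False by simp
  qed
  then show ?thesis using False by simp
qed

text \<open>The sum of \<open>G\<close> over the points in \<open>[0,1)\<close> of the grid of step \<open>1/N\<close> through \<open>\<xi>\<close>.\<close>

definition grid_sum :: "nat \<Rightarrow> (real \<Rightarrow> ennreal) \<Rightarrow> real \<Rightarrow> ennreal" where
  "grid_sum N G \<xi> = (\<Sum>n<N. G ((real n + frac (real N * \<xi>)) / real N))"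

lemma measurable_frac [measurable]: "(frac :: real \<Rightarrow> real) \<in> borel_measurable borel"
  unfolding frac_def by measurable

lemma measurable_grid_sum [measurable]:
  assumes [measurable]: "G \<in> borel_measurable borel"
  shows "grid_sum N G \<in> borel_measurable borel"
  unfolding grid_sum_def[abs_def] by measurable

text \<open>If \<open>\<xi>\<close> is uniform, then each grid point is uniform on its cell.\<close>

lemma nn_integral_grid_sum:
  assumes [measurable]: "G \<in> borel_measurable borel" and N: "0 < N"
  shows "(\<integral>\<^sup>+\<xi>\<in>{0..<1}. grid_sum N G \<xi> \<partial>lborel) = of_nat N * (\<integral>\<^sup>+x\<in>{0..<1}. G x \<partial>lborel)"
proof -
  let ?I = "\<lambda>l. {real l / real N..<real (Suc l) / real N}"
  have split: "grid_sum N G \<xi> * indicator {0..<1} \<xi> =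
     (\<Sum>l<N. \<Sum>n<N. G (\<xi> + (real n - real l) / real N) * indicator (?I l) \<xi>)" for \<xi>
  proof -
    have "grid_sum N G \<xi> * indicator (?I l) \<xi> =
        (\<Sum>n<N. G (\<xi> + (real n - real l) / real N) * indicator (?I l) \<xi>)" for l
    proof (cases "\<xi> \<in> ?I l")
      case True
      then have fr: "frac (real N * \<xi>) = real N * \<xi> - real l"
        using N by (subst frac_unique_iff) (auto simp: field_simps)
      have "(real n + frac (real N * \<xi>)) / real N = \<xi> + (real n - real l) / real N" for n
        unfolding fr using N by (simp add: field_simps)
      then show ?thesis using True by (simp add: grid_sum_def)
    qed simp
    then show ?thesis by (simp add: indicator_unit_split[OF N] sum_distrib_left)
  qed
  have shift: "(\<integral>\<^sup>+\<xi>. G (\<xi> + (real n - real l) / real N) * indicator (?I l) \<xi> \<partial>lborel)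
     = (\<integral>\<^sup>+x. G x * indicator (?I n) x \<partial>lborel)" for n l
  proof -
    have "(\<integral>\<^sup>+x. G x * indicator (?I n) x \<partial>lborel) =
       (\<integral>\<^sup>+\<xi>. G ((real n - real l) / real N + 1 * \<xi>) * indicator (?I n) ((real n - real l) / real N + 1 * \<xi>) \<partial>lborel)"
      by (subst nn_integral_real_affine[of _ 1 "(real n - real l) / real N"]) auto
    also have "\<dots> = (\<integral>\<^sup>+\<xi>. G (\<xi> + (real n - real l) / real N) * indicator (?I l) \<xi> \<partial>lborel)"
    proof (intro nn_integral_cong)
      fix \<xi> :: real
      have "(real n - real l) / real N + 1 * \<xi> \<in> ?I n \<longleftrightarrow> \<xi> \<in> ?I l"
        by (auto simp: diff_divide_distrib add_divide_distrib)
      then show "G ((real n - real l) / real N + 1 * \<xi>) * indicator (?I n) ((real n - real l) / real N + 1 * \<xi>)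
         = G (\<xi> + (real n - real l) / real N) * indicator (?I l) \<xi>"
        by (simp add: indicator_def add.commute)
    qed
    finally show ?thesis by simp
  qed
  have "(\<integral>\<^sup>+\<xi>\<in>{0..<1}. grid_sum N G \<xi> \<partial>lborel) =
     (\<Sum>l<N. \<integral>\<^sup>+\<xi>. (\<Sum>n<N. G (\<xi> + (real n - real l) / real N) * indicator (?I l) \<xi>) \<partial>lborel)"
    unfolding split by (rule nn_integral_sum) measurable
  also have "\<dots> = (\<Sum>l<N. \<Sum>n<N. \<integral>\<^sup>+\<xi>. G (\<xi> + (real n - real l) / real N) * indicator (?I l) \<xi> \<partial>lborel)"
    by (intro sum.cong refl nn_integral_sum) measurable
  also have "\<dots> = of_nat N * (\<Sum>n<N. \<integral>\<^sup>+x. G x * indicator (?I n) x \<partial>lborel)"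
    by (simp only: shift) simp
  also have "(\<Sum>n<N. \<integral>\<^sup>+x. G x * indicator (?I n) x \<partial>lborel) = (\<integral>\<^sup>+x\<in>{0..<1}. G x \<partial>lborel)"
    unfolding indicator_unit_split[OF N] sum_distrib_left by (rule nn_integral_sum[symmetric]) measurable
  finally show ?thesis .
qed

lemma nn_integral_step:
  fixes F :: "nat \<Rightarrow> ennreal"
  assumes N: "0 < N"
  shows "(\<integral>\<^sup>+x\<in>{0..<1}. F (nat \<lfloor>real N * x\<rfloor>) \<partial>lborel) = ennreal (1 / real N) * (\<Sum>a<N. F a)"
proof -
  let ?I = "\<lambda>l. {real l / real N..<real (Suc l) / real N}"
  have "F (nat \<lfloor>real N * x\<rfloor>) * indicator {0..<1} x = (\<Sum>a<N. F a * indicator (?I a) x)" for x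
  proof -
    have "F (nat \<lfloor>real N * x\<rfloor>) * indicator (?I a) x = F a * indicator (?I a) x" for a
    proof (cases "x \<in> ?I a")
      case True
      then have "nat \<lfloor>real N * x\<rfloor> = a" using N by (simp add: field_simps) linarith
      then show ?thesis by simp
    qed simp
    then show ?thesis by (simp add: indicator_unit_split[OF N] sum_distrib_left)
  qed
  then have "(\<integral>\<^sup>+x\<in>{0..<1}. F (nat \<lfloor>real N * x\<rfloor>) \<partial>lborel) = (\<integral>\<^sup>+x. (\<Sum>a<N. F a * indicator (?I a) x) \<partial>lborel)"
    by (intro nn_integral_cong)
  also have "\<dots> = (\<Sum>a<N. \<integral>\<^sup>+x. F a * indicator (?I a) x \<partial>lborel)"
    by (rule nn_integral_sum) simp
  also have "\<dots> = (\<Sum>a<N. F a * ennreal (1 / real N))"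
  proof (intro sum.cong refl)
    fix a
    have "emeasure lborel (?I a) = ennreal (1 / real N)"
      using N by (subst emeasure_lborel_Ico) (auto simp: field_simps)
    then show "(\<integral>\<^sup>+x. F a * indicator (?I a) x \<partial>lborel) = F a * ennreal (1 / real N)"
      by (subst nn_integral_cmult_indicator) auto
  qed
  finally show ?thesis by (simp only: mult.commute[of "ennreal (1 / real N)"] sum_distrib_right)
qed

text \<open>A function with integral at most \<open>K\<close> over a set of measure one cannot exceed \<open>K\<close> almost
  everywhere.\<close>

lemma exists_good_point:
  fixes A U :: "real \<Rightarrow> ennreal"
  assumes [measurable]: "A \<in> borel_measurable borel" "U \<in> borel_measurable borel"
    and A: "(\<integral>\<^sup>+\<xi>\<in>{0..<1}. A \<xi> \<partial>lborel) \<le> ennreal K"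
    and U: "(\<integral>\<^sup>+\<xi>\<in>{0..<1}. U \<xi> \<partial>lborel) < \<infinity>"
  shows "\<exists>\<xi>\<in>{0..<1}. A \<xi> \<le> ennreal K \<and> U \<xi> < \<infinity>"
proof (rule ccontr)
  assume no: "\<not> ?thesis"
  have "AE \<xi> in lborel. U \<xi> * indicator {0..<1} \<xi> \<noteq> \<infinity>"
    by (rule nn_integral_noteq_infinite) (use U in auto)
  then have AE: "AE \<xi> in lborel. \<xi> \<in> {0..<1} \<longrightarrow> ennreal K < A \<xi>"
  proof eventually_elim
    case (elim \<xi>)
    then show ?case using no by (auto simp: infinity_ennreal_def less_top[symmetric] not_le)
  qed
  have "(\<integral>\<^sup>+\<xi>. ennreal K * indicator {0..<1::real} \<xi> \<partial>lborel) < (\<integral>\<^sup>+\<xi>. A \<xi> * indicator {0..<1::real} \<xi> \<partial>lborel)"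
  proof (rule nn_integral_less)
    show "(\<integral>\<^sup>+\<xi>. ennreal K * indicator {0..<1::real} \<xi> \<partial>lborel) \<noteq> \<infinity>"
      by (simp add: nn_integral_cmult_indicator)
    show "AE \<xi> in lborel. ennreal K * indicator {0..<1} \<xi> \<le> A \<xi> * indicator {0..<1} \<xi>"
      using AE by eventually_elim (auto simp: indicator_def)
    show "\<not> (AE \<xi> in lborel. A \<xi> * indicator {0..<1} \<xi> \<le> ennreal K * indicator {0..<1} \<xi>)"
    proof
      assume "AE \<xi> in lborel. A \<xi> * indicator {0..<1} \<xi> \<le> ennreal K * indicator {0..<1} \<xi>"
      then have "AE \<xi> in lborel. \<xi> \<notin> {0..<1::real}"
        using AE by eventually_elim (auto simp: indicator_def)
      then have "emeasure lborel {0..<1::real} = 0"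
        by (subst (asm) AE_iff_measurable[of "{0..<1}"]) auto
      then show False by simp
    qed
  qed auto
  then show False using A by (simp add: nn_integral_cmult_indicator)
qed

section \<open>Interpolation on a random grid\<close>

text \<open>The nodes of level \<open>j\<close> are the points of the grid of step \<open>b\<^sup>-\<^sup>j\<^sup>-\<^sup>k\<close> through \<open>\<xi>\<close>; each cell
  contains \<open>b\<^sup>k \<ge> k\<close> of them, and the grids of increasing levels are nested.\<close>

definition node :: "nat \<Rightarrow> nat \<Rightarrow> real \<Rightarrow> nat \<Rightarrow> nat \<Rightarrow> nat \<Rightarrow> real" where
  "node b k \<xi> j a i = (real (a * b ^ k + i) + frac (real (b ^ (j + k)) * \<xi>)) / real (b ^ (j + k))"

definition sample_poly :: "nat \<Rightarrow> nat \<Rightarrow> (real \<Rightarrow> real) \<Rightarrow> real \<Rightarrow> nat \<Rightarrow> nat \<Rightarrow> real poly" where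
  "sample_poly b k f \<xi> j a = lagrange_interpolant (node b k \<xi> j a ` {..<k}) f"

lemma inj_node: "0 < b \<Longrightarrow> inj (node b k \<xi> j a)"
  by (auto simp: node_def inj_on_def)

lemma degree_sample_poly:
  assumes "0 < b" "0 < k"
  shows "degree (sample_poly b k f \<xi> j a) < k"
proof -
  have "card (node b k \<xi> j a ` {..<k}) = k"
    using inj_node[OF assms(1), of k \<xi> j a] by (subst card_image) (auto simp: inj_on_def)
  then show ?thesis
    using degree_lagrange_interpolant[of "node b k \<xi> j a ` {..<k}" f] assms
    by (auto simp: sample_poly_def)
qed

lemma sample_poly_node: "i < k \<Longrightarrow> poly (sample_poly b k f \<xi> j a) (node b k \<xi> j a i) = f (node b k \<xi> j a i)"
  by (simp add: sample_poly_def poly_lagrange_interpolant)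

lemma less_base_power: "2 \<le> b \<Longrightarrow> k < b ^ k" for b k :: nat
  by (metis less_exp order_less_le_trans power_mono zero_le_numeral)

lemma degree_pcompose_linear_less:
  fixes R :: "real poly"
  assumes "degree R < k"
  shows "degree (pcompose R [:u, v:]) < k"
  using degree_pcompose_le[of R "[:u, v:]"] assms
  by (metis (no_types, opaque_lifting) degree_pCons_eq_if degree_0 le_less_trans mult.right_neutral
      mult_0_right One_nat_def order_trans zero_le)

lemma sample_poly_bound:
  assumes b: "2 \<le> b" and k: "0 < k" and x: "0 \<le> x" "cell b j x = a"
    and A: "\<And>i. i < k \<Longrightarrow> \<bar>f (node b k \<xi> j a i) - v\<bar> \<le> A"
  shows "\<bar>poly (sample_poly b k f \<xi> j a) x - v\<bar> \<le> real k * (real (b ^ k) + 1) ^ k * A"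
proof -
  define N where "N = b ^ (j + k)"
  define \<eta> where "\<eta> = frac (real N * \<xi>)"
  have N: "0 < N" using b by (simp add: N_def)
  have eta: "0 \<le> \<eta>" "\<eta> < 1" by (auto simp: \<eta>_def frac_lt_1)
  define x0 where "x0 = (real (a * b ^ k) + \<eta>) / real N"
  define R where "R = pcompose (sample_poly b k f \<xi> j a - [:v:]) [:x0, 1 / real N:]"
  have Rx: "poly R y = poly (sample_poly b k f \<xi> j a) (x0 + y / real N) - v" for y
    by (simp add: R_def poly_pcompose)
  have nd: "node b k \<xi> j a i = x0 + real i / real N" for i
    by (simp add: node_def x0_def N_def[symmetric] \<eta>_def add_divide_distrib)
  define y where "y = real N * (x - x0)"
  have xy: "x = x0 + y / real N" using N by (simp add: y_def)
  have "real a \<le> real b ^ j * x" "real b ^ j * x < real a + 1"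
    using cell_bounds[of b x j] b x by auto
  then have "real (b ^ k) * real a \<le> real (b ^ k) * (real b ^ j * x)"
      "real (b ^ k) * (real b ^ j * x) < real (b ^ k) * (real a + 1)"
    using b by (auto intro!: mult_left_mono mult_strict_left_mono)
  moreover have "real N * x = real (b ^ k) * (real b ^ j * x)" by (simp add: N_def power_add mult.commute)
  moreover have "real N * x0 = real (b ^ k) * real a + \<eta>" using N by (simp add: x0_def)
  moreover have "y = real N * x - real N * x0" by (simp add: y_def right_diff_distrib)
  ultimately have y: "-1 \<le> y" "y \<le> real (b ^ k)"
    using eta unfolding distrib_left by linarith+
  have "\<bar>poly R y\<bar> \<le> real (card {..<k}) * (real (b ^ k) + 1) ^ card {..<k} * A"
  proof (rule poly_bound_from_integer_nodes)
    show "{..<k} \<subseteq> {..<b ^ k}" using less_base_power[OF b, of k] by auto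
    have "degree (sample_poly b k f \<xi> j a - [:v:]) < k"
      using degree_sample_poly[of b k f \<xi> j a] b k by (intro degree_diff_less) auto
    then show "degree R < card {..<k}"
      unfolding R_def using degree_pcompose_linear_less by simp
    show "\<bar>poly R (real n)\<bar> \<le> A" if "n \<in> {..<k}" for n
      using A[of n] that sample_poly_node[of n k b f \<xi> j a] by (simp add: Rx nd)
  qed (use y in auto)
  then show ?thesis by (simp add: Rx xy[symmetric])
qed

definition step_const :: "nat \<Rightarrow> nat \<Rightarrow> real" where
  "step_const b k = 2 * (real k * (real (b ^ Suc k) + 1) ^ k * real (b ^ Suc k) ^ k)"

text \<open>The interpolants on a cell and on its child both use values on the grid of the next level, where
  the \<open>k\<close>-th differences of \<open>f\<close> control how far two interpolants of the same data can differ.\<close>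

lemma sample_poly_step:
  assumes b: "2 \<le> b" and k: "0 < k" and x: "0 \<le> x" "cell b j x = a" and c: "c < b"
    and N: "N = b ^ Suc (j + k)" and \<eta>: "\<eta> = frac (real N * \<xi>)" and A: "0 \<le> A"
    and D: "\<And>n. n + k < b ^ Suc k \<Longrightarrow>
       \<bar>(difference (1 / real N) ^^ k) f ((real (a * b ^ Suc k + n) + \<eta>) / real N)\<bar> \<le> A"
  shows "\<bar>poly (sample_poly b k f \<xi> (Suc j) (b * a + c)) x - poly (sample_poly b k f \<xi> j a) x\<bar>
     \<le> step_const b k * A"
proof -
  define M where "M = b ^ Suc k"
  have N0: "0 < N" using b N by simp
  have eta: "0 \<le> \<eta>" "\<eta> < 1" by (auto simp: \<eta> frac_lt_1)
  define x0 where "x0 = (real (a * M) + \<eta>) / real N"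
  define u where "u = (\<lambda>y. f (x0 + (1 / real N) * y))"
  define R where "R = pcompose (sample_poly b k f \<xi> (Suc j) (b * a + c)) [:x0, 1 / real N:]"
  define R' where "R' = pcompose (sample_poly b k f \<xi> j a) [:x0, 1 / real N:]"
  define T where "T = (\<lambda>i. c * b ^ k + i) ` {..<k}"
  define \<eta>' where "\<eta>' = frac (real (b ^ (j + k)) * \<xi>)"
  define e where "e = nat \<lfloor>real b * \<eta>'\<rfloor>"
  define T' where "T' = (\<lambda>i. b * i + e) ` {..<k}"
  have eta': "0 \<le> \<eta>'" "\<eta>' < 1" by (auto simp: \<eta>'_def frac_lt_1)
  have be: "0 \<le> real b * \<eta>'" "real b * \<eta>' < real b" using eta' b by auto
  have e: "e < b" using be unfolding e_def by linarith
  have NN: "real N = real b * real (b ^ (j + k))" by (simp add: N)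
  \<comment> \<open>Multiplying the offset of the coarse grid by \<open>b\<close> gives that of the fine grid up to an integer \<open>e\<close>,
    so the coarse nodes are the fine nodes with the indices \<open>b * i + e\<close>.\<close>
  have eq: "real b * \<eta>' = real e + \<eta>"
  proof -
    have shift: "frac (z - of_int n) = frac z" for z :: real and n by (simp add: frac_def)
    have e1: "real b * \<eta>' = real N * \<xi> - of_int (int b * \<lfloor>real (b ^ (j + k)) * \<xi>\<rfloor>)"
      by (simp add: \<eta>'_def frac_def NN right_diff_distrib)
    have "frac (real b * \<eta>') = \<eta>"
      unfolding e1 \<eta> by (rule shift)
    moreover have "real e = of_int \<lfloor>real b * \<eta>'\<rfloor>" using be by (simp add: e_def)
    ultimately show ?thesis by (simp add: frac_def)
  qed
  have kM: "k < b ^ k" using less_base_power[OF b] .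
  have MM: "M = b * b ^ k" by (simp add: M_def)
  have Tsub: "T \<subseteq> {..<M}"
  proof
    fix n assume "n \<in> T"
    then obtain i where i: "n = c * b ^ k + i" "i < k" by (auto simp: T_def)
    have "(c + 1) * b ^ k \<le> b * b ^ k" using c by (intro mult_right_mono) auto
    then show "n \<in> {..<M}" using i kM by (simp add: MM)
  qed
  have T'sub: "T' \<subseteq> {..<M}"
  proof
    fix n assume "n \<in> T'"
    then obtain i where i: "n = b * i + e" "i < k" by (auto simp: T'_def)
    have "b * (i + 1) \<le> b * b ^ k" using i kM by (intro mult_left_mono) auto
    then show "n \<in> {..<M}" using i e by (simp add: MM)
  qed
  have cT: "card T = k" "card T' = k"
    unfolding T_def T'_def using b by (auto simp: card_image inj_on_def)
  have nd: "node b k \<xi> (Suc j) (b * a + c) i = x0 + (1 / real N) * real (c * b ^ k + i)" for i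
  proof -
    have "b ^ (Suc j + k) = N" by (simp add: N)
    moreover have "(b * a + c) * b ^ k + i = a * M + (c * b ^ k + i)" by (simp add: MM algebra_simps)
    ultimately have "node b k \<xi> (Suc j) (b * a + c) i = (real (a * M + (c * b ^ k + i)) + \<eta>) / real N"
      unfolding node_def \<eta> by (simp only:)
    then show ?thesis by (simp add: x0_def add_divide_distrib)
  qed
  have nd': "node b k \<xi> j a i = x0 + (1 / real N) * real (b * i + e)" for i
  proof -
    have "node b k \<xi> j a i = (real b * (real (a * b ^ k + i) + \<eta>')) / real N"
      using b by (simp add: node_def \<eta>'_def NN)
    also have "real b * (real (a * b ^ k + i) + \<eta>') = real (a * M) + \<eta> + real (b * i + e)"
      using eq by (simp add: distrib_left MM algebra_simps)
    finally show ?thesis by (simp add: x0_def add_divide_distrib)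
  qed
  define y where "y = real N * (x - x0)"
  have xy: "x = x0 + y / real N" using N0 by (simp add: y_def)
  have "real a \<le> real b ^ j * x" "real b ^ j * x < real a + 1"
    using cell_bounds[of b x j] b x by auto
  then have "real M * real a \<le> real M * (real b ^ j * x)"
      "real M * (real b ^ j * x) < real M * (real a + 1)"
    using b by (auto intro!: mult_left_mono mult_strict_left_mono simp: M_def)
  moreover have "real N * x = real M * (real b ^ j * x)" by (simp add: N M_def power_add)
  moreover have "real N * x0 = real M * real a + \<eta>" using N0 by (simp add: x0_def)
  moreover have "y = real N * x - real N * x0" by (simp add: y_def right_diff_distrib)
  ultimately have y: "-1 \<le> y" "y \<le> real M"
    using eta unfolding distrib_left by linarith+
  have "\<bar>poly R y - poly R' y\<bar> \<le> 2 * (real k * (real M + 1) ^ k * (real M ^ k * A))"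
  proof (rule interpolants_close[where u = u and T = T and T' = T'])
    show "k \<le> M" using kM b MM mult_le_mono1[of 1 b "b ^ k"] by linarith
    show "degree R < k" "degree R' < k"
      unfolding R_def R'_def using degree_sample_poly b k by (auto intro!: degree_pcompose_linear_less)
    show "poly R (real n) = u (real n)" if nT: "n \<in> T" for n
    proof -
      obtain i where i: "n = c * b ^ k + i" "i < k" using nT by (auto simp only: T_def)
      show ?thesis using sample_poly_node[OF i(2), of b f \<xi> "Suc j" "b * a + c"]
        unfolding nd i(1) by (simp add: R_def u_def poly_pcompose)
    qed
    show "poly R' (real n) = u (real n)" if nT: "n \<in> T'" for n
    proof -
      obtain i where i: "n = b * i + e" "i < k" using nT by (auto simp only: T'_def)
      show ?thesis using sample_poly_node[OF i(2), of b f \<xi> j a]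
        unfolding nd' i(1) by (simp add: R'_def u_def poly_pcompose)
    qed
    show "\<bar>(difference 1 ^^ k) u (real n)\<bar> \<le> A" if "n + k < M" for n
    proof -
      have "(difference 1 ^^ k) u (real n) = (difference (1 / real N) ^^ k) f (x0 + 1 / real N * real n)"
        unfolding u_def by (rule funpow_difference_rescale[symmetric])
      also have "x0 + 1 / real N * real n = (real (a * b ^ Suc k + n) + \<eta>) / real N"
        by (simp add: x0_def M_def add_divide_distrib)
      finally show ?thesis using D[of n] that by (simp add: M_def)
    qed
  qed (use k Tsub T'sub cT A y in auto)
  then show ?thesis
    by (simp add: R_def R'_def poly_pcompose xy[symmetric] step_const_def M_def mult.assoc)
qed

text \<open>The truncated distance measures convergence in measure without any integrability of \<open>f\<close>.\<close>

definition trunc :: "real \<Rightarrow> real" where "trunc u = min 1 \<bar>u\<bar>"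

lemma measurable_trunc [measurable]: "trunc \<in> borel_measurable borel"
  unfolding trunc_def[abs_def] by measurable

lemma trunc_nonneg: "0 \<le> trunc u" by (simp add: trunc_def)

lemma trunc_sum_le: 
  assumes "\<bar>u\<bar> \<le> c * (\<Sum>i\<in>I. \<bar>v i\<bar>)" "1 \<le> c"
  shows "trunc u \<le> c * (\<Sum>i\<in>I. trunc (v i))"
proof (cases "finite I \<and> (\<exists>i\<in>I. 1 \<le> \<bar>v i\<bar>)")
  case True
  then obtain i where i: "finite I" "i \<in> I" "1 \<le> \<bar>v i\<bar>" by blast
  have "1 \<le> trunc (v i)" using i by (simp add: trunc_def)
  also have "\<dots> \<le> (\<Sum>i\<in>I. trunc (v i))"
    using i by (intro member_le_sum) (auto simp: trunc_nonneg)
  also have "\<dots> \<le> c * (\<Sum>i\<in>I. trunc (v i))"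
    using mult_right_mono[OF assms(2), of "\<Sum>i\<in>I. trunc (v i)"] by (simp add: sum_nonneg trunc_nonneg)
  finally show ?thesis by (simp add: trunc_def)
next
  case False
  then have "(\<Sum>i\<in>I. trunc (v i)) = (\<Sum>i\<in>I. \<bar>v i\<bar>)"
    by (cases "finite I") (auto simp: trunc_def min_def not_le intro!: sum.cong)
  then show ?thesis using assms(1) by (simp add: trunc_def)
qed

lemma continuous_approximation:
  fixes f :: "real \<Rightarrow> real"
  assumes [measurable]: "f \<in> borel_measurable borel" and e: "0 < e"
  shows "\<exists>g. continuous_on UNIV g \<and> (\<integral>\<^sup>+x\<in>{0..<1}. ennreal (trunc (f x - g x)) \<partial>lborel) \<le> ennreal e"
proof -
  have "f \<in> borel_measurable lebesgue" by (simp add: measurable_completion)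
  then have "f measurable_on UNIV" by (intro lebesgue_measurable_imp_measurable_on) auto
  then obtain N g where N: "negligible N" and g: "\<And>n. continuous_on UNIV (g n)"
    and lim: "\<And>x. x \<notin> N \<Longrightarrow> (\<lambda>n. g n x) \<longlonglongrightarrow> f x"
    unfolding measurable_on_def by auto
  have [measurable]: "g n \<in> borel_measurable borel" for n
    using g by (intro borel_measurable_continuous_onI)
  have "AE x in lebesgue. x \<notin> N" using N by (simp add: negligible_iff_null_sets AE_not_in)
  then have AE: "AE x in lborel. x \<notin> N" by (simp add: AE_completion_iff)
  have "(\<lambda>n. \<integral>\<^sup>+x. norm (0 - trunc (f x - g n x) * indicator {0..<1} x) \<partial>lborel) \<longlonglongrightarrow> 0"
  proof (rule nn_integral_dominated_convergence_norm[where w = "indicator {0..<1}"])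
    show "AE x in lborel. norm (trunc (f x - g j x) * indicator {0..<1} x) \<le> indicator {0..<1} x" for j
      by (auto simp: trunc_def indicator_def)
    show "AE x in lborel. (\<lambda>n. trunc (f x - g n x) * indicator {0..<1} x) \<longlonglongrightarrow> 0"
      using AE
    proof eventually_elim
      case (elim x)
      have "(\<lambda>n. trunc (f x - g n x) * indicator {0..<1} x) \<longlonglongrightarrow> min 1 \<bar>f x - f x\<bar> * indicator {0..<1} x"
        unfolding trunc_def by (intro tendsto_intros lim elim)
      then show ?case by simp
    qed
  qed (auto simp: ennreal_indicator)
  then have "\<forall>\<^sub>F n in sequentially. (\<integral>\<^sup>+x. norm (0 - trunc (f x - g n x) * indicator {0..<1} x) \<partial>lborel) < ennreal e"
    using e by (intro order_tendstoD) auto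
  then obtain n where n: "(\<integral>\<^sup>+x. norm (0 - trunc (f x - g n x) * indicator {0..<1} x) \<partial>lborel) < ennreal e"
    using eventually_happens' sequentially_bot by blast
  have "(\<integral>\<^sup>+x\<in>{0..<1}. ennreal (trunc (f x - g n x)) \<partial>lborel) =
      (\<integral>\<^sup>+x. norm (0 - trunc (f x - g n x) * indicator {0..<1} x) \<partial>lborel)"
    by (intro nn_integral_cong) (auto simp: indicator_def trunc_nonneg)
  then show ?thesis using n g by (intro exI[of _ "g n"]) auto
qed

lemma sum_blocks_le:
  fixes H :: "nat \<Rightarrow> ennreal"
  assumes "k \<le> m"
  shows "(\<Sum>a<A. \<Sum>i<k. H (a * m + i)) \<le> (\<Sum>n<A * m. H n)"
proof -
  have "(\<Sum>a<A. \<Sum>i<k. H (a * m + i)) \<le> (\<Sum>a<A. \<Sum>i<m. H (a * m + i))"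
    using assms by (intro sum_mono sum_mono2) auto
  also have "\<dots> = (\<Sum>a<A. \<Sum>n\<in>{a * m..<a * m + m}. H n)"
  proof (rule sum.cong[OF refl])
    fix a
    show "(\<Sum>i<m. H (a * m + i)) = (\<Sum>n\<in>{a * m..<a * m + m}. H n)"
      by (rule sum.reindex_bij_witness[of _ "\<lambda>n. n - a * m" "\<lambda>i. a * m + i"]) auto
  qed
  also have "\<dots> = (\<Sum>n<A * m. H n)" by (rule sum.nat_group)
  finally show ?thesis .
qed

definition sample :: "nat \<Rightarrow> nat \<Rightarrow> (real \<Rightarrow> real) \<Rightarrow> real \<Rightarrow> nat \<Rightarrow> real \<Rightarrow> real" where
  "sample b k f \<xi> j x = poly (sample_poly b k f \<xi> j (cell b j x)) x"

lemma measurable_sample [measurable]: "sample b k f \<xi> j \<in> borel_measurable borel"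
proof -
  have "(\<lambda>x. (\<lambda>a. poly (sample_poly b k f \<xi> j a) x) (cell b j x)) \<in> borel_measurable borel"
    by (rule measurable_compose_countable[where g = "cell b j"])
      (auto intro!: borel_measurable_continuous_onI continuous_intros)
  then show ?thesis by (simp add: sample_def[abs_def])
qed

text \<open>The interpolant reproduces constants, so its distance to \<open>f(x)\<close> is bounded by the oscillation of
  \<open>f\<close> between \<open>x\<close> and the nodes of its cell. Replacing \<open>f\<close> by a continuous \<open>g\<close> at both places leaves
  the grid sum and the integral of the truncated distance of \<open>f\<close> and \<open>g\<close>.\<close>

lemma sample_error:
  assumes b: "2 \<le> b" and k: "0 < k"
    and [measurable]: "f \<in> borel_measurable borel" "g \<in> borel_measurable borel"
    and osc: "\<And>x y. x \<in> {0..1} \<Longrightarrow> y \<in> {0..1} \<Longrightarrow> \<bar>x - y\<bar> \<le> 1 / real b ^ j \<Longrightarrow> \<bar>g x - g y\<bar> \<le> e"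
    and c: "c = real k * (real (b ^ k) + 1) ^ k"
  shows "(\<integral>\<^sup>+x\<in>{0..<1}. ennreal (trunc (f x - sample b k f \<xi> j x)) \<partial>lborel)
     \<le> ennreal c * (ennreal (1 / real (b ^ j)) * grid_sum (b ^ (j + k)) (\<lambda>x. ennreal (trunc (f x - g x))) \<xi>
        + ennreal (real k * e) + of_nat k * (\<integral>\<^sup>+x\<in>{0..<1}. ennreal (trunc (f x - g x)) \<partial>lborel))"
proof -
  let ?G = "\<lambda>x. ennreal (trunc (f x - g x))"
  let ?n = "\<lambda>x i. node b k \<xi> j (cell b j x) i"
  have e0: "0 \<le> e" using osc[of 0 0] by simp
  have c1: "1 \<le> c"
  proof -
    have "1 * 1 \<le> real k * (real (b ^ k) + 1) ^ k"
      using k by (intro mult_mono one_le_power) auto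
    then show ?thesis by (simp add: c)
  qed
  have pt: "ennreal (trunc (f x - sample b k f \<xi> j x))
      \<le> ennreal c * ((\<Sum>i<k. ?G (?n x i)) + ennreal (real k * e) + of_nat k * ?G x)"
    if x: "x \<in> {0..<1}" for x
  proof -
    define a where "a = cell b j x"
    have a: "real a \<le> real b ^ j * x" "real b ^ j * x < real a + 1"
      unfolding a_def using cell_bounds[of b x j] b x by auto
    have ab: "a < b ^ j" unfolding a_def using b x by (intro cell_less) auto
    have fr: "0 \<le> frac z" "frac z < 1" for z :: real by (auto simp: frac_lt_1)
    have near: "\<bar>g (?n x i) - g x\<bar> \<le> e" if i: "i < k" for i
    proof (rule osc)
      define y where "y = ?n x i"
      have yb: "real b ^ j * y = real a + (real i + frac (real (b ^ (j + k)) * \<xi>)) / real b ^ k"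
        using b by (simp add: y_def node_def a_def[symmetric] power_add field_simps)
      have "i < b ^ k" using i less_base_power[OF b, of k] by linarith
      then have "real i + 1 \<le> real b ^ k" by (metis Suc_leI of_nat_Suc of_nat_le_iff of_nat_power add.commute)
      then have "real i + frac (real (b ^ (j + k)) * \<xi>) < real b ^ k"
        using fr(2)[of "real (b ^ (j + k)) * \<xi>"] by linarith
      then have q: "0 \<le> (real i + frac (real (b ^ (j + k)) * \<xi>)) / real b ^ k"
         "(real i + frac (real (b ^ (j + k)) * \<xi>)) / real b ^ k < 1"
        using b by (auto simp: divide_less_eq)
      then have y: "real a \<le> real b ^ j * y" "real b ^ j * y < real a + 1" unfolding yb by auto
      have bj: "0 < real b ^ j" using b by simp
      have "0 \<le> real b ^ j * y" using y by linarith
      then show "?n x i \<in> {0..1}"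
      proof -
        have "real a + 1 \<le> real b ^ j" using ab by (metis Suc_leI of_nat_Suc of_nat_le_iff of_nat_power add.commute)
        then have "real b ^ j * y \<le> real b ^ j * 1" using y by simp
        then have "y \<le> 1" using bj by (simp only: mult_le_cancel_left_pos)
        moreover have "0 \<le> y" using bj \<open>0 \<le> real b ^ j * y\<close> by (simp only: zero_le_mult_iff) linarith
        ultimately show ?thesis by (simp add: y_def)
      qed
      have "real b ^ j * \<bar>y - x\<bar> = \<bar>real b ^ j * y - real b ^ j * x\<bar>"
        using bj by (simp add: abs_mult right_diff_distrib[symmetric])
      also have "\<dots> \<le> 1" using y a by linarith
      finally show "\<bar>?n x i - x\<bar> \<le> 1 / real b ^ j" using bj by (simp add: y_def[symmetric] field_simps)
    qed (use x in auto)
    have "\<bar>poly (sample_poly b k f \<xi> j a) x - f x\<bar> \<le> c * (\<Sum>i<k. \<bar>f (?n x i) - f x\<bar>)"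
      unfolding c
    proof (rule sample_poly_bound[OF b k])
      show "\<bar>f (node b k \<xi> j a i) - f x\<bar> \<le> (\<Sum>i<k. \<bar>f (?n x i) - f x\<bar>)" if "i < k" for i
        unfolding a_def using that by (intro member_le_sum) auto
    qed (use x a_def in auto)
    then have "trunc (f x - sample b k f \<xi> j x) \<le> c * (\<Sum>i<k. trunc (f (?n x i) - f x))"
      by (intro trunc_sum_le c1) (simp add: sample_def a_def abs_minus_commute)
    also have "\<dots> \<le> c * (\<Sum>i<k. trunc (f (?n x i) - g (?n x i)) + e + trunc (f x - g x))"
    proof (intro mult_left_mono sum_mono)
      fix i assume "i \<in> {..<k}"
      then have "\<bar>g (?n x i) - g x\<bar> \<le> e" using near by simp
      then show "trunc (f (?n x i) - f x) \<le> trunc (f (?n x i) - g (?n x i)) + e + trunc (f x - g x)"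
        unfolding trunc_def by linarith
    qed (use c1 in simp)
    also have "\<dots> = c * ((\<Sum>i<k. trunc (f (?n x i) - g (?n x i))) + real k * e + real k * trunc (f x - g x))"
      by (simp add: sum.distrib)
    finally have "ennreal (trunc (f x - sample b k f \<xi> j x)) \<le>
        ennreal (c * ((\<Sum>i<k. trunc (f (?n x i) - g (?n x i))) + real k * e + real k * trunc (f x - g x)))"
      by (rule ennreal_leI)
    also have "\<dots> = ennreal c * ((\<Sum>i<k. ?G (?n x i)) + ennreal (real k * e) + of_nat k * ?G x)"
      using c1 e0 by (simp add: ennreal_mult ennreal_plus sum_nonneg trunc_nonneg ennreal_of_nat_eq_real_of_nat)
    finally show ?thesis .
  qed
  have [measurable]: "(\<lambda>x. \<Sum>i<k. ?G (?n x i)) \<in> borel_measurable borel"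
    by (rule measurable_compose[OF measurable_cell, where g = "\<lambda>a. \<Sum>i<k. ?G (node b k \<xi> j a i)"]) simp
  have "(\<integral>\<^sup>+x\<in>{0..<1}. ennreal (trunc (f x - sample b k f \<xi> j x)) \<partial>lborel)
      \<le> (\<integral>\<^sup>+x. ennreal c * ((\<Sum>i<k. ?G (?n x i)) * indicator {0..<1} x + ennreal (real k * e) * indicator {0..<1} x
          + of_nat k * (?G x * indicator {0..<1} x)) \<partial>lborel)"
    by (intro nn_integral_mono) (use pt in \<open>auto simp: indicator_def\<close>)
  also have "\<dots> = ennreal c * ((\<integral>\<^sup>+x\<in>{0..<1}. (\<Sum>i<k. ?G (?n x i)) \<partial>lborel) + ennreal (real k * e)
      + of_nat k * (\<integral>\<^sup>+x\<in>{0..<1}. ?G x \<partial>lborel))"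
    by (simp add: nn_integral_cmult nn_integral_add)
  also have "(\<integral>\<^sup>+x\<in>{0..<1}. (\<Sum>i<k. ?G (?n x i)) \<partial>lborel)
      = ennreal (1 / real (b ^ j)) * (\<Sum>a<b ^ j. \<Sum>i<k. ?G (node b k \<xi> j a i))"
    using nn_integral_step[of "b ^ j" "\<lambda>a. \<Sum>i<k. ?G (node b k \<xi> j a i)"] b by (simp add: cell_def)
  also have "(\<Sum>a<b ^ j. \<Sum>i<k. ?G (node b k \<xi> j a i)) \<le> grid_sum (b ^ (j + k)) ?G \<xi>"
    unfolding grid_sum_def node_def power_add
    using sum_blocks_le[of k "b ^ k" "\<lambda>n. ?G ((real n + frac (real (b ^ j * b ^ k) * \<xi>)) / real (b ^ j * b ^ k))" "b ^ j"]
      less_base_power[OF b, of k] by simp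
  finally show ?thesis by (simp add: mult_left_mono add_mono)
qed

lemma suminf_geometric_finite: "(\<Sum>i. ennreal (C * (1 / 2) ^ i)) < \<infinity>" if "0 \<le> C"
proof -
  have "summable (\<lambda>i. C * (1 / 2) ^ i :: real)" by (intro summable_mult summable_geometric) simp
  then show ?thesis using that by (subst suminf_ennreal2) auto
qed

lemma ennreal_mult_half_power: "0 \<le> C \<Longrightarrow> ennreal C * ennreal ((1 / 2) ^ i) = ennreal (C * (1 / 2) ^ i)"
  by (simp add: ennreal_mult)

text \<open>Averaged over \<open>\<xi>\<close>, the distance of \<open>f\<close> to its interpolant tends to zero, so along a suitable
  sequence of levels the distances are summable for almost every \<open>\<xi>\<close>.\<close>

lemma sample_converges:
  fixes f :: "real \<Rightarrow> real"
  assumes b: "2 \<le> b" and k: "0 < k" and f [measurable]: "f \<in> borel_measurable borel"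
  shows "\<exists>js U. (\<forall>i. i \<le> js i) \<and> U \<in> borel_measurable borel \<and> (\<integral>\<^sup>+\<xi>\<in>{0..<1::real}. U \<xi> \<partial>lborel) < \<infinity> \<and>
     (\<forall>\<xi>. U \<xi> < \<infinity> \<longrightarrow> (AE x in lborel. x \<in> {0..<1} \<longrightarrow> (\<lambda>i. sample b k f \<xi> (js i) x) \<longlonglongrightarrow> f x))"
proof -
  have "\<exists>g. continuous_on UNIV g \<and> (\<integral>\<^sup>+x\<in>{0..<1}. ennreal (trunc (f x - g x)) \<partial>lborel) \<le> ennreal ((1 / 2) ^ i)" for i :: nat
    by (intro continuous_approximation f) simp
  then obtain g where g: "\<And>i::nat. continuous_on UNIV (g i)"
    and fg: "\<And>i. (\<integral>\<^sup>+x\<in>{0..<1}. ennreal (trunc (f x - g i x)) \<partial>lborel) \<le> ennreal ((1 / 2) ^ i)"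
    by metis
  have [measurable]: "g i \<in> borel_measurable borel" for i
    using g by (intro borel_measurable_continuous_onI)
  have "\<exists>j\<ge>i. \<forall>x\<in>{0..1}. \<forall>y\<in>{0..1}. \<bar>x - y\<bar> \<le> 1 / real b ^ j \<longrightarrow> \<bar>g i x - g i y\<bar> \<le> (1 / 2) ^ i" for i :: nat
  proof -
    have "uniformly_continuous_on {0..1} (g i)"
      using g[of i] by (intro compact_uniformly_continuous) (auto intro: continuous_on_subset)
    then obtain d where d: "d > 0" "\<And>x y. x \<in> {0..1} \<Longrightarrow> y \<in> {0..1} \<Longrightarrow> dist y x < d \<Longrightarrow> dist (g i y) (g i x) < (1 / 2) ^ i"
      unfolding uniformly_continuous_on_def by (metis zero_less_power half_gt_zero_iff zero_less_one)
    obtain n where n: "(1 / real b) ^ n < d" using real_arch_pow_inv[OF d(1), of "1 / real b"] b by auto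
    have "1 / real b ^ max i n \<le> 1 / real b ^ n"
      using b by (intro divide_left_mono power_increasing) auto
    then have "1 / real b ^ max i n < d" using n by (simp add: power_divide)
    then show ?thesis using d(2) by (intro exI[of _ "max i n"]) (force simp: dist_real_def)
  qed
  then obtain js where js: "\<And>i. i \<le> js i" and osc: "\<And>i x y. x \<in> {0..1} \<Longrightarrow> y \<in> {0..1} \<Longrightarrow>
      \<bar>x - y\<bar> \<le> 1 / real b ^ js i \<Longrightarrow> \<bar>g i x - g i y\<bar> \<le> (1 / 2) ^ i"
    by metis
  let ?G = "\<lambda>i x. ennreal (trunc (f x - g i x))"
  define V where "V = (\<lambda>i \<xi>. ennreal (1 / real (b ^ js i)) * grid_sum (b ^ (js i + k)) (?G i) \<xi>)"
  define U where "U = (\<lambda>\<xi>. \<Sum>i. V i \<xi>)"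
  have V [measurable]: "V i \<in> borel_measurable borel" for i unfolding V_def by measurable
  have U [measurable]: "U \<in> borel_measurable borel" unfolding U_def by measurable
  have intV: "(\<integral>\<^sup>+\<xi>. V i \<xi> * indicator {0..<1} \<xi> \<partial>lborel) \<le> ennreal (real (b ^ k) * (1 / 2) ^ i)" for i
  proof -
    have "(\<integral>\<^sup>+\<xi>. V i \<xi> * indicator {0..<1} \<xi> \<partial>lborel) =
       ennreal (1 / real (b ^ js i)) * (of_nat (b ^ (js i + k)) * (\<integral>\<^sup>+x\<in>{0..<1}. ?G i x \<partial>lborel))"
      unfolding V_def using b by (simp add: mult.assoc nn_integral_cmult nn_integral_grid_sum del: of_nat_power)
    also have "\<dots> \<le> ennreal (1 / real (b ^ js i)) * (of_nat (b ^ (js i + k)) * ennreal ((1 / 2) ^ i))"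
      by (intro mult_left_mono fg) auto
    also have "\<dots> = ennreal (1 / real (b ^ js i) * (real (b ^ (js i + k)) * (1 / 2) ^ i))"
      by (simp add: ennreal_of_nat_eq_real_of_nat ennreal_mult[symmetric] del: of_nat_power)
    also have "1 / real (b ^ js i) * (real (b ^ (js i + k)) * (1 / 2) ^ i) = real (b ^ k) * (1 / 2) ^ i"
      using b by (simp add: power_add)
    finally show ?thesis .
  qed
  have "(\<integral>\<^sup>+\<xi>\<in>{0..<1}. U \<xi> \<partial>lborel) = (\<Sum>i. \<integral>\<^sup>+\<xi>. V i \<xi> * indicator {0..<1} \<xi> \<partial>lborel)"
    unfolding U_def ennreal_suminf_multc[symmetric] by (rule nn_integral_suminf) measurable
  also have "\<dots> \<le> (\<Sum>i. ennreal (real (b ^ k) * (1 / 2) ^ i))" by (intro suminf_le intV) auto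
  also have "\<dots> < \<infinity>" by (rule suminf_geometric_finite) simp
  finally have intU: "(\<integral>\<^sup>+\<xi>\<in>{0..<1}. U \<xi> \<partial>lborel) < \<infinity>" .
  have "AE x in lborel. x \<in> {0..<1} \<longrightarrow> (\<lambda>i. sample b k f \<xi> (js i) x) \<longlonglongrightarrow> f x" if fin: "U \<xi> < \<infinity>" for \<xi>
  proof -
    let ?w = "\<lambda>i x. trunc (f x - sample b k f \<xi> (js i) x)"
    define c where "c = real k * (real (b ^ k) + 1) ^ k"
    have fin_comb: "ennreal c * (u + v) < \<infinity>" if "u < \<infinity>" "v < \<infinity>" for u v
      using that by (simp add: ennreal_mult_less_top)
    have "(\<integral>\<^sup>+x\<in>{0..<1}. ennreal (?w i x) \<partial>lborel) \<le> ennreal c * (V i \<xi> + ennreal (2 * real k * (1 / 2) ^ i))" for i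
    proof -
      have "(\<integral>\<^sup>+x\<in>{0..<1}. ennreal (?w i x) \<partial>lborel) \<le>
          ennreal c * (V i \<xi> + ennreal (real k * (1 / 2) ^ i) + of_nat k * (\<integral>\<^sup>+x\<in>{0..<1}. ?G i x \<partial>lborel))"
        unfolding V_def by (rule sample_error[OF b k _ _ osc]) (auto simp: c_def)
      also have "\<dots> \<le> ennreal c * (V i \<xi> + ennreal (real k * (1 / 2) ^ i) + of_nat k * ennreal ((1 / 2) ^ i))"
        by (intro mult_left_mono add_mono fg order_refl) auto
      also have "\<dots> = ennreal c * (V i \<xi> + ennreal (2 * real k * (1 / 2) ^ i))"
      proof -
        have h: "0 \<le> real k * (1 / 2) ^ i" by simp
        have "of_nat k * ennreal ((1 / 2) ^ i) = ennreal (real k * (1 / 2) ^ i)"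
          by (simp only: ennreal_of_nat_eq_real_of_nat ennreal_mult_half_power of_nat_0_le_iff)
        then have "ennreal (real k * (1 / 2) ^ i) + of_nat k * ennreal ((1 / 2) ^ i)
           = ennreal (real k * (1 / 2) ^ i + real k * (1 / 2) ^ i)"
          by (simp only: ennreal_plus[OF h h])
        also have "real k * (1 / 2) ^ i + real k * (1 / 2) ^ i = 2 * real k * (1 / 2) ^ i" by simp
        finally show ?thesis by (simp only: add.assoc)
      qed
      finally show ?thesis .
    qed
    then have "(\<Sum>i. \<integral>\<^sup>+x\<in>{0..<1}. ennreal (?w i x) \<partial>lborel)
        \<le> (\<Sum>i. ennreal c * (V i \<xi> + ennreal (2 * real k * (1 / 2) ^ i)))"
      by (intro suminf_le) auto
    also have "\<dots> = ennreal c * (U \<xi> + (\<Sum>i. ennreal (2 * real k * (1 / 2) ^ i)))"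
      by (simp add: U_def suminf_add)
    also have "\<dots> < \<infinity>"
      by (rule fin_comb[OF fin suminf_geometric_finite]) simp
    finally have "(\<Sum>i. \<integral>\<^sup>+x\<in>{0..<1}. ennreal (?w i x) \<partial>lborel) < \<infinity>" .
    moreover have "(\<Sum>i. \<integral>\<^sup>+x\<in>{0..<1}. ennreal (?w i x) \<partial>lborel)
        = (\<integral>\<^sup>+x. (\<Sum>i. ennreal (?w i x) * indicator {0..<1} x) \<partial>lborel)"
      by (rule nn_integral_suminf[symmetric]) measurable
    ultimately have "AE x in lborel. (\<Sum>i. ennreal (?w i x) * indicator {0..<1} x) \<noteq> \<infinity>"
      by (intro nn_integral_noteq_infinite) auto
    then show ?thesis
    proof eventually_elim
      case (elim x)
      show ?case
      proof
        assume x: "x \<in> {0..<1}"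
        have "summable (\<lambda>i. ?w i x)"
          using elim x by (intro summable_suminf_not_top) (auto simp: trunc_nonneg)
        then have w0: "(\<lambda>i. ?w i x) \<longlonglongrightarrow> 0" by (rule summable_LIMSEQ_zero)
        then have "\<forall>\<^sub>F i in sequentially. ?w i x < 1" by (rule order_tendstoD) simp
        then have "\<forall>\<^sub>F i in sequentially. ?w i x = \<bar>f x - sample b k f \<xi> (js i) x\<bar>"
          by eventually_elim (simp add: trunc_def min_def split: if_splits)
        with w0 have "(\<lambda>i. \<bar>f x - sample b k f \<xi> (js i) x\<bar>) \<longlonglongrightarrow> 0"
          by (rule Lim_transform_eventually)
        then have "(\<lambda>i. f x - sample b k f \<xi> (js i) x) \<longlonglongrightarrow> 0" by (rule tendsto_rabs_zero_cancel)
        then have "(\<lambda>i. f x - (f x - sample b k f \<xi> (js i) x)) \<longlonglongrightarrow> f x - 0" by (intro tendsto_intros)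
        then show "(\<lambda>i. sample b k f \<xi> (js i) x) \<longlonglongrightarrow> f x" by simp
      qed
    qed
  qed
  then show ?thesis using js U intU by blast
qed

text \<open>All that the later steps use of the samples: piecewise polynomials \<open>P j\<close> on the cells of level \<open>j\<close>, with
  bounds in \<open>l\<^sup>\<tau>\<close> on the step from each level to the next, and almost everywhere convergence to \<open>f\<close>.\<close>

locale multiscale =
  fixes b k :: nat and \<tau> r K :: real and f :: "real \<Rightarrow> real"
    and P :: "nat \<Rightarrow> nat \<Rightarrow> real poly" and \<delta> :: "nat \<Rightarrow> nat \<Rightarrow> real" and js :: "nat \<Rightarrow> nat"
  assumes b: "2 \<le> b" and k: "0 < k" and \<tau>: "0 < \<tau>" and K: "0 < K"
    and f [measurable]: "f \<in> borel_measurable borel"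
    and deg: "\<And>j a. degree (P j a) < k"
    and \<delta>_nonneg: "\<And>j a. 0 \<le> \<delta> j a"
    and step: "\<And>j x. x \<in> {0..<1} \<Longrightarrow>
       \<bar>poly (P (Suc j) (cell b (Suc j) x)) x - poly (P j (cell b j x)) x\<bar> \<le> \<delta> j (cell b j x)"
    and sum_\<delta>: "\<And>j. (\<Sum>a<b ^ j. \<delta> j a powr \<tau>) \<le> K powr \<tau> * real b powr (real j * (1 - r * \<tau>))"
    and start: "\<And>x. x \<in> {0..<1} \<Longrightarrow> \<bar>poly (P 0 0) x\<bar> \<le> K"
    and js: "\<And>i. i \<le> js i"
    and conv: "AE x in lborel. x \<in> {0..<1} \<longrightarrow> (\<lambda>i. poly (P (js i) (cell b (js i) x)) x) \<longlonglongrightarrow> f x"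

lemma measurable_difference [measurable]:
  assumes [measurable]: "f \<in> borel_measurable borel"
  shows "(difference h ^^ k) f \<in> borel_measurable borel"
proof (induction k)
  case (Suc k)
  note [measurable] = this
  have "(difference h ^^ Suc k) f = (\<lambda>x. (difference h ^^ k) f (x + h) - (difference h ^^ k) f x)"
    by (rule ext) (rule funpow_difference_Suc)
  then show ?case by simp
qed simp

lemma powr_inverse_le:
  assumes "ennreal (\<bar>x\<bar> powr \<tau>) \<le> ennreal y" "0 < \<tau>" "0 \<le> y"
  shows "\<bar>x\<bar> \<le> y powr (1 / \<tau>)"
proof -
  have "\<bar>x\<bar> powr \<tau> \<le> y" using assms by (simp add: ennreal_le_iff)
  then have "(\<bar>x\<bar> powr \<tau>) powr (1 / \<tau>) \<le> y powr (1 / \<tau>)" using assms by (intro powr_mono2) auto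
  then show ?thesis using assms by (simp add: powr_powr)
qed

text \<open>A discrete form of the \<open>\<tau>\<close>-th power of the Besov norm, sampled at the grid steps.\<close>

definition besov_sum :: "nat \<Rightarrow> nat \<Rightarrow> real \<Rightarrow> real \<Rightarrow> (real \<Rightarrow> real) \<Rightarrow> ennreal" where
  "besov_sum b k \<tau> r f =
     (\<Sum>j. ennreal (real b powr (real j * (r * \<tau>))) *
        (\<integral>\<^sup>+z\<in>{0..<1 - real k * (1 / real (b ^ Suc (j + k)))}.
           ennreal (\<bar>(difference (1 / real (b ^ Suc (j + k))) ^^ k) f z\<bar> powr \<tau>) \<partial>lborel))
     + (\<integral>\<^sup>+z\<in>{0..<1}. ennreal (\<bar>f z\<bar> powr \<tau>) \<partial>lborel)"

text \<open>Integrating over the grid position \<open>\<xi>\<close> turns the sums of differences at grid points into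
  integrals; hence one \<open>\<xi>\<close> serves all levels at once.\<close>

lemma exists_multiscale:
  fixes f :: "real \<Rightarrow> real"
  assumes b: "2 \<le> b" and k: "0 < k" and \<tau>: "0 < \<tau>" and B: "0 < B"
    and f [measurable]: "f \<in> borel_measurable borel"
    and bs: "besov_sum b k \<tau> r f \<le> ennreal (B powr \<tau>)"
  shows "\<exists>P \<delta> js. multiscale b k \<tau> r (step_const b k * real (b ^ Suc k) powr (1 / \<tau>) * B) f P \<delta> js"
proof -
  define M where "M = b ^ Suc k"
  define N where "N = (\<lambda>j. b ^ Suc (j + k))"
  define D where "D = (\<lambda>j. (difference (1 / real (N j)) ^^ k) f)"
  define G where "G = (\<lambda>j z. ennreal (\<bar>D j z\<bar> powr \<tau>) * indicator {0..<1 - real k * (1 / real (N j))} z)"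
  have N0: "0 < N j" for j using b by (simp add: N_def)
  have D [measurable]: "D j \<in> borel_measurable borel" for j unfolding D_def by measurable
  have G [measurable]: "G j \<in> borel_measurable borel" for j unfolding G_def by measurable
  have kM: "k < M" unfolding M_def power_Suc
    using less_base_power[OF b, of k] mult_le_mono1[of 1 b "b ^ k"] b by linarith
  have NM: "N j = b ^ j * M" for j by (simp add: N_def M_def power_add)
  obtain js U where js: "\<And>i. i \<le> js i" and U [measurable]: "U \<in> borel_measurable borel"
    and intU: "(\<integral>\<^sup>+\<xi>\<in>{0..<1::real}. U \<xi> \<partial>lborel) < \<infinity>"
    and conv: "\<And>\<xi>. U \<xi> < \<infinity> \<Longrightarrow> (AE x in lborel. x \<in> {0..<1} \<longrightarrow> (\<lambda>i. sample b k f \<xi> (js i) x) \<longlonglongrightarrow> f x)"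
    using sample_converges[OF b k f] by blast
  \<comment> \<open>The weight \<open>b\<^sup>j\<^sup>(\<^sup>r\<^sup>\<tau>\<^sup>-\<^sup>1\<^sup>)\<close>: integration contributes the number of grid points, a multiple of \<open>b\<^sup>j\<close>.\<close>
  define wt where "wt = (\<lambda>j::nat. real b powr (real j * (r * \<tau> - 1)))"
  define F where "F = (\<lambda>z. ennreal (\<bar>f z\<bar> powr \<tau>))"
  have F [measurable]: "F \<in> borel_measurable borel" unfolding F_def by measurable
  define A where "A = (\<lambda>\<xi>. (\<Sum>j. ennreal (wt j) * grid_sum (N j) (G j) \<xi>) + grid_sum (b ^ k) F \<xi>)"
  have A [measurable]: "A \<in> borel_measurable borel" unfolding A_def by measurable
  define Kc where "Kc = real M * B powr \<tau>"
  have intA: "(\<integral>\<^sup>+\<xi>\<in>{0..<1}. A \<xi> \<partial>lborel) \<le> ennreal Kc"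
  proof -
    define X where "X = (\<lambda>j. ennreal (real b powr (real j * (r * \<tau>))) *
         (\<integral>\<^sup>+z\<in>{0..<1 - real k * (1 / real (N j))}. ennreal (\<bar>D j z\<bar> powr \<tau>) \<partial>lborel))"
    have bk: "0 < b ^ k" using b by simp
    have intG: "(\<integral>\<^sup>+z\<in>{0..<1}. G j z \<partial>lborel) =
       (\<integral>\<^sup>+z\<in>{0..<1 - real k * (1 / real (N j))}. ennreal (\<bar>D j z\<bar> powr \<tau>) \<partial>lborel)" for j
      by (intro nn_integral_cong) (auto simp: G_def indicator_def intro: order_less_le_trans)
    have coef: "ennreal (wt j) * (of_nat (N j) * I) = of_nat M * (ennreal (real b powr (real j * (r * \<tau>))) * I)" for j I
    proof -
      have "wt j * real (N j) = real M * real b powr (real j * (r * \<tau>))"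
        using b by (simp add: wt_def NM right_diff_distrib powr_diff powr_realpow)
      then have "ennreal (wt j) * of_nat (N j) = of_nat M * ennreal (real b powr (real j * (r * \<tau>)))"
        by (simp add: ennreal_of_nat_eq_real_of_nat ennreal_mult[symmetric] wt_def)
      then show ?thesis by (simp add: mult.assoc[symmetric])
    qed
    have "(\<integral>\<^sup>+\<xi>\<in>{0..<1}. A \<xi> \<partial>lborel) =
       (\<integral>\<^sup>+\<xi>. (\<Sum>j. ennreal (wt j) * (grid_sum (N j) (G j) \<xi> * indicator {0..<1} \<xi>))
            + grid_sum (b ^ k) F \<xi> * indicator {0..<1} \<xi> \<partial>lborel)"
      by (intro nn_integral_cong) (auto simp: A_def indicator_def)
    also have "\<dots> = (\<Sum>j. ennreal (wt j) * (\<integral>\<^sup>+\<xi>\<in>{0..<1}. grid_sum (N j) (G j) \<xi> \<partial>lborel))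
        + (\<integral>\<^sup>+\<xi>\<in>{0..<1}. grid_sum (b ^ k) F \<xi> \<partial>lborel)"
      by (simp add: nn_integral_add nn_integral_suminf nn_integral_cmult)
    also have "\<dots> = (\<Sum>j. of_nat M * X j) + of_nat (b ^ k) * (\<integral>\<^sup>+z\<in>{0..<1}. F z \<partial>lborel)"
      using b by (simp only: nn_integral_grid_sum[OF G N0] nn_integral_grid_sum[OF F bk] coef intG X_def)
    also have "\<dots> \<le> of_nat M * (\<Sum>j. X j) + of_nat M * (\<integral>\<^sup>+z\<in>{0..<1}. F z \<partial>lborel)"
      unfolding ennreal_suminf_cmult
    proof (rule add_left_mono, rule mult_right_mono)
      have "b ^ k \<le> M" using b by (simp add: M_def)
      then show "(of_nat (b ^ k) :: ennreal) \<le> of_nat M" by (rule of_nat_mono)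
    qed simp
    also have "\<dots> = of_nat M * besov_sum b k \<tau> r f"
      by (simp only: besov_sum_def distrib_left X_def N_def D_def F_def)
    also have "\<dots> \<le> of_nat M * ennreal (B powr \<tau>)" by (intro mult_left_mono bs) simp
    also have "\<dots> = ennreal Kc" by (simp add: Kc_def ennreal_of_nat_eq_real_of_nat ennreal_mult)
    finally show ?thesis .
  qed
  obtain \<xi> where A\<xi>: "A \<xi> \<le> ennreal Kc" and U\<xi>: "U \<xi> < \<infinity>"
    using exists_good_point[OF A U intA intU] by blast
  have Kc0: "0 \<le> Kc" by (simp add: Kc_def)
  define z where "z = (\<lambda>j a n. (real (a * M + n) + frac (real (N j) * \<xi>)) / real (N j))"
  define E where "E = (\<lambda>j a. \<Sum>n<M - k. \<bar>D j (z j a n)\<bar> powr \<tau>)"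
  have E0: "0 \<le> E j a" for j a by (auto simp: E_def intro: sum_nonneg)
  have sumE: "(\<Sum>a<b ^ j. E j a) \<le> Kc * real b powr (real j * (1 - r * \<tau>))" for j
  proof -
    have "ennreal (\<Sum>a<b ^ j. E j a) = (\<Sum>a<b ^ j. \<Sum>n<M - k. ennreal (\<bar>D j (z j a n)\<bar> powr \<tau>))"
      by (simp add: E_def sum_ennreal sum_nonneg)
    also have "\<dots> = (\<Sum>a<b ^ j. \<Sum>n<M - k. G j (z j a n))"
    proof (intro sum.cong refl)
      fix a n assume a: "a \<in> {..<b ^ j}" and n: "n \<in> {..<M - k}"
      have fr: "0 \<le> frac (real (N j) * \<xi>)" "frac (real (N j) * \<xi>) < 1" by (auto simp: frac_lt_1)
      have "(a + 1) * M \<le> b ^ j * M" using a by (intro mult_right_mono) auto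
      then have "a * M + n + 1 + k \<le> N j" using n by (simp add: NM)
      then have "real (a * M + n) + 1 + real k \<le> real (N j)" by linarith
      then have "real (a * M + n) + frac (real (N j) * \<xi>) < real (N j) - real k" using fr by linarith
      then have "z j a n < 1 - real k * (1 / real (N j))"
        using divide_strict_right_mono[of _ "real (N j) - real k" "real (N j)"] N0[of j]
        by (simp add: z_def diff_divide_distrib)
      moreover have "0 \<le> z j a n" using fr by (simp add: z_def)
      ultimately show "ennreal (\<bar>D j (z j a n)\<bar> powr \<tau>) = G j (z j a n)" by (simp add: G_def)
    qed
    also have "\<dots> \<le> grid_sum (N j) (G j) \<xi>"
      unfolding grid_sum_def z_def
      using sum_blocks_le[of "M - k" M "\<lambda>n. G j ((real n + frac (real (N j) * \<xi>)) / real (N j))" "b ^ j"]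
      by (simp add: NM)
    finally have "ennreal (wt j) * ennreal (\<Sum>a<b ^ j. E j a) \<le> ennreal (wt j) * grid_sum (N j) (G j) \<xi>"
      by (rule mult_left_mono) simp
    also have "\<dots> \<le> (\<Sum>j. ennreal (wt j) * grid_sum (N j) (G j) \<xi>)"
      using sum_le_suminf[of "\<lambda>j. ennreal (wt j) * grid_sum (N j) (G j) \<xi>" "{j}"] by simp
    also have "\<dots> \<le> A \<xi>" by (simp add: A_def)
    also note A\<xi>
    finally have "wt j * (\<Sum>a<b ^ j. E j a) \<le> Kc"
      using Kc0 by (simp add: ennreal_mult[symmetric] wt_def sum_nonneg E0)
    then have "real b powr (real j * (1 - r * \<tau>)) * (wt j * (\<Sum>a<b ^ j. E j a)) \<le> real b powr (real j * (1 - r * \<tau>)) * Kc"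
      by (intro mult_left_mono) auto
    moreover have "real b powr (real j * (1 - r * \<tau>)) * wt j = 1"
      using b by (simp add: wt_def powr_add[symmetric] algebra_simps)
    ultimately show ?thesis by (metis mult.assoc mult.commute mult_1)
  qed
  define C1 where "C1 = step_const b k"
  have C1: "0 < C1" unfolding C1_def step_const_def
    by (intro mult_pos_pos zero_less_power add_nonneg_pos) (use k b in auto)
  define \<delta> where "\<delta> = (\<lambda>j a. C1 * E j a powr (1 / \<tau>))"
  let ?K = "C1 * real (b ^ Suc k) powr (1 / \<tau>) * B"
  have Kpow: "?K powr \<tau> = C1 powr \<tau> * Kc"
    using B C1 \<tau> b by (simp add: Kc_def M_def powr_mult powr_powr)
  have "multiscale b k \<tau> r ?K f (sample_poly b k f \<xi>) \<delta> js"
  proof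
    show "2 \<le> b" "0 < k" "0 < \<tau>" "f \<in> borel_measurable borel" by fact+
    show "0 < ?K" using B C1 b by simp
    show "degree (sample_poly b k f \<xi> j a) < k" for j a using degree_sample_poly b k by auto
    show "0 \<le> \<delta> j a" for j a using C1 by (simp add: \<delta>_def)
    show "i \<le> js i" for i by (rule js)
    show "AE x in lborel. x \<in> {0..<1} \<longrightarrow>
        (\<lambda>i. poly (sample_poly b k f \<xi> (js i) (cell b (js i) x)) x) \<longlonglongrightarrow> f x"
      using conv[OF U\<xi>] by (simp add: sample_def)
    show "(\<Sum>a<b ^ j. \<delta> j a powr \<tau>) \<le> ?K powr \<tau> * real b powr (real j * (1 - r * \<tau>))" for j
    proof -
      have "(\<Sum>a<b ^ j. \<delta> j a powr \<tau>) = C1 powr \<tau> * (\<Sum>a<b ^ j. E j a)"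
        using C1 \<tau> E0 by (simp add: \<delta>_def powr_mult powr_powr sum_distrib_left)
      also have "\<dots> \<le> C1 powr \<tau> * (Kc * real b powr (real j * (1 - r * \<tau>)))"
        by (intro mult_left_mono sumE) simp
      finally show ?thesis unfolding Kpow by (simp only: mult.assoc)
    qed
    show "\<bar>poly (sample_poly b k f \<xi> 0 0) x\<bar> \<le> ?K" if x: "x \<in> {0..<1}" for x
    proof -
      have "\<bar>f (node b k \<xi> 0 0 i) - 0\<bar> \<le> Kc powr (1 / \<tau>)" if i: "i < k" for i
      proof -
        have "F (node b k \<xi> 0 0 i) \<le> grid_sum (b ^ k) F \<xi>"
          unfolding grid_sum_def
          using i less_base_power[OF b, of k] by (intro order_trans[OF _ member_le_sum[of i]]) (auto simp: node_def)
        also have "\<dots> \<le> A \<xi>" by (simp add: A_def)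
        also note A\<xi>
        finally show ?thesis using powr_inverse_le[OF _ \<tau> Kc0] by (simp add: F_def)
      qed
      then have "\<bar>poly (sample_poly b k f \<xi> 0 0) x - 0\<bar> \<le> real k * (real (b ^ k) + 1) ^ k * Kc powr (1 / \<tau>)"
        using x by (intro sample_poly_bound b k) (auto simp: cell_0)
      also have "\<dots> \<le> C1 * Kc powr (1 / \<tau>)"
      proof (intro mult_right_mono)
        have le: "real (b ^ k) \<le> real (b ^ Suc k)" using b by simp
        have "real k * (real (b ^ k) + 1) ^ k \<le> real k * (real (b ^ Suc k) + 1) ^ k"
          using le by (intro mult_left_mono power_mono) auto
        also have "\<dots> \<le> real k * (real (b ^ Suc k) + 1) ^ k * (2 * real (b ^ Suc k) ^ k)"
        proof -
          have "1 \<le> real b ^ Suc k" using b by (intro one_le_power) simp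
          then have "1 \<le> real (b ^ Suc k) ^ k" by (intro one_le_power) (simp only: of_nat_power)
          then have "1 \<le> 2 * real (b ^ Suc k) ^ k" by linarith
          moreover have "0 \<le> real k * (real (b ^ Suc k) + 1) ^ k" by simp
          ultimately show ?thesis by (metis mult.right_neutral mult_left_mono)
        qed
        finally show "real k * (real (b ^ k) + 1) ^ k \<le> C1" by (simp add: C1_def step_const_def mult_ac)
      qed simp
      also have "C1 * Kc powr (1 / \<tau>) = ?K"
        using B \<tau> by (simp add: Kc_def M_def powr_mult powr_powr)
      finally show ?thesis by simp
    qed
    show "\<bar>poly (sample_poly b k f \<xi> (Suc j) (cell b (Suc j) x)) x - poly (sample_poly b k f \<xi> j (cell b j x)) x\<bar>
        \<le> \<delta> j (cell b j x)" if x: "x \<in> {0..<1}" for j x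
    proof -
      define a where "a = cell b j x"
      define c where "c = cell b (Suc j) x mod b"
      have "cell b (Suc j) x div b = a"
        unfolding a_def by (rule cell_Suc_div) (use b x in auto)
      then have ca: "cell b (Suc j) x = b * a + c"
        using mult_div_mod_eq[of b "cell b (Suc j) x"] by (simp add: c_def)
      have "\<bar>poly (sample_poly b k f \<xi> (Suc j) (b * a + c)) x - poly (sample_poly b k f \<xi> j a) x\<bar>
          \<le> step_const b k * E j a powr (1 / \<tau>)"
      proof (rule sample_poly_step[OF b k, where N = "N j" and \<eta> = "frac (real (N j) * \<xi>)"])
        show "\<bar>(difference (1 / real (N j)) ^^ k) f ((real (a * b ^ Suc k + n) + frac (real (N j) * \<xi>)) / real (N j))\<bar>
           \<le> E j a powr (1 / \<tau>)" if n: "n + k < b ^ Suc k" for n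
        proof -
          have "\<bar>D j (z j a n)\<bar> powr \<tau> \<le> E j a"
            unfolding E_def using n by (intro member_le_sum) (auto simp: M_def)
          then have "\<bar>D j (z j a n)\<bar> \<le> E j a powr (1 / \<tau>)"
            by (intro powr_inverse_le \<tau> E0 ennreal_leI)
          then show ?thesis by (simp only: D_def z_def M_def)
        qed
      qed (use x b in \<open>auto simp: a_def c_def N_def\<close>)
      then show ?thesis unfolding ca a_def[symmetric] by (simp add: \<delta>_def C1_def)
    qed
  qed
  then show ?thesis unfolding C1_def by blast
qed

section \<open>Nonlinear approximation by few cells\<close>

definition unit_lborel :: "real measure" where
  "unit_lborel = restrict_space lborel {0..<1}"

lemma measurable_unit_lborel [measurable (raw)]: "f \<in> borel_measurable borel \<Longrightarrow> f \<in> borel_measurable unit_lborel"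
  unfolding unit_lborel_def by (intro measurable_restrict_space1) simp

lemma nn_integral_unit_lborel: "(\<integral>\<^sup>+x. F x \<partial>unit_lborel) = (\<integral>\<^sup>+x\<in>{0..<1}. F x \<partial>lborel)"
  unfolding unit_lborel_def by (rule nn_integral_restrict_space) simp

lemma space_unit_lborel: "space unit_lborel = {0..<1}"
  by (simp add: unit_lborel_def space_restrict_space)

abbreviation p_integral :: "real \<Rightarrow> (real \<Rightarrow> real) \<Rightarrow> ennreal" where
  "p_integral p f \<equiv> (\<integral>\<^sup>+x. ennreal (\<bar>f x\<bar> powr p) \<partial>unit_lborel)"

lemma geometric_sum_le:
  fixes q :: real
  assumes "0 \<le> q" "q < 1"
  shows "(\<Sum>j=l..<n. q ^ (j - l)) \<le> 1 / (1 - q)"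
proof -
  have "(\<Sum>j=l..<n. q ^ (j - l)) = (\<Sum>i<n - l. q ^ i)"
    by (rule sum.reindex_bij_witness[of _ "\<lambda>i. i + l" "\<lambda>j. j - l"]) auto
  also have "\<dots> \<le> (\<Sum>i. q ^ i)"
    using assms by (intro sum_le_suminf summable_geometric) auto
  also have "\<dots> = 1 / (1 - q)" using assms by (intro suminf_geometric) auto
  finally show ?thesis .
qed

context multiscale
begin

definition S :: "nat \<Rightarrow> real \<Rightarrow> real" where "S j x = poly (P j (cell b j x)) x"
definition D :: "nat \<Rightarrow> real \<Rightarrow> real" where "D j x = S (Suc j) x - S j x"

lemma b0: "0 < b" using b by simp

lemma measurable_S [measurable]: "S j \<in> borel_measurable borel"
proof -
  have "(\<lambda>x. (\<lambda>a. poly (P j a) x) (cell b j x)) \<in> borel_measurable borel"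
    by (rule measurable_compose_countable[where g = "cell b j"])
      (auto intro!: borel_measurable_continuous_onI continuous_intros)
  then show ?thesis by (simp add: S_def[abs_def])
qed

lemma measurable_D [measurable]: "D j \<in> borel_measurable borel"
  unfolding D_def[abs_def] by measurable

lemma D_le: "x \<in> {0..<1} \<Longrightarrow> \<bar>D j x\<bar> \<le> \<delta> j (cell b j x)"
  using step[of x j] by (simp add: D_def S_def)

lemma S_telescope: "m \<le> n \<Longrightarrow> S n x = S m x + (\<Sum>j=m..<n. D j x)"
  using sum_Suc_diff'[of m n "\<lambda>j. S j x"] by (simp add: D_def)

lemma \<delta>_le:
  assumes "a < b ^ j"
  shows "\<delta> j a \<le> K * real b powr (real j * (1 / \<tau> - r))"
proof -
  have "\<delta> j a powr \<tau> \<le> (\<Sum>a<b ^ j. \<delta> j a powr \<tau>)"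
    using assms by (intro member_le_sum) auto
  also have "\<dots> \<le> K powr \<tau> * real b powr (real j * (1 - r * \<tau>))" by (rule sum_\<delta>)
  finally have "(\<delta> j a powr \<tau>) powr (1 / \<tau>) \<le> (K powr \<tau> * real b powr (real j * (1 - r * \<tau>))) powr (1 / \<tau>)"
    using \<tau> by (intro powr_mono2) auto
  then show ?thesis using \<tau> K \<delta>_nonneg by (simp add: powr_powr powr_mult field_simps)
qed

text \<open>The error from discarding the steps of level \<open>j\<close> on a set \<open>A\<close> of cells where they are small:
  \<open>\<delta>\<^sup>p \<le> \<eta>\<^sup>p\<^sup>-\<^sup>\<tau> \<delta>\<^sup>\<tau>\<close>.\<close>

lemma discard_error:
  assumes p: "\<tau> < p" and A: "A \<subseteq> {..<b ^ j}"
    and small: "\<And>a. a \<in> A \<Longrightarrow> \<delta> j a \<le> K * real b powr (- real j * r + (real j - real l) / \<tau>)"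
  shows "p_integral p (\<lambda>x. if cell b j x \<in> A then D j x else 0)
     \<le> ennreal ((K * real b powr (- real l * r - (real j - real l) * (r - 1 / \<tau> + 1 / p))) powr p)"
proof -
  define \<eta> where "\<eta> = K * real b powr (- real j * r + (real j - real l) / \<tau>)"
  have \<eta>: "0 < \<eta>" using K b by (simp add: \<eta>_def)
  have p0: "0 < p" using p \<tau> by simp
  have bj: "1 / real (b ^ j) = real b powr (- real j)"
    using b by (simp add: powr_minus powr_realpow inverse_eq_divide)
  have collect: "real b powr u * ((K * real b powr x) powr s * (K powr \<tau> * real b powr w))
      = (K powr s * K powr \<tau>) * real b powr (u + x * s + w)" for u x s w
    by (simp add: powr_mult powr_powr powr_add mult_ac)
  define F where "F = (\<lambda>a. if a \<in> A then ennreal (\<delta> j a powr p) else 0)"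
  have "p_integral p (\<lambda>x. if cell b j x \<in> A then D j x else 0)
      \<le> (\<integral>\<^sup>+x. F (cell b j x) \<partial>unit_lborel)"
    using D_le p0 by (intro nn_integral_mono) (auto simp: F_def space_unit_lborel intro!: ennreal_leI powr_mono2)
  also have "\<dots> = ennreal (1 / real (b ^ j)) * (\<Sum>a<b ^ j. F a)"
    unfolding nn_integral_unit_lborel using nn_integral_step[of "b ^ j" F] b0 by (simp add: cell_def)
  also have "(\<Sum>a<b ^ j. F a) = (\<Sum>a\<in>A. ennreal (\<delta> j a powr p))"
    unfolding F_def using A by (intro sum.mono_neutral_cong_right) auto
  also have "\<dots> = ennreal (\<Sum>a\<in>A. \<delta> j a powr p)" by (rule sum_ennreal) simp
  also have "ennreal (1 / real (b ^ j)) * \<dots> = ennreal (1 / real (b ^ j) * (\<Sum>a\<in>A. \<delta> j a powr p))"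
    by (rule ennreal_mult[symmetric]) (auto intro: sum_nonneg)
  also have "\<dots> \<le> ennreal ((K * real b powr (- real l * r - (real j - real l) * (r - 1 / \<tau> + 1 / p))) powr p)"
  proof (rule ennreal_leI)
    have "(\<Sum>a\<in>A. \<delta> j a powr p) \<le> (\<Sum>a\<in>A. \<eta> powr (p - \<tau>) * \<delta> j a powr \<tau>)"
    proof (rule sum_mono)
      fix a assume a: "a \<in> A"
      have "\<delta> j a powr p = \<delta> j a powr (p - \<tau>) * \<delta> j a powr \<tau>" by (simp add: powr_add[symmetric])
      also have "\<dots> \<le> \<eta> powr (p - \<tau>) * \<delta> j a powr \<tau>"
        using small[OF a] p \<delta>_nonneg by (intro mult_right_mono powr_mono2) (auto simp: \<eta>_def)
      finally show "\<delta> j a powr p \<le> \<eta> powr (p - \<tau>) * \<delta> j a powr \<tau>" .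
    qed
    also have "\<dots> \<le> \<eta> powr (p - \<tau>) * (\<Sum>a<b ^ j. \<delta> j a powr \<tau>)"
      unfolding sum_distrib_left[symmetric] using A by (intro mult_left_mono sum_mono2) auto
    also have "\<dots> \<le> \<eta> powr (p - \<tau>) * (K powr \<tau> * real b powr (real j * (1 - r * \<tau>)))"
      by (intro mult_left_mono sum_\<delta>) simp
    finally have "1 / real (b ^ j) * (\<Sum>a\<in>A. \<delta> j a powr p) \<le>
        1 / real (b ^ j) * (\<eta> powr (p - \<tau>) * (K powr \<tau> * real b powr (real j * (1 - r * \<tau>))))"
      by (rule mult_left_mono) simp
    also have "1 / real (b ^ j) * (\<eta> powr (p - \<tau>) * (K powr \<tau> * real b powr (real j * (1 - r * \<tau>))))
       = (K powr (p - \<tau>) * K powr \<tau>) * real b powr (- real j + (- real j * r + (real j - real l) / \<tau>) * (p - \<tau>) + real j * (1 - r * \<tau>))"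
      unfolding \<eta>_def bj by (rule collect)
    also have "K powr (p - \<tau>) * K powr \<tau> = K powr p" by (simp add: powr_add[symmetric])
    also have "- real j + (- real j * r + (real j - real l) / \<tau>) * (p - \<tau>) + real j * (1 - r * \<tau>)
        = (- real l * r - (real j - real l) * (r - 1 / \<tau> + 1 / p)) * p"
      using p0 \<tau> by (simp add: field_simps)
    also have "K powr p * real b powr \<dots> = (K * real b powr (- real l * r - (real j - real l) * (r - 1 / \<tau> + 1 / p))) powr p"
      using K by (simp add: powr_mult powr_powr)
    finally show "1 / real (b ^ j) * (\<Sum>a\<in>A. \<delta> j a powr p)
       \<le> (K * real b powr (- real l * r - (real j - real l) * (r - 1 / \<tau> + 1 / p))) powr p" .
  qed
  finally show ?thesis .
qed

text \<open>The threshold is the value that the bound on the \<open>l\<^sup>\<tau>\<close> sum allows for \<open>b\<^sup>l\<close> equal terms.\<close>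

definition large :: "nat \<Rightarrow> nat \<Rightarrow> nat set" where
  "large l j = {a. a < b ^ j \<and> K * real b powr (- real j * r + (real j - real l) / \<tau>) < \<delta> j a}"

lemma finite_large: "finite (large l j)" by (simp add: large_def)

lemma card_large: "card (large l j) \<le> b ^ l"
proof -
  define \<eta> where "\<eta> = K * real b powr (- real j * r + (real j - real l) / \<tau>)"
  have \<eta>: "0 < \<eta>" using K b by (simp add: \<eta>_def)
  have e: "\<eta> powr \<tau> = K powr \<tau> * real b powr (real j * (1 - r * \<tau>)) / real b powr real l"
  proof -
    have "(- real j * r + (real j - real l) / \<tau>) * \<tau> = real j * (1 - r * \<tau>) - real l"
      using \<tau> by (simp add: field_simps)
    then have "\<eta> powr \<tau> = K powr \<tau> * real b powr (real j * (1 - r * \<tau>) - real l)"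
      by (simp only: \<eta>_def powr_mult powr_powr)
    then show ?thesis by (simp add: powr_diff)
  qed
  have "real (card (large l j)) * \<eta> powr \<tau> = (\<Sum>a\<in>large l j. \<eta> powr \<tau>)" by simp
  also have "\<dots> \<le> (\<Sum>a\<in>large l j. \<delta> j a powr \<tau>)"
    using \<eta> \<tau> by (intro sum_mono powr_mono2) (auto simp: large_def \<eta>_def)
  also have "\<dots> \<le> (\<Sum>a<b ^ j. \<delta> j a powr \<tau>)" by (intro sum_mono2) (auto simp: large_def)
  also have "\<dots> \<le> K powr \<tau> * real b powr (real j * (1 - r * \<tau>))" by (rule sum_\<delta>)
  also have "\<dots> = real b powr real l * \<eta> powr \<tau>" using b by (simp add: e)
  finally have "real (card (large l j)) \<le> real b powr real l" using \<eta> by simp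
  then have "real (card (large l j)) \<le> real (b ^ l)" using b by (simp add: powr_realpow)
  then show ?thesis by (simp only: of_nat_le_iff)
qed

definition coarse :: "nat \<Rightarrow> nat \<Rightarrow> real \<Rightarrow> real" where
  "coarse l L x = S l x + (\<Sum>j=l..<L. if cell b j x \<in> large l j then D j x else 0)"

lemma measurable_coarse [measurable]: "coarse l L \<in> borel_measurable borel"
  unfolding coarse_def[abs_def] by measurable

text \<open>From level \<open>l\<close> on only the steps on the large cells are kept, from level \<open>L\<close> on none. At both
  kinds of levels the discarded steps decay geometrically in \<open>L\<^sup>p\<close>, by the gap
  \<open>r - 1/\<tau> + 1/p > 0\<close> to the embedding line.\<close>

lemma coarse_error:
  assumes p: "1 \<le> p" "\<tau> < p" and al: "al = r - 1 / \<tau> + 1 / p" "0 < al"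
    and L: "l \<le> L" "real l * r \<le> real L * al" and q: "q = real b powr (- al)"
  shows "p_integral p (\<lambda>x. f x - coarse l L x)
     \<le> ennreal ((2 / (1 - q) * K * real b powr (- real l * r)) powr p)"
proof -
  have q01: "0 \<le> q" "q < 1" using b al by (auto simp: q powr_less_one)
  have qpow: "q ^ n = real b powr (- (real n * al))" for n
    using b by (simp add: q powr_realpow[symmetric] powr_powr mult.commute)
  define R where "R = (\<lambda>j x. if j < L \<and> cell b j x \<in> large l j then 0 else D j x)"
  define A where "A = (\<lambda>j. K * real b powr (- real l * r) * (q ^ (j - l) + (if L \<le> j then q ^ (j - L) else 0)))"
  have R [measurable]: "R j \<in> borel_measurable borel" for j
    unfolding R_def by measurable
  have A0: "0 \<le> A j" for j using K q01 by (simp add: A_def)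
  have RA: "p_integral p (R j) \<le> ennreal (A j powr p)" if j: "l \<le> j" for j
  proof (cases "j < L")
    case True
    let ?X = "{..<b ^ j} - large l j"
    have "p_integral p (R j)
        = (p_integral p (\<lambda>x. if cell b j x \<in> ?X then D j x else 0))"
      using True cell_less[OF b0] by (intro nn_integral_cong) (auto simp: R_def space_unit_lborel)
    also have "\<dots> \<le> ennreal ((K * real b powr (- real l * r - (real j - real l) * (r - 1 / \<tau> + 1 / p))) powr p)"
      by (rule discard_error[OF p(2)]) (auto simp: large_def not_less)
    also have "K * real b powr (- real l * r - (real j - real l) * (r - 1 / \<tau> + 1 / p)) = A j"
      using True j by (simp add: A_def qpow al(1)[symmetric] powr_add[symmetric] of_nat_diff)
    finally show ?thesis .
  next
    case False
    have "p_integral p (R j)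
        = (p_integral p (\<lambda>x. if cell b j x \<in> {..<b ^ j} then D j x else 0))"
      using False cell_less[OF b0] by (intro nn_integral_cong) (auto simp: R_def space_unit_lborel)
    also have "\<dots> \<le> ennreal ((K * real b powr (- real 0 * r - (real j - real 0) * (r - 1 / \<tau> + 1 / p))) powr p)"
    proof (rule discard_error[OF p(2)])
      show "\<delta> j a \<le> K * real b powr (- real j * r + (real j - real 0) / \<tau>)" if "a \<in> {..<b ^ j}" for a
        using \<delta>_le[of a j] that by (simp add: algebra_simps)
    qed simp
    also have "\<dots> \<le> ennreal (A j powr p)"
    proof (intro ennreal_leI powr_mono2)
      have "real b powr (- real 0 * r - (real j - real 0) * (r - 1 / \<tau> + 1 / p)) =
          real b powr (- (real L * al)) * q ^ (j - L)"
      proof -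
        have "- real 0 * r - (real j - real 0) * (r - 1 / \<tau> + 1 / p) = - (real L * al) + - (real (j - L) * al)"
          unfolding al(1)[symmetric] using False by (simp add: of_nat_diff left_diff_distrib)
        then show ?thesis by (simp only: qpow powr_add)
      qed
      also have "\<dots> \<le> real b powr (- real l * r) * q ^ (j - L)"
        using L b q01 by (intro mult_right_mono powr_mono) auto
      also have "\<dots> \<le> real b powr (- real l * r) * (q ^ (j - l) + (if L \<le> j then q ^ (j - L) else 0))"
        using False q01 by (intro mult_left_mono) auto
      finally show "K * real b powr (- real 0 * r - (real j - real 0) * (r - 1 / \<tau> + 1 / p)) \<le> A j"
        using K by (simp add: A_def mult.assoc)
    qed (use p K in auto)
    finally show ?thesis .
  qed
  have sumA: "(\<Sum>j=l..<n. A j) \<le> 2 / (1 - q) * K * real b powr (- real l * r)" if n: "L \<le> n" for n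
  proof -
    have "(\<Sum>j=l..<n. if L \<le> j then q ^ (j - L) else 0) = (\<Sum>j=L..<n. q ^ (j - L))"
      using L by (intro sum.mono_neutral_cong_right) auto
    then have "(\<Sum>j=l..<n. A j) = K * real b powr (- real l * r) * ((\<Sum>j=l..<n. q ^ (j - l)) + (\<Sum>j=L..<n. q ^ (j - L)))"
      by (simp add: A_def sum_distrib_left[symmetric] sum.distrib)
    also have "\<dots> \<le> K * real b powr (- real l * r) * (1 / (1 - q) + 1 / (1 - q))"
      using K by (intro mult_left_mono add_mono geometric_sum_le q01) auto
    finally show ?thesis by (simp add: mult_ac)
  qed
  have Sn: "p_integral p (\<lambda>x. S n x - coarse l L x)
     \<le> ennreal ((2 / (1 - q) * K * real b powr (- real l * r)) powr p)" if n: "L \<le> n" for n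
  proof -
    have eq: "S n x - coarse l L x = (\<Sum>j=l..<n. R j x)" for x
    proof -
      have "(\<Sum>j=l..<L. if cell b j x \<in> large l j then D j x else 0)
          = (\<Sum>j=l..<n. if j < L \<and> cell b j x \<in> large l j then D j x else 0)"
        using n by (intro sum.mono_neutral_cong_left) auto
      then have "S n x - coarse l L x = (\<Sum>j=l..<n. D j x - (if j < L \<and> cell b j x \<in> large l j then D j x else 0))"
        using S_telescope[of l n x] L n by (simp add: coarse_def sum_subtractf)
      also have "\<dots> = (\<Sum>j=l..<n. R j x)" by (intro sum.cong) (auto simp: R_def)
      finally show ?thesis .
    qed
    have "p_integral p (\<lambda>x. \<Sum>j=l..<n. R j x) \<le> ennreal ((\<Sum>j=l..<n. A j) powr p)"
      by (rule minkowski_sum[OF _ p(1)]) (use A0 RA in auto)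
    also have "\<dots> \<le> ennreal ((2 / (1 - q) * K * real b powr (- real l * r)) powr p)"
      using p A0 sumA[OF n] by (intro ennreal_leI powr_mono2) (auto intro: sum_nonneg)
    finally show ?thesis by (simp only: eq)
  qed
  have "AE x in unit_lborel. (\<lambda>i. S (js i) x) \<longlonglongrightarrow> f x"
    unfolding unit_lborel_def by (subst AE_restrict_space_iff) (use conv in \<open>auto simp: S_def\<close>)
  then have "p_integral p (\<lambda>x. f x - coarse l L x)
     \<le> (\<integral>\<^sup>+x. liminf (\<lambda>i. ennreal (\<bar>S (js i) x - coarse l L x\<bar> powr p)) \<partial>unit_lborel)"
  proof (intro nn_integral_mono_AE, eventually_elim)
    case (elim x)
    have "(\<lambda>i. \<bar>S (js i) x - coarse l L x\<bar> powr p) \<longlonglongrightarrow> \<bar>f x - coarse l L x\<bar> powr p"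
      using p by (intro tendsto_powr' tendsto_intros elim) auto
    then have "(\<lambda>i. ennreal (\<bar>S (js i) x - coarse l L x\<bar> powr p)) \<longlonglongrightarrow> ennreal (\<bar>f x - coarse l L x\<bar> powr p)"
      by (rule tendsto_ennrealI)
    from lim_imp_Liminf[OF sequentially_bot this] show ?case by simp
  qed
  also have "\<dots> \<le> liminf (\<lambda>i. \<integral>\<^sup>+x. ennreal (\<bar>S (js i) x - coarse l L x\<bar> powr p) \<partial>unit_lborel)"
    by (rule nn_integral_liminf) measurable
  also have "\<dots> \<le> liminf (\<lambda>i::nat. ennreal ((2 / (1 - q) * K * real b powr (- real l * r)) powr p))"
  proof (rule Liminf_mono)
    show "\<forall>\<^sub>F i in sequentially. (p_integral p (\<lambda>x. S (js i) x - coarse l L x))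
        \<le> ennreal ((2 / (1 - q) * K * real b powr (- real l * r)) powr p)"
      using eventually_ge_at_top[of L] by eventually_elim (use Sn js order_trans in blast)
  qed
  also have "\<dots> = ennreal ((2 / (1 - q) * K * real b powr (- real l * r)) powr p)"
    by (simp add: Liminf_const)
  finally show ?thesis .
qed

end

lemma cells_function_in_\<Phi>_set:
  fixes Q :: "nat \<times> nat \<Rightarrow> real poly"
  assumes b: "0 < b" and k: "0 < k" and d: "1 \<le> d" and basis: "is_poly_basis m \<phi>"
    and T: "finite T" "T \<noteq> {}"
    and lvl: "\<And>t. t \<in> T \<Longrightarrow> fst t \<le> d \<and> snd t < b ^ fst t \<and> degree (Q t) < k"
    and n: "d * card T * (b * k + b * k * k + k * (m + 1)) \<le> n"
    and f: "f = (\<lambda>x. \<Sum>t\<in>T. if cell b (fst t) x = snd t then poly (Q t) (real (cell b d x) / real b ^ d) else 0)"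
  shows "f \<in> \<Phi>_set b m \<phi> compl_N n" "f \<in> \<Phi>_set b m \<phi> (compl_S b m) n"
proof -
  obtain h where h: "bij_betw h {0..<card T} T" using ex_bij_betw_nat_finite[OF T(1)] by blast
  have hT: "h i \<in> T" if "i < card T" for i using h that by (auto simp: bij_betw_def)
  obtain c where c: "\<And>y. (\<Sum>l=1..m + 1. c l * poly (\<phi> l) y) = 1" using basis_expansion_of_one[OF basis] by blast
  let ?v = "cells_network b k c d (card T) (\<lambda>i. fst (h i)) (\<lambda>i. snd (h i)) (\<lambda>i. Q (h i))"
  have M: "0 < card T" using T by (simp add: card_gt_0_iff)
  have "realizes b m \<phi> ?v (\<lambda>x. \<Sum>i<card T. if cell b (fst (h i)) x = snd (h i)
      then poly (Q (h i)) (real (cell b d x) / real b ^ d) else 0)"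
    using lvl hT by (intro cells_network_realizes b k d c) auto
  also have "(\<lambda>x. \<Sum>i<card T. if cell b (fst (h i)) x = snd (h i)
      then poly (Q (h i)) (real (cell b d x) / real b ^ d) else 0) = f"
    unfolding f lessThan_atLeast0 by (rule ext) (rule sum.reindex_bij_betw[OF h])
  finally have r: "realizes b m \<phi> ?v f" .
  have v: "is_tensor_network ?v" by (rule cells_network_valid[OF d M k])
  have S: "compl_S b m ?v \<le> n" using compl_S_cells_network[OF k d] n by (rule order_trans)
  have "k \<le> b * k + b * k * k + k * (m + 1)" by simp
  then have "d * card T * k \<le> n" using n by (meson mult_le_mono2 order_trans)
  then have N: "compl_N ?v \<le> n" by (simp add: compl_N_cells_network mult.assoc)
  have "0 < d * card T * k" using M d k by simp
  then have "0 < n" using \<open>d * card T * k \<le> n\<close> by (rule less_le_trans)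
  then show "f \<in> \<Phi>_set b m \<phi> compl_N n" "f \<in> \<Phi>_set b m \<phi> (compl_S b m) n"
    using r v S N by (auto simp: \<Phi>_set_def)
qed

lemma cell_rounded:
  assumes b: "0 < b" and x: "x \<in> {0..<1}" and j: "j \<le> d"
  shows "cell b j (real (cell b d x) / real b ^ d) = cell b j x"
proof -
  let ?y = "real (cell b d x) / real b ^ d"
  have "cell b d ?y = cell b d x" using b by (simp add: cell_def)
  then show ?thesis using cell_div[OF b _ j, of ?y] cell_div[OF b _ j, of x] x by simp
qed

context multiscale
begin

text \<open>The cells of level \<open>l\<close> together with the children of the large cells, and the polynomials that
  \<open>coarse\<close> adds on them.\<close>

definition kept :: "nat \<Rightarrow> nat \<Rightarrow> (nat \<times> nat) set" where
  "kept l L = {l} \<times> {..<b ^ l} \<union>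
     (\<lambda>(j, a). (Suc j, a)) ` (SIGMA j:{l..<L}. {a. a < b ^ Suc j \<and> a div b \<in> large l j})"

definition piece :: "nat \<Rightarrow> nat \<times> nat \<Rightarrow> real poly" where
  "piece l = (\<lambda>(j, a). if j = l then P j a else P j a - P (j - 1) (a div b))"

lemma finite_kept: "finite (kept l L)"
  unfolding kept_def by (auto intro!: finite_imageI finite_SigmaI)

lemma card_kept: 
  assumes "l \<le> L"
  shows "card (kept l L) \<le> b ^ l * (1 + b * L)"
proof -
  let ?A = "\<lambda>j. {a. a < b ^ Suc j \<and> a div b \<in> large l j}"
  have A: "card (?A j) \<le> b * b ^ l" for j
  proof -
    have "?A j \<subseteq> (\<lambda>(a, c). b * a + c) ` (large l j \<times> {..<b})"
    proof
      fix a assume "a \<in> ?A j"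
      then show "a \<in> (\<lambda>(a, c). b * a + c) ` (large l j \<times> {..<b})"
        using b0 by (intro image_eqI[of _ _ "(a div b, a mod b)"]) auto
    qed
    then have "card (?A j) \<le> card (large l j \<times> {..<b})"
      using finite_large by (intro surj_card_le) auto
    also have "\<dots> = card (large l j) * b" by (simp add: card_cartesian_product)
    also have "\<dots> \<le> b ^ l * b" by (intro mult_right_mono card_large) simp
    finally show ?thesis by (simp add: mult.commute)
  qed
  have "card (kept l L) \<le> card ({l} \<times> {..<b ^ l}) + card (SIGMA j:{l..<L}. ?A j)"
    unfolding kept_def by (intro order_trans[OF card_Un_le] add_mono card_image_le finite_SigmaI) auto
  also have "card (SIGMA j:{l..<L}. ?A j) = (\<Sum>j=l..<L. card (?A j))" by (intro card_SigmaI) auto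
  also have "\<dots> \<le> (\<Sum>j=l..<L. b * b ^ l)" by (intro sum_mono A)
  also have "\<dots> \<le> L * (b * b ^ l)" by simp
  finally show ?thesis by (simp add: algebra_simps)
qed

lemma kept_valid:
  assumes "t \<in> kept l L" "l \<le> L"
  shows "fst t \<le> L \<and> snd t < b ^ fst t \<and> degree (piece l t) < k"
  using assms deg by (auto simp: kept_def piece_def intro!: degree_diff_less)

lemma coarse_eq_sum_kept:
  assumes x: "x \<in> {0..<1}"
  shows "coarse l L x = (\<Sum>t\<in>kept l L. if cell b (fst t) x = snd t then poly (piece l t) x else 0)"
proof -
  let ?F = "\<lambda>t. if cell b (fst t) x = snd t then poly (piece l t) x else 0"
  let ?A = "\<lambda>j. {a. a < b ^ Suc j \<and> a div b \<in> large l j}"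
  have inj: "inj_on (\<lambda>(j, a). (Suc j, a)) (SIGMA j:{l..<L}. ?A j)" by (auto simp: inj_on_def)
  have "(\<Sum>t\<in>kept l L. ?F t) = (\<Sum>t\<in>{l} \<times> {..<b ^ l}. ?F t) + (\<Sum>t\<in>(\<lambda>(j, a). (Suc j, a)) ` (SIGMA j:{l..<L}. ?A j). ?F t)"
    unfolding kept_def by (intro sum.union_disjoint finite_imageI finite_SigmaI) auto
  also have "(\<Sum>t\<in>{l} \<times> {..<b ^ l}. ?F t) = (\<Sum>a<b ^ l. ?F (l, a))"
    by (rule sum.reindex_bij_witness[of _ "\<lambda>a. (l, a)" snd]) auto
  also have "\<dots> = (\<Sum>a<b ^ l. if a = cell b l x then poly (P l a) x else 0)"
    by (intro sum.cong) (auto simp: piece_def)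
  also have "\<dots> = S l x" using cell_less[OF b0 x, of l] by (simp add: S_def)
  also have "(\<Sum>t\<in>(\<lambda>(j, a). (Suc j, a)) ` (SIGMA j:{l..<L}. ?A j). ?F t)
     = (\<Sum>(j, a)\<in>(SIGMA j:{l..<L}. ?A j). ?F (Suc j, a))"
    by (subst sum.reindex[OF inj]) (simp add: o_def case_prod_unfold)
  also have "\<dots> = (\<Sum>j=l..<L. \<Sum>a\<in>?A j. ?F (Suc j, a))"
    by (rule sum.Sigma[symmetric]) auto
  also have "\<dots> = (\<Sum>j=l..<L. if cell b j x \<in> large l j then D j x else 0)"
  proof (intro sum.cong refl)
    fix j assume j: "j \<in> {l..<L}"
    have c: "cell b (Suc j) x < b ^ Suc j" "cell b (Suc j) x div b = cell b j x"
      using cell_less[OF b0 x, of "Suc j"] cell_Suc_div[OF b0, of x j] x by auto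
    have "(\<Sum>a\<in>?A j. ?F (Suc j, a)) =
        (\<Sum>a\<in>?A j. if a = cell b (Suc j) x then poly (P (Suc j) a) x - poly (P j (a div b)) x else 0)"
      using j by (intro sum.cong) (auto simp: piece_def)
    also have "\<dots> = (if cell b j x \<in> large l j then D j x else 0)"
      using c by (simp add: D_def S_def)
    finally show "(\<Sum>a\<in>?A j. ?F (Suc j, a)) = (if cell b j x \<in> large l j then D j x else 0)" .
  qed
  finally show ?thesis by (simp add: coarse_def)
qed

lemma coarse_bound:
  assumes r: "0 \<le> r" and x: "x \<in> {0..<1}" and l: "l \<le> L"
  shows "\<bar>coarse l L x\<bar> \<le> K * real b powr (real L * (1 / \<tau> + 1))"
proof -
  have d: "\<bar>D j x\<bar> \<le> K * real b powr (real L / \<tau>)" if "j < L" for j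
  proof -
    have "\<bar>D j x\<bar> \<le> \<delta> j (cell b j x)" by (rule D_le[OF x])
    also have "\<dots> \<le> K * real b powr (real j * (1 / \<tau> - r))" by (rule \<delta>_le[OF cell_less[OF b0 x]])
    also have "\<dots> \<le> K * real b powr (real L / \<tau>)"
    proof -
      have "real j * (1 / \<tau> - r) \<le> real j * (1 / \<tau>)" using r by (intro mult_left_mono) auto
      also have "\<dots> \<le> real L * (1 / \<tau>)" using that \<tau> by (intro mult_right_mono) auto
      finally show ?thesis using K b by (intro mult_left_mono powr_mono) auto
    qed
    finally show ?thesis .
  qed
  have "coarse l L x = S 0 x + (\<Sum>j=0..<l. D j x) + (\<Sum>j=l..<L. if cell b j x \<in> large l j then D j x else 0)"
    using S_telescope[of 0 l x] by (simp add: coarse_def)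
  then have "\<bar>coarse l L x\<bar> = \<bar>S 0 x + (\<Sum>j=0..<l. D j x) + (\<Sum>j=l..<L. if cell b j x \<in> large l j then D j x else 0)\<bar>"
    by (rule arg_cong)
  also have "\<dots> \<le> \<bar>S 0 x\<bar> + (\<Sum>j=0..<l. \<bar>D j x\<bar>) + (\<Sum>j=l..<L. \<bar>if cell b j x \<in> large l j then D j x else 0\<bar>)"
    by (intro order_trans[OF abs_triangle_ineq] add_mono order_refl sum_abs)
  also have "\<dots> \<le> \<bar>S 0 x\<bar> + (\<Sum>j=0..<l. \<bar>D j x\<bar>) + (\<Sum>j=l..<L. \<bar>D j x\<bar>)"
    by (rule add_left_mono, rule sum_mono) simp
  also have "\<dots> = \<bar>S 0 x\<bar> + (\<Sum>j=0..<L. \<bar>D j x\<bar>)"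
    using l by (simp add: sum.atLeastLessThan_concat)
  also have "\<dots> \<le> K * real b powr (real L / \<tau>) + (\<Sum>j=0..<L. K * real b powr (real L / \<tau>))"
  proof (intro add_mono sum_mono)
    have "\<bar>S 0 x\<bar> \<le> K" using start[OF x] x by (simp add: S_def cell_0)
    also have "\<dots> \<le> K * real b powr (real L / \<tau>)"
      using K b \<tau> by (simp add: mult_le_cancel_left1 ge_one_powr_ge_zero)
    finally show "\<bar>S 0 x\<bar> \<le> K * real b powr (real L / \<tau>)" .
  qed (use d in auto)
  also have "\<dots> = (real L + 1) * (K * real b powr (real L / \<tau>))" by (simp add: algebra_simps)
  also have "\<dots> \<le> real b ^ L * (K * real b powr (real L / \<tau>))"
  proof (intro mult_right_mono)
    have "Suc L \<le> b ^ L" using less_base_power[OF b, of L] by simp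
    then show "real L + 1 \<le> real b ^ L" by (metis of_nat_Suc of_nat_le_iff of_nat_power add.commute)
  qed (use K in auto)
  also have "\<dots> = K * real b powr (real L * (1 / \<tau> + 1))"
    using b by (simp add: powr_realpow[symmetric] powr_add[symmetric] algebra_simps)
  finally show ?thesis .
qed

definition rounded :: "nat \<Rightarrow> nat \<Rightarrow> nat \<Rightarrow> real \<Rightarrow> real" where
  "rounded l L d x = (\<Sum>t\<in>kept l L. if cell b (fst t) x = snd t
     then poly (piece l t) (real (cell b d x) / real b ^ d) else 0)"

lemma measurable_rounded [measurable]: "rounded l L d \<in> borel_measurable borel"
proof -
  have poly: "(\<lambda>x. poly q (real (cell b d x) / real b ^ d)) \<in> borel_measurable borel" for q
    by (rule measurable_compose[OF measurable_cell, where g = "\<lambda>n. poly q (real n / real b ^ d)"]) simp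
  have cell: "{x \<in> space borel. cell b j x = a} \<in> sets borel" for j a
    by measurable
  show ?thesis
    unfolding rounded_def[abs_def]
    by (intro borel_measurable_sum measurable_If poly measurable_const cell) simp
qed

lemma rounded_eq_coarse:
  assumes x: "x \<in> {0..<1}" and L: "l \<le> L" "L \<le> d"
  shows "rounded l L d x = coarse l L (real (cell b d x) / real b ^ d)"
proof -
  have xd: "real (cell b d x) / real b ^ d \<in> {0..<1}"
    using cell_less[OF b0 x, of d] b0 by (simp flip: of_nat_power)
  have "cell b (fst t) (real (cell b d x) / real b ^ d) = cell b (fst t) x" if "t \<in> kept l L" for t
    using kept_valid[OF that L(1)] L(2) by (intro cell_rounded[OF b0 x]) auto
  then show ?thesis
    unfolding rounded_def coarse_eq_sum_kept[OF xd] by (intro sum.cong refl) (simp only:)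
qed

text \<open>On a cell of level \<open>L\<close> the function \<open>coarse l L\<close> is a polynomial, so by Markov's inequality it
  hardly changes when its argument is rounded to \<open>d\<close> digits; the exponent of its a priori bound is
  paid for by a depth proportional to \<open>L\<close>.\<close>

lemma rounding_error:
  assumes r: "0 \<le> r" and x: "x \<in> {0..<1}" and L: "l \<le> L" "L \<le> d"
    and Cm: "0 \<le> Cm" "\<And>(R :: real poly) B x y. degree R < k \<Longrightarrow> (\<forall>x\<in>{0..<1}. \<bar>poly R x\<bar> \<le> B) \<Longrightarrow>
       x \<in> {0..1} \<Longrightarrow> y \<in> {0..1} \<Longrightarrow> \<bar>poly R x - poly R y\<bar> \<le> Cm * B * \<bar>x - y\<bar>"
    and d: "real L * (1 / \<tau> + 2) + real l * r \<le> real d"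
  shows "\<bar>coarse l L x - rounded l L d x\<bar> \<le> Cm * K * real b powr (- real l * r)"
proof -
  define a where "a = cell b L x"
  define xd where "xd = real (cell b d x) / real b ^ d"
  define R where "R = pcompose (P l (a div b ^ (L - l)) + (\<Sum>j=l..<L. if a div b ^ (L - j) \<in> large l j
      then P (Suc j) (a div b ^ (L - Suc j)) - P j (a div b ^ (L - j)) else 0)) [:real a / real b ^ L, 1 / real b ^ L:]"
  define B where "B = K * real b powr (real L * (1 / \<tau> + 1))"
  have bL: "0 < real b ^ L" using b0 by simp
  have ab: "a < b ^ L" unfolding a_def by (rule cell_less[OF b0 x])
  have cellj: "cell b j y = a div b ^ (L - j)" if "cell b L y = a" "0 \<le> y" "j \<le> L" for j y
    using cell_div[OF b0 that(2,3)] that(1) by simp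
  have R: "poly R t = coarse l L ((real a + t) / real b ^ L)" if t: "t \<in> {0..<1}" for t
  proof -
    let ?y = "(real a + t) / real b ^ L"
    have y0: "0 \<le> ?y" using t by simp
    have c: "cell b L ?y = a" using t bL b0 y0 by (subst cell_eq_iff) auto
    have py: "poly (pcompose q [:real a / real b ^ L, 1 / real b ^ L:]) t = poly q ?y" for q
      by (simp add: poly_pcompose add_divide_distrib)
    show ?thesis
      unfolding R_def py coarse_def S_def D_def
      using cellj[OF c y0] L(1) by (auto simp: poly_sum intro!: sum.cong)
  qed
  have degR: "degree R < k"
    unfolding R_def
    by (intro degree_pcompose_linear_less degree_add_less degree_sum_less)
      (use deg k in \<open>auto intro: degree_diff_less\<close>)
  have bnd: "\<forall>t\<in>{0..<1}. \<bar>poly R t\<bar> \<le> B"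
  proof
    fix t :: real assume t: "t \<in> {0..<1}"
    have "real a + 1 \<le> real b ^ L" using ab by (metis Suc_leI of_nat_Suc of_nat_le_iff of_nat_power add.commute)
    then have "(real a + t) / real b ^ L \<in> {0..<1}" using t bL by (simp add: divide_less_eq)
    then show "\<bar>poly R t\<bar> \<le> B" unfolding R[OF t] B_def by (intro coarse_bound r L(1))
  qed
  define t where "t = real b ^ L * x - real a"
  define t' where "t' = real b ^ L * xd - real a"
  have xd: "xd \<in> {0..<1}"
    unfolding xd_def using cell_less[OF b0 x, of d] b0 by (simp flip: of_nat_power)
  have t: "t \<in> {0..<1}" using cell_bounds[OF b0, of x L] x by (auto simp: t_def a_def)
  have "cell b L xd = a" unfolding xd_def a_def by (rule cell_rounded[OF b0 x L(2)])
  then have t': "t' \<in> {0..<1}" using cell_bounds[OF b0, of xd L] xd by (auto simp: t'_def)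
  have "coarse l L x = poly R t" "coarse l L xd = poly R t'"
    using R[OF t] R[OF t'] bL by (auto simp: t_def t'_def)
  then have "\<bar>coarse l L x - rounded l L d x\<bar> = \<bar>poly R t - poly R t'\<bar>"
    using rounded_eq_coarse[OF x L] by (simp add: xd_def)
  also have "\<dots> \<le> Cm * B * \<bar>t - t'\<bar>" using t t' by (intro Cm(2)[OF degR bnd]) auto
  also have "\<bar>t - t'\<bar> = real b ^ L * \<bar>x - xd\<bar>"
    using bL by (simp add: t_def t'_def abs_mult flip: right_diff_distrib)
  also have "Cm * B * (real b ^ L * \<bar>x - xd\<bar>) \<le> Cm * B * (real b ^ L * (1 / real b ^ d))"
  proof (intro mult_left_mono)
    have bd: "0 < real b ^ d" using b0 by simp
    have e: "real b ^ d * (x - xd) = real b ^ d * x - real (cell b d x)"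
      using bd by (simp add: xd_def right_diff_distrib)
    have "real b ^ d * \<bar>x - xd\<bar> = \<bar>real b ^ d * (x - xd)\<bar>" using bd by (simp add: abs_mult)
    also have "\<dots> \<le> 1" unfolding e using cell_bounds[OF b0, of x d] x by auto
    finally show "\<bar>x - xd\<bar> \<le> 1 / real b ^ d" using bd by (simp add: field_simps)
  qed (use bL Cm(1) K in \<open>auto simp: B_def\<close>)
  also have "\<dots> = Cm * K * real b powr (real L * (1 / \<tau> + 1) + real L - real d)"
  proof -
    have bn: "real b ^ n = real b powr real n" for n using b0 by (simp add: powr_realpow)
    show ?thesis unfolding B_def bn powr_add powr_diff by simp
  qed
  also have "\<dots> \<le> Cm * K * real b powr (- real l * r)"
  proof (intro mult_left_mono powr_mono)
    show "real L * (1 / \<tau> + 1) + real L - real d \<le> - real l * r"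
      using d unfolding distrib_left by linarith
  qed (use Cm(1) K b in auto)
  finally show ?thesis .
qed

end

section \<open>Powers of extended nonnegative numbers\<close>

lemma epowr_ennreal: "0 \<le> x \<Longrightarrow> epowr (ennreal x) a = ennreal (x powr a)"
  by (simp add: epowr_def)

lemma epowr_mono:
  assumes "x \<le> y" "0 < a"
  shows "epowr x a \<le> epowr y a"
proof (cases y)
  case (real v)
  then obtain u where "x = ennreal u" "0 \<le> u" "u \<le> v"
    using assms by (cases x) (auto simp: top_unique)
  then show ?thesis using real assms by (auto simp: epowr_ennreal intro!: ennreal_leI powr_mono2)
qed (simp add: epowr_def)

lemma epowr_epowr:
  assumes "0 < a" "0 < c"
  shows "epowr (epowr x a) c = epowr x (a * c)"
  using assms by (cases x) (auto simp: epowr_ennreal powr_powr epowr_def)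

lemma epowr_one: "epowr x 1 = x"
  by (cases x) (auto simp: epowr_def)

lemma epowr_inverse: "0 < a \<Longrightarrow> epowr (epowr x a) (1 / a) = x" "0 < a \<Longrightarrow> epowr (epowr x (1 / a)) a = x"
  by (simp_all add: epowr_epowr epowr_one)

lemma epowr_mult:
  assumes "0 < c" "0 < a"
  shows "epowr (ennreal c * x) a = ennreal (c powr a) * epowr x a"
proof (cases x)
  case (real u)
  then show ?thesis using assms
    by (simp add: ennreal_mult[symmetric] epowr_ennreal powr_mult)
next
  case top
  then show ?thesis using assms by (simp add: epowr_def ennreal_mult_top)
qed

lemma epowr_le_ennrealD:
  assumes "epowr x (1 / a) \<le> ennreal y" "0 < a" "0 \<le> y"
  shows "x \<le> ennreal (y powr a)"
  using epowr_mono[OF assms(1,2)] assms by (simp add: epowr_inverse epowr_ennreal)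

lemma epowr_le_ennrealI:
  assumes "x \<le> ennreal (y powr a)" "0 < a" "0 \<le> y"
  shows "epowr x (1 / a) \<le> ennreal y"
  using epowr_mono[OF assms(1), of "1 / a"] assms by (simp add: epowr_ennreal powr_powr)

section \<open>Besov norms at discrete scales\<close>

lemma nn_integral_ge_disjoint_sum:
  fixes F :: "real \<Rightarrow> ennreal" and c :: "nat \<Rightarrow> ennreal"
  assumes I: "\<And>j. I j \<in> sets lebesgue" "\<And>j. I j \<subseteq> A" "disjoint_family I"
    and F: "\<And>j t. t \<in> I j \<Longrightarrow> c j \<le> F t"
  shows "(\<Sum>j. c j * emeasure lebesgue (I j)) \<le> (\<integral>\<^sup>+t\<in>A. F t \<partial>lebesgue)"
proof -
  have "(\<Sum>j. c j * emeasure lebesgue (I j)) = (\<integral>\<^sup>+t. (\<Sum>j. c j * indicator (I j) t) \<partial>lebesgue)"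
    using I(1) by (subst nn_integral_suminf) (auto simp: nn_integral_cmult_indicator)
  also have "\<dots> \<le> (\<integral>\<^sup>+t\<in>A. F t \<partial>lebesgue)"
  proof (rule nn_integral_mono)
    fix t
    show "(\<Sum>j. c j * indicator (I j) t) \<le> F t * indicator A t"
    proof (cases "\<exists>i. t \<in> I i")
      case True
      then obtain i where i: "t \<in> I i" by blast
      then have "t \<notin> I j" if "j \<noteq> i" for j using I(3) that unfolding disjoint_family_on_def by blast
      then have "(\<Sum>j. c j * indicator (I j) t) = (\<Sum>j\<in>{i}. c j * indicator (I j) t)"
        by (intro suminf_finite) auto
      then show ?thesis using F[OF i] I(2)[of i] i by auto
    next
      case False
      then show ?thesis by simp
    qed
  qed
  finally show ?thesis .
qed

lemma funpow_difference_cong: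
  assumes "\<And>l. l \<le> k \<Longrightarrow> f (x + real l * h) = g (x + real l * h)"
  shows "(difference h ^^ k) f x = (difference h ^^ k) g x"
  using assms
proof (induction k arbitrary: x)
  case 0
  then show ?case using 0[of 0] by simp
next
  case (Suc k)
  have "(difference h ^^ k) f x = (difference h ^^ k) g x"
    using Suc.prems by (intro Suc.IH) simp
  moreover have "(difference h ^^ k) f (x + h) = (difference h ^^ k) g (x + h)"
  proof (rule Suc.IH)
    show "f (x + h + real l * h) = g (x + h + real l * h)" if "l \<le> k" for l
      using Suc.prems[of "Suc l"] that by (simp add: algebra_simps)
  qed
  ultimately show ?case by (simp only: funpow_difference_Suc)
qed

lemma AE_lborel_translate:
  fixes Q :: "real \<Rightarrow> bool"
  assumes "AE x in lborel. Q x"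
  shows "AE x in lborel. Q (x + c)"
proof -
  obtain N where N: "{x. \<not> Q x} \<subseteq> N" "N \<in> null_sets lborel"
    using assms by (auto elim!: AE_E simp: null_sets_def)
  have [measurable]: "N \<in> sets borel" using N(2) by (auto simp: null_sets_def)
  have "AE x in lborel. x \<notin> N" using N(2) by (rule AE_not_in)
  then have "AE x in lborel. c + 1 * x \<notin> N" by (intro AE_borel_affine) auto
  then show ?thesis by eventually_elim (use N(1) in \<open>auto simp: add.commute\<close>)
qed

lemma borel_representative:
  assumes "f \<in> borel_measurable (lebesgue_on {0..<1::real})"
  obtains f' :: "real \<Rightarrow> real" where "f' \<in> borel_measurable borel"
    "AE x in lborel. x \<in> {0..<1} \<longrightarrow> f x = f' x"
proof -
  have "(\<lambda>x. if x \<in> {0..<1} then f x else 0) \<in> borel_measurable lebesgue"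
    using assms by (subst borel_measurable_if) auto
  from completion_ex_borel_measurable_real[OF this] obtain f' where f': "f' \<in> borel_measurable lborel"
    "AE x in lborel. (if x \<in> {0..<1} then f x else 0) = f' x" by blast
  show ?thesis
  proof
    show "f' \<in> borel_measurable borel" using f'(1) by simp
    show "AE x in lborel. x \<in> {0..<1} \<longrightarrow> f x = f' x" using f'(2) by eventually_elim auto
  qed
qed

lemma Lp_norm_lborel: "Lp_norm p A f = epowr (\<integral>\<^sup>+x\<in>A. ennreal (\<bar>f x\<bar> powr p) \<partial>lborel) (1 / p)"
  by (simp add: Lp_norm_def nn_integral_completion)

lemma Lp_norm_cong_AE:
  assumes "AE x in lborel. x \<in> A \<longrightarrow> f x = g x"
  shows "Lp_norm p A f = Lp_norm p A g"
  unfolding Lp_norm_lborel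
  by (rule arg_cong[where f = "\<lambda>x. epowr x (1 / p)"], rule nn_integral_cong_AE)
    (use assms in \<open>eventually_elim, auto simp: indicator_def\<close>)

text \<open>On \<open>(h, b h)\<close> with \<open>h = b\<^sup>-\<^sup>j\<^sup>-\<^sup>k\<^sup>-\<^sup>1\<close> the modulus of smoothness is at least its value at \<open>h\<close>, so the
  integral defining the seminorm dominates a sum over the scales of the grids.\<close>

lemma besov_sum_le:
  assumes b: "2 \<le> b" and \<tau>: "0 < \<tau>" and r: "0 < r" and k: "k = nat \<lfloor>r\<rfloor> + 1"
    and f: "AE x in lborel. x \<in> {0..<1} \<longrightarrow> f x = f' x"
    and \<beta>: "besov_norm r \<tau> (ennreal \<tau>) f = ennreal \<beta>" "0 \<le> \<beta>"
  shows "besov_sum b k \<tau> r f' \<le> ennreal ((3 powr (1 / \<tau>) * \<beta>) powr \<tau>)"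
proof -
  define h where "h = (\<lambda>j. 1 / real (b ^ Suc (j + k)))"
  define W where "W = (\<lambda>j. \<integral>\<^sup>+z\<in>{0..<1 - real k * h j}. ennreal (\<bar>(difference (h j) ^^ k) f' z\<bar> powr \<tau>) \<partial>lborel)"
  define I where "I = (\<lambda>j. {h j<..<real b * h j})"
  define X where "X = (\<integral>\<^sup>+t\<in>{0<..1}. epowr (ennreal (t powr - r) * modulus_of_smoothness k \<tau> f t) \<tau> * ennreal (1 / t) \<partial>lebesgue)"
  have h0: "0 < h j" for j using b by (simp add: h_def)
  have bh: "real b * h j = 1 / real b ^ (j + k)" for j using b by (simp add: h_def)
  have W_le: "epowr (W j) (1 / \<tau>) \<le> modulus_of_smoothness k \<tau> f t" if t: "h j \<le> t" for j t
  proof -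
    have "AE x in lborel. \<forall>l\<in>{..k}. x + real l * h j \<in> {0..<1} \<longrightarrow> f (x + real l * h j) = f' (x + real l * h j)"
      using AE_lborel_translate[OF f] by (intro AE_finite_allI) auto
    then have "AE x in lborel. x \<in> {0..<1 - real k * h j} \<longrightarrow> (difference (h j) ^^ k) f x = (difference (h j) ^^ k) f' x"
    proof eventually_elim
      case (elim x)
      show ?case
      proof (intro impI funpow_difference_cong)
        fix l assume x: "x \<in> {0..<1 - real k * h j}" and l: "l \<le> k"
        have "real l * h j \<le> real k * h j" "0 \<le> real l * h j"
          using l h0[of j] by (auto intro!: mult_right_mono)
        then have "x + real l * h j \<in> {0..<1}" using x by auto
        then show "f (x + real l * h j) = f' (x + real l * h j)" using elim l by auto
      qed
    qed
    then have "epowr (W j) (1 / \<tau>) = Lp_norm \<tau> {0..<1 - real k * h j} ((difference (h j) ^^ k) f)"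
      unfolding W_def Lp_norm_lborel[symmetric] by (rule Lp_norm_cong_AE[symmetric])
    also have "\<dots> \<le> modulus_of_smoothness k \<tau> f t"
      unfolding modulus_of_smoothness_def using t h0[of j] by (intro SUP_upper) auto
    finally show ?thesis .
  qed
  have low: "(\<Sum>j. (ennreal ((real b * h j) powr (- r * \<tau>)) * W j * ennreal (1 / (real b * h j))) * emeasure lebesgue (I j)) \<le> X"
    unfolding X_def
  proof (rule nn_integral_ge_disjoint_sum)
    show "I j \<subseteq> {0<..1}" for j
    proof -
      have "real b * h j \<le> 1" unfolding bh using b by (simp add: one_le_power)
      then show ?thesis using h0[of j] by (auto simp: I_def)
    qed
    show "disjoint_family I"
    proof -
      have le: "real b * h j \<le> h i" if "i < j" for i j
      proof -
        have "real b ^ Suc (i + k) \<le> real b ^ (j + k)" using that b by (intro power_increasing) auto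
        then show ?thesis unfolding bh unfolding h_def of_nat_power using b by (intro divide_left_mono) auto
      qed
      have "I i \<inter> I j = {}" if "i < j" for i j using le[OF that] by (auto simp: I_def)
      then show ?thesis unfolding disjoint_family_on_def by (metis Int_commute linorder_neqE_nat)
    qed
    fix j t assume "t \<in> I j"
    then have t: "h j < t" "t < real b * h j" by (auto simp: I_def)
    then have t0: "0 < t" using h0[of j] by linarith
    have "ennreal ((real b * h j) powr (- r * \<tau>)) * W j = epowr (ennreal ((real b * h j) powr - r) * epowr (W j) (1 / \<tau>)) \<tau>"
      using h0[of j] b \<tau> by (subst epowr_mult) (auto simp: powr_powr epowr_inverse)
    also have "\<dots> \<le> epowr (ennreal (t powr - r) * modulus_of_smoothness k \<tau> f t) \<tau>"
      using t t0 r \<tau> W_le[of j t] by (intro epowr_mono mult_mono ennreal_leI powr_mono2') auto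
    finally show "ennreal ((real b * h j) powr (- r * \<tau>)) * W j * ennreal (1 / (real b * h j))
        \<le> epowr (ennreal (t powr - r) * modulus_of_smoothness k \<tau> f t) \<tau> * ennreal (1 / t)"
      using t t0 by (intro mult_mono ennreal_leI divide_left_mono) auto
  qed (simp add: I_def)
  have compare: "ennreal (1 / 2) * (ennreal (real b powr (real j * (r * \<tau>))) * W j)
      \<le> (ennreal ((real b * h j) powr (- r * \<tau>)) * W j * ennreal (1 / (real b * h j))) * emeasure lebesgue (I j)" for j
  proof -
    \<comment> \<open>The measure of \<open>(h, b h)\<close> is \<open>(1 - 1/b) b h\<close>, and \<open>1/t\<close> is at least \<open>1/(b h)\<close> there.\<close>
    have half: "1 / 2 \<le> (1 / (real b * h j)) * (real b * h j - h j)"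
      using h0[of j] b by (simp add: field_simps)
    have em: "emeasure lebesgue (I j) = ennreal (real b * h j - h j)"
      using h0[of j] b by (simp add: I_def)
    have "real b powr (real j * (r * \<tau>)) \<le> real b powr (real (j + k) * (r * \<tau>))"
      using b r \<tau> by (intro powr_mono mult_right_mono) auto
    also have "\<dots> = (real b * h j) powr (- r * \<tau>)"
      unfolding bh using b by (simp add: powr_divide powr_realpow[symmetric] powr_powr powr_minus_divide)
    finally have pw: "real b powr (real j * (r * \<tau>)) \<le> (real b * h j) powr (- r * \<tau>)" .
    have "ennreal (1 / 2) \<le> ennreal ((1 / (real b * h j)) * (real b * h j - h j))"
      by (rule ennreal_leI[OF half])
    also have "\<dots> = ennreal (1 / (real b * h j)) * ennreal (real b * h j - h j)"
      using h0[of j] b by (intro ennreal_mult) auto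
    finally have "ennreal (1 / 2) * (ennreal (real b powr (real j * (r * \<tau>))) * W j)
        \<le> (ennreal (1 / (real b * h j)) * ennreal (real b * h j - h j)) * (ennreal ((real b * h j) powr (- r * \<tau>)) * W j)"
      by (intro mult_mono[OF _ mult_right_mono[OF ennreal_leI[OF pw]]]) auto
    then show ?thesis by (simp add: em mult_ac)
  qed
  have "(\<Sum>j. ennreal (1 / 2) * (ennreal (real b powr (real j * (r * \<tau>))) * W j)) \<le> X"
    by (rule order_trans[OF suminf_le[OF compare summableI summableI] low])
  then have half: "ennreal (1 / 2) * (\<Sum>j. ennreal (real b powr (real j * (r * \<tau>))) * W j) \<le> X"
    by (simp only: ennreal_suminf_cmult)
  have sn: "besov_seminorm r \<tau> (ennreal \<tau>) f = epowr X (1 / \<tau>)"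
    using \<tau> by (simp add: besov_seminorm_def Lq_star_norm_def X_def k)
  have "besov_seminorm r \<tau> (ennreal \<tau>) f \<le> ennreal \<beta>"
    unfolding \<beta>(1)[symmetric] besov_norm_def by simp
  then have X: "X \<le> ennreal (\<beta> powr \<tau>)"
    unfolding sn by (rule epowr_le_ennrealD[OF _ \<tau> \<beta>(2)])
  have "Lp_norm \<tau> {0..<1} f' \<le> ennreal \<beta>"
    unfolding Lp_norm_cong_AE[OF f, symmetric] \<beta>(1)[symmetric] besov_norm_def by simp
  then have f\<tau>: "(\<integral>\<^sup>+z\<in>{0..<1}. ennreal (\<bar>f' z\<bar> powr \<tau>) \<partial>lborel) \<le> ennreal (\<beta> powr \<tau>)"
    unfolding Lp_norm_lborel by (rule epowr_le_ennrealD[OF _ \<tau> \<beta>(2)])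
  have "(\<Sum>j. ennreal (real b powr (real j * (r * \<tau>))) * W j)
      = ennreal 2 * (ennreal (1 / 2) * (\<Sum>j. ennreal (real b powr (real j * (r * \<tau>))) * W j))"
    by (simp only: mult.assoc[symmetric] ennreal_mult[symmetric]) simp
  also have "\<dots> \<le> ennreal 2 * ennreal (\<beta> powr \<tau>)"
    using half X by (intro mult_left_mono) auto
  finally have "besov_sum b k \<tau> r f' \<le> ennreal 2 * ennreal (\<beta> powr \<tau>) + ennreal (\<beta> powr \<tau>)"
    unfolding besov_sum_def W_def h_def by (intro add_mono f\<tau>)
  also have "\<dots> = ennreal (3 * \<beta> powr \<tau>)"
  proof -
    have "ennreal 2 * ennreal (\<beta> powr \<tau>) = ennreal (2 * \<beta> powr \<tau>)"
      by (rule ennreal_mult[symmetric]) auto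
    moreover have "ennreal (2 * \<beta> powr \<tau>) + ennreal (\<beta> powr \<tau>) = ennreal (2 * \<beta> powr \<tau> + \<beta> powr \<tau>)"
      by (rule ennreal_plus[symmetric]) auto
    ultimately show ?thesis by simp
  qed
  also have "3 * \<beta> powr \<tau> = (3 powr (1 / \<tau>) * \<beta>) powr \<tau>"
    using \<tau> by (simp add: powr_mult powr_powr)
  finally show ?thesis .
qed

section \<open>The direct inequality\<close>

definition cutoff_level :: "real \<Rightarrow> real \<Rightarrow> real \<Rightarrow> nat \<Rightarrow> nat" where
  "cutoff_level \<tau> r p l = l + nat \<lceil>real l * (r / (r - 1 / \<tau> + 1 / p))\<rceil>"

definition digit_depth :: "real \<Rightarrow> real \<Rightarrow> nat \<Rightarrow> nat \<Rightarrow> nat" where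
  "digit_depth \<tau> r l L = Suc (nat \<lceil>real L * (1 / \<tau> + 2)\<rceil> + nat \<lceil>real l * r\<rceil>)"

context multiscale
begin

lemma Lp_bound:
  assumes p: "1 \<le> p" "\<tau> < p" and gap: "0 < r - 1 / \<tau> + 1 / p" and q: "q = real b powr (- (r - 1 / \<tau> + 1 / p))"
  shows "p_integral p f \<le> ennreal (((2 / (1 - q) + 1) * K) powr p)"
proof -
  have q01: "0 \<le> q" "q < 1" using b gap by (auto simp: q powr_less_one)
  have 1: "p_integral p (\<lambda>x. f x - coarse 0 0 x) \<le> ennreal ((2 / (1 - q) * K) powr p)"
    using coarse_error[OF p refl gap _ _ q, of 0 0] b by simp
  have "p_integral p (coarse 0 0) \<le> (\<integral>\<^sup>+x. ennreal (K powr p) \<partial>unit_lborel)"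
    using p start by (intro nn_integral_mono ennreal_leI powr_mono2)
      (auto simp: coarse_def S_def cell_0 space_unit_lborel)
  also have "\<dots> = ennreal (K powr p)"
    unfolding nn_integral_unit_lborel by (simp add: nn_integral_cmult_indicator)
  finally have 2: "p_integral p (coarse 0 0) \<le> ennreal (K powr p)" .
  have "p_integral p (\<lambda>x. (f x - coarse 0 0 x) + coarse 0 0 x)
      \<le> ennreal ((2 / (1 - q) * K + K) powr p)"
    using p K q01 by (intro minkowski 1 2) auto
  then show ?thesis by (simp add: distrib_right)
qed

text \<open>The cutoff level makes the error of stopping at \<open>L\<close> comparable to \<open>b\<^sup>-\<^sup>l\<^sup>r\<close>, and the depth does the
  same for the rounding error.\<close>

lemma network_approximation:
  assumes p: "1 \<le> p" "\<tau> < p" and gap: "0 < r - 1 / \<tau> + 1 / p" and q: "q = real b powr (- (r - 1 / \<tau> + 1 / p))"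
    and r: "0 < r" and basis: "is_poly_basis m \<phi>"
    and Cm: "0 \<le> Cm" "\<And>(R :: real poly) B x y. degree R < k \<Longrightarrow> (\<forall>x\<in>{0..<1}. \<bar>poly R x\<bar> \<le> B) \<Longrightarrow>
       x \<in> {0..1} \<Longrightarrow> y \<in> {0..1} \<Longrightarrow> \<bar>poly R x - poly R y\<bar> \<le> Cm * B * \<bar>x - y\<bar>"
    and L: "L = cutoff_level \<tau> r p l" and d: "d = digit_depth \<tau> r l L"
    and n: "d * (b ^ l * (1 + b * L)) * (b * k + b * k * k + k * (m + 1)) \<le> n"
  shows "rounded l L d \<in> \<Phi>_set b m \<phi> compl_N n" "rounded l L d \<in> \<Phi>_set b m \<phi> (compl_S b m) n"
    "p_integral p (\<lambda>x. f x - rounded l L d x)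
      \<le> ennreal (((2 / (1 - q) + Cm) * K * real b powr (- real l * r)) powr p)"
proof -
  have q01: "0 \<le> q" "q < 1" using b gap by (auto simp: q powr_less_one)
  have lL: "l \<le> L" by (simp add: L cutoff_level_def)
  have d1: "real L * (1 / \<tau> + 2) + real l * r \<le> real d"
    unfolding d digit_depth_def of_nat_Suc of_nat_add by linarith
  have Ld: "L \<le> d"
  proof -
    have "real L * 1 \<le> real L * (1 / \<tau> + 2)" using \<tau> by (intro mult_left_mono) (auto simp: add_nonneg_nonneg)
    also have "\<dots> \<le> real d" using d1 r by (smt (verit) mult_nonneg_nonneg of_nat_0_le_iff)
    finally show ?thesis by simp
  qed
  have Lal: "real l * r \<le> real L * (r - 1 / \<tau> + 1 / p)"
  proof -
    have "real l * (r / (r - 1 / \<tau> + 1 / p)) \<le> real L"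
      unfolding L cutoff_level_def of_nat_add by linarith
    then have "real l * (r / (r - 1 / \<tau> + 1 / p)) * (r - 1 / \<tau> + 1 / p) \<le> real L * (r - 1 / \<tau> + 1 / p)"
      using gap by (intro mult_right_mono) auto
    then show ?thesis using gap by simp
  qed
  have nn: "d * card (kept l L) * (b * k + b * k * k + k * (m + 1)) \<le> n"
    using n card_kept[OF lL] by (meson mult_le_mono le_refl order_trans)
  have "(l, 0) \<in> kept l L" using b0 by (simp add: kept_def)
  then have ne: "kept l L \<noteq> {}" by blast
  have "1 \<le> d" by (simp add: d digit_depth_def)
  have "fst t \<le> d \<and> snd t < b ^ fst t \<and> degree (piece l t) < k" if "t \<in> kept l L" for t
    using kept_valid[OF that lL] Ld by auto
  then show "rounded l L d \<in> \<Phi>_set b m \<phi> compl_N n" "rounded l L d \<in> \<Phi>_set b m \<phi> (compl_S b m) n"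
    using cells_function_in_\<Phi>_set[OF b0 k \<open>1 \<le> d\<close> basis finite_kept ne _ nn ext[OF rounded_def]] by auto
  have 1: "p_integral p (\<lambda>x. f x - coarse l L x)
     \<le> ennreal ((2 / (1 - q) * K * real b powr (- real l * r)) powr p)"
    by (rule coarse_error[OF p refl gap lL Lal q])
  have "p_integral p (\<lambda>x. coarse l L x - rounded l L d x)
      \<le> (\<integral>\<^sup>+x. ennreal ((Cm * K * real b powr (- real l * r)) powr p) \<partial>unit_lborel)"
  proof (intro nn_integral_mono ennreal_leI powr_mono2)
    fix x assume "x \<in> space unit_lborel"
    then have x: "x \<in> {0..<1}" by (simp add: space_unit_lborel)
    show "\<bar>coarse l L x - rounded l L d x\<bar> \<le> Cm * K * real b powr (- real l * r)"
      by (rule rounding_error[OF _ x lL Ld Cm d1]) (use r in auto)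
  qed (use p in auto)
  also have "\<dots> = ennreal ((Cm * K * real b powr (- real l * r)) powr p)"
    unfolding nn_integral_unit_lborel by (simp add: nn_integral_cmult_indicator)
  finally have 2: "p_integral p (\<lambda>x. coarse l L x - rounded l L d x)
      \<le> ennreal ((Cm * K * real b powr (- real l * r)) powr p)" .
  have "p_integral p (\<lambda>x. (f x - coarse l L x) + (coarse l L x - rounded l L d x))
      \<le> ennreal ((2 / (1 - q) * K * real b powr (- real l * r) + Cm * K * real b powr (- real l * r)) powr p)"
    using p K q01 Cm(1) by (intro minkowski 1 2) auto
  then show "p_integral p (\<lambda>x. f x - rounded l L d x)
      \<le> ennreal (((2 / (1 - q) + Cm) * K * real b powr (- real l * r)) powr p)"
    by (simp add: distrib_right)
qed

end

lemma nat_ceiling_mult_le: "0 \<le> x \<Longrightarrow> nat \<lceil>real l * x\<rceil> \<le> l * nat \<lceil>x\<rceil>"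
proof -
  assume x: "0 \<le> x"
  have "x \<le> real (nat \<lceil>x\<rceil>)" by (rule real_nat_ceiling_ge)
  then have "real l * x \<le> real l * real (nat \<lceil>x\<rceil>)" by (rule mult_left_mono) simp
  then have "real l * x \<le> real (l * nat \<lceil>x\<rceil>)" by simp
  then have "\<lceil>real l * x\<rceil> \<le> int (l * nat \<lceil>x\<rceil>)" by (simp only: ceiling_le_iff of_int_of_nat_eq)
  then show ?thesis by linarith
qed

text \<open>Levels and depth grow linearly in \<open>l\<close>, so the networks have \<open>O(l\<^sup>2 b\<^sup>l)\<close> parameters.\<close>

lemma network_size:
  assumes "0 < \<tau>" "0 < r" "0 < r - 1 / \<tau> + 1 / p"
  shows "\<exists>Cn::nat. 1 \<le> Cn \<and> (\<forall>l. digit_depth \<tau> r l (cutoff_level \<tau> r p l) * (b ^ l * (1 + b * cutoff_level \<tau> r p l)) * c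
     \<le> Cn * (l + 1)\<^sup>2 * b ^ l)"
proof -
  define A where "A = 1 + nat \<lceil>r / (r - 1 / \<tau> + 1 / p)\<rceil>"
  define D where "D = 1 + A * nat \<lceil>1 / \<tau> + 2\<rceil> + nat \<lceil>r\<rceil>"
  have "digit_depth \<tau> r l (cutoff_level \<tau> r p l) * (b ^ l * (1 + b * cutoff_level \<tau> r p l)) * c
     \<le> (D * (1 + b * A) * c + 1) * (l + 1)\<^sup>2 * b ^ l" for l
  proof -
    define L where "L = cutoff_level \<tau> r p l"
    define x y x' y' z z' where "x = nat \<lceil>real l * (r / (r - 1 / \<tau> + 1 / p))\<rceil>"
      and "y = nat \<lceil>r / (r - 1 / \<tau> + 1 / p)\<rceil>" and "x' = nat \<lceil>real L * (1 / \<tau> + 2)\<rceil>"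
      and "y' = nat \<lceil>1 / \<tau> + 2\<rceil>" and "z = nat \<lceil>real l * r\<rceil>" and "z' = nat \<lceil>r\<rceil>"
    note defs = this
    have x: "x \<le> l * y" "x' \<le> L * y'" "z \<le> l * z'"
      unfolding defs using assms by (intro nat_ceiling_mult_le; simp)+
    have "L = l + x" "A = 1 + y" by (simp_all only: L_def cutoff_level_def A_def defs)
    then have L: "L \<le> A * l" using x(1) by (simp add: algebra_simps)
    have "x' \<le> A * l * y'" using x(2) mult_right_mono[OF L, of y'] by linarith
    then have "digit_depth \<tau> r l L \<le> 1 + (A * y' + z') * l"
      using x(3) unfolding digit_depth_def defs[symmetric] by (simp add: algebra_simps)
    also have "\<dots> \<le> D * (l + 1)" unfolding D_def defs[symmetric] by (simp add: algebra_simps)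
    finally have d: "digit_depth \<tau> r l L \<le> D * (l + 1)" .
    have "b * L \<le> b * (A * l)" using L by (intro mult_left_mono) auto
    moreover have "(1 + b * A) * (l + 1) = l + 1 + b * (A * l) + b * A" by (simp add: algebra_simps)
    ultimately have "1 + b * L \<le> (1 + b * A) * (l + 1)" by linarith
    then have "digit_depth \<tau> r l L * (b ^ l * (1 + b * L)) * c \<le> (D * (l + 1)) * (b ^ l * ((1 + b * A) * (l + 1))) * c"
      using d by (intro mult_mono) auto
    also have "\<dots> = (D * (1 + b * A) * c) * (l + 1)\<^sup>2 * b ^ l" by (simp only: power2_eq_square mult_ac)
    also have "\<dots> \<le> (D * (1 + b * A) * c + 1) * (l + 1)\<^sup>2 * b ^ l" by (intro mult_right_mono) auto
    finally show ?thesis by (simp only: L_def)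
  qed
  then show ?thesis by (intro exI[of _ "D * (1 + b * A) * c + 1"]) auto
qed

text \<open>The loss from \<open>r\<close> to \<open>rbar\<close> absorbs the factor \<open>l\<^sup>2\<close>.\<close>

lemma size_growth:
  assumes b: "2 \<le> b" and r: "0 < rbar" "rbar < r"
  shows "\<exists>G>0. \<forall>l. real (C * (l + 2)\<^sup>2 * b ^ (l + 1)) powr rbar \<le> G * real b powr (real l * r)"
proof -
  define e where "e = (r - rbar) / (2 * rbar) * ln (real b)"
  have e: "0 < e" using b r by (simp add: e_def)
  define G where "G = real C powr rbar * (1 / e) powr (2 * rbar) * real b powr (2 * (r - rbar) + rbar)"
  have "real (C * (l + 2)\<^sup>2 * b ^ (l + 1)) powr rbar \<le> (G + 1) * real b powr (real l * r)" for l
  proof -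
    have "e * real (l + 2) \<le> exp (e * real (l + 2))" using exp_ge_add_one_self[of "e * real (l + 2)"] by linarith
    also have "\<dots> = real b powr ((r - rbar) / (2 * rbar) * real (l + 2))"
      using b by (simp add: powr_def e_def)
    finally have "real (l + 2) \<le> 1 / e * real b powr ((r - rbar) / (2 * rbar) * real (l + 2))"
      using e by (simp add: field_simps)
    then have "real (l + 2) powr (2 * rbar) \<le> (1 / e * real b powr ((r - rbar) / (2 * rbar) * real (l + 2))) powr (2 * rbar)"
      using r by (intro powr_mono2) auto
    also have "\<dots> = (1 / e) powr (2 * rbar) * real b powr ((r - rbar) * real (l + 2))"
    proof -
      have "(r - rbar) / (2 * rbar) * real (l + 2) * (2 * rbar) = (r - rbar) * real (l + 2)" using r by simp
      then show ?thesis by (simp only: powr_mult powr_powr)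
    qed
    finally have l2: "real (l + 2) powr (2 * rbar) \<le> (1 / e) powr (2 * rbar) * real b powr ((r - rbar) * real (l + 2))" .
    have sq: "((real (l + 2))\<^sup>2) powr rbar = real (l + 2) powr (2 * rbar)"
    proof -
      have "(real (l + 2))\<^sup>2 = real (l + 2) powr 2" by simp
      then show ?thesis by (simp only: powr_powr)
    qed
    have bp: "(real b ^ (l + 1)) powr rbar = real b powr (real (l + 1) * rbar)"
      using b by (subst powr_realpow[symmetric]) (auto simp: powr_powr)
    have "real (C * (l + 2)\<^sup>2 * b ^ (l + 1)) powr rbar = real C powr rbar * real (l + 2) powr (2 * rbar) * real b powr (real (l + 1) * rbar)"
      by (simp only: of_nat_mult of_nat_power powr_mult sq bp)
    also have "\<dots> \<le> real C powr rbar * ((1 / e) powr (2 * rbar) * real b powr ((r - rbar) * real (l + 2))) * real b powr (real (l + 1) * rbar)"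
      by (intro mult_right_mono mult_left_mono l2) auto
    also have "\<dots> = real C powr rbar * (1 / e) powr (2 * rbar) * real b powr ((r - rbar) * real (l + 2) + real (l + 1) * rbar)"
      by (simp only: powr_add mult.assoc)
    also have "(r - rbar) * real (l + 2) + real (l + 1) * rbar = (2 * (r - rbar) + rbar) + real l * r"
      by (simp add: algebra_simps)
    also have "real C powr rbar * (1 / e) powr (2 * rbar) * real b powr \<dots> = G * real b powr (real l * r)"
      by (simp only: G_def powr_add mult.assoc)
    also have "\<dots> \<le> (G + 1) * real b powr (real l * r)" by (intro mult_right_mono) auto
    finally show ?thesis .
  qed
  moreover have "0 < G + 1" by (simp add: G_def add_nonneg_pos)
  ultimately show ?thesis by blast
qed

lemma Lp_norm_le_of_unit:
  assumes f: "AE x in lborel. x \<in> {0..<1} \<longrightarrow> f x = f' x"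
    and le: "p_integral p (\<lambda>x. f' x - g x) \<le> ennreal (A powr p)" and p: "1 \<le> p" and A: "0 \<le> A"
  shows "Lp_norm p {0..<1} (\<lambda>x. f x - g x) \<le> ennreal A"
proof -
  have "Lp_norm p {0..<1} (\<lambda>x. f x - g x) = Lp_norm p {0..<1} (\<lambda>x. f' x - g x)"
    by (rule Lp_norm_cong_AE) (use f in \<open>eventually_elim, auto\<close>)
  also have "\<dots> \<le> ennreal A"
    unfolding Lp_norm_lborel using le p A by (intro epowr_le_ennrealI) (auto simp: nn_integral_unit_lborel)
  finally show ?thesis .
qed

lemma zero_in_\<Phi>_set: "(\<lambda>_. 0) \<in> \<Phi>_set b m \<phi> c n"
  by (simp add: \<Phi>_set_def)

theorem direct_inequality:
  assumes b: "2 \<le> b" and basis: "is_poly_basis m \<phi>" and p: "1 \<le> p" and \<tau>: "0 < \<tau>" "\<tau> < p"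
    and gap: "r > 1 / \<tau> - 1 / p" and rbar: "0 < rbar" "rbar < r"
  shows "\<exists>C\<ge>0. \<forall>f\<in>fst (Besov r \<tau> (ennreal \<tau>)). \<forall>n. \<exists>g\<in>borel_measurable borel.
     g \<in> \<Phi>_set b m \<phi> compl_N n \<and> g \<in> \<Phi>_set b m \<phi> (compl_S b m) n \<and>
     Lp_norm p {0..<1} (\<lambda>x. f x - g x) \<le> ennreal (C * real (Suc n) powr (- rbar)) * besov_norm r \<tau> (ennreal \<tau>) f"
proof -
  define k where "k = nat \<lfloor>r\<rfloor> + 1"
  have k: "0 < k" by (simp add: k_def)
  have r: "0 < r" using rbar by simp
  define al where "al = r - 1 / \<tau> + 1 / p"
  have al: "0 < al" using gap by (simp add: al_def)
  define q where "q = real b powr (- al)"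
  have q01: "0 \<le> q" "q < 1" using b al by (auto simp: q_def powr_less_one)
  define c where "c = b * k + b * k * k + k * (m + 1)"
  obtain Cm where Cm: "0 \<le> Cm" "\<And>(R :: real poly) B x y. degree R < k \<Longrightarrow> (\<forall>x\<in>{0..<1}. \<bar>poly R x\<bar> \<le> B) \<Longrightarrow>
       x \<in> {0..1} \<Longrightarrow> y \<in> {0..1} \<Longrightarrow> \<bar>poly R x - poly R y\<bar> \<le> Cm * B * \<bar>x - y\<bar>"
    using poly_markov[OF k] by blast
  obtain Cn where Cn: "1 \<le> Cn" "\<And>l. digit_depth \<tau> r l (cutoff_level \<tau> r p l) * (b ^ l * (1 + b * cutoff_level \<tau> r p l)) * c
     \<le> Cn * (l + 1)\<^sup>2 * b ^ l"
    using network_size[of \<tau> r p b c] \<tau>(1) r al unfolding al_def by blast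
  obtain G where G: "0 < G" "\<And>l. real (Cn * (l + 2)\<^sup>2 * b ^ (l + 1)) powr rbar \<le> G * real b powr (real l * r)"
    using size_growth[OF b rbar] by blast
  define \<kappa> where "\<kappa> = step_const b k * real (b ^ Suc k) powr (1 / \<tau>) * 3 powr (1 / \<tau>)"
  define C where "C = (2 / (1 - q) + Cm + 1) * \<kappa> * (G + real Cn powr rbar)"
  have \<kappa>0: "0 \<le> \<kappa>" by (simp add: \<kappa>_def step_const_def)
  have C0: "0 \<le> C" using q01 Cm(1) G(1) \<kappa>0 by (simp add: C_def)
  show ?thesis
  proof (intro exI[of _ C] conjI C0 ballI allI)
    fix f n assume fB: "f \<in> fst (Besov r \<tau> (ennreal \<tau>))"
    then have fm: "f \<in> borel_measurable (lebesgue_on {0..<1})" and fin: "besov_norm r \<tau> (ennreal \<tau>) f < \<infinity>"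
      by (auto simp: Besov_def Lp_def)
    obtain \<beta> where \<beta>: "besov_norm r \<tau> (ennreal \<tau>) f = ennreal \<beta>" "0 \<le> \<beta>"
      using fin by (cases "besov_norm r \<tau> (ennreal \<tau>) f") auto
    obtain f' where f' [measurable]: "f' \<in> borel_measurable borel" and ff': "AE x in lborel. x \<in> {0..<1} \<longrightarrow> f x = f' x"
      using borel_representative[OF fm] by blast
    have bs: "besov_sum b k \<tau> r f' \<le> ennreal ((3 powr (1 / \<tau>) * \<beta>) powr \<tau>)"
      by (rule besov_sum_le[OF b \<tau>(1) r k_def ff' \<beta>])
    let ?bound = "ennreal (C * real (Suc n) powr (- rbar)) * besov_norm r \<tau> (ennreal \<tau>) f"
    let ?goal = "\<lambda>g. g \<in> \<Phi>_set b m \<phi> compl_N n \<and> g \<in> \<Phi>_set b m \<phi> (compl_S b m) n \<and>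
       Lp_norm p {0..<1} (\<lambda>x. f x - g x) \<le> ?bound"
    have fromA: "Lp_norm p {0..<1} (\<lambda>x. f x - g x) \<le> ?bound"
      if le: "p_integral p (\<lambda>x. f' x - g x) \<le> ennreal (A powr p)"
        and A: "0 \<le> A" "A \<le> C * real (Suc n) powr (- rbar) * \<beta>" for g A
    proof -
      have "Lp_norm p {0..<1} (\<lambda>x. f x - g x) \<le> ennreal A" by (rule Lp_norm_le_of_unit[OF ff' le p A(1)])
      also have "\<dots> \<le> ennreal (C * real (Suc n) powr (- rbar) * \<beta>)" by (rule ennreal_leI[OF A(2)])
      also have "\<dots> = ennreal (C * real (Suc n) powr (- rbar)) * ennreal \<beta>" using C0 \<beta>(2) by (intro ennreal_mult) auto
      finally show ?thesis by (simp only: \<beta>(1))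
    qed
    show "\<exists>g\<in>borel_measurable borel. ?goal g"
    proof (cases "\<beta> = 0")
      \<comment> \<open>The construction needs a positive norm; otherwise \<open>f\<close> vanishes almost everywhere.\<close>
      case True
      have "(\<integral>\<^sup>+z\<in>{0..<1}. ennreal (\<bar>f' z\<bar> powr \<tau>) \<partial>lborel) \<le> besov_sum b k \<tau> r f'"
        by (simp add: besov_sum_def)
      also have "\<dots> \<le> 0" using bs True by simp
      finally have "AE z in lborel. ennreal (\<bar>f' z\<bar> powr \<tau>) * indicator {0..<1} z = 0"
        by (subst (asm) le_zero_eq, subst (asm) nn_integral_0_iff_AE) auto
      then have "AE z in lborel. ennreal (\<bar>f' z\<bar> powr p) * indicator {0..<1} z = 0"
        by eventually_elim (auto simp: indicator_def)
      then have "p_integral p (\<lambda>x. f' x - 0) = 0"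
        unfolding nn_integral_unit_lborel by (subst nn_integral_0_iff_AE) auto
      then have "Lp_norm p {0..<1} (\<lambda>x. f x - 0) \<le> ?bound"
        by (intro fromA[where g = "\<lambda>_. 0" and A = 0]) (auto simp: True)
      then show ?thesis by (intro bexI[of _ "\<lambda>_. 0"]) (auto simp: zero_in_\<Phi>_set)
    next
      case False
      then have "0 < 3 powr (1 / \<tau>) * \<beta>" using \<beta>(2) by simp
      from exists_multiscale[OF b k \<tau>(1) this f' bs] obtain P \<delta> js
        where "multiscale b k \<tau> r (step_const b k * real (b ^ Suc k) powr (1 / \<tau>) * (3 powr (1 / \<tau>) * \<beta>)) f' P \<delta> js"
        by blast
      then have ms: "multiscale b k \<tau> r (\<kappa> * \<beta>) f' P \<delta> js" by (simp only: \<kappa>_def mult.assoc)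
      have n0: "0 < real (Suc n)" by simp
      show ?thesis
      proof (cases "n < Cn")
        \<comment> \<open>No network of the construction is small enough, but \<open>n\<close> is bounded and \<open>g = 0\<close> suffices.\<close>
        case True
        have "p_integral p (\<lambda>x. f' x - 0) \<le> ennreal (((2 / (1 - q) + 1) * (\<kappa> * \<beta>)) powr p)"
          using multiscale.Lp_bound[OF ms p \<tau>(2) al[unfolded al_def] q_def[unfolded al_def]] by simp
        moreover have "(2 / (1 - q) + 1) * (\<kappa> * \<beta>) \<le> C * real (Suc n) powr (- rbar) * \<beta>"
        proof -
          have "real (Suc n) powr rbar \<le> real Cn powr rbar" using True rbar by (intro powr_mono2) auto
          then have one: "1 \<le> (G + real Cn powr rbar) * real (Suc n) powr (- rbar)"
            using G(1) n0 by (simp add: powr_minus_divide pos_le_divide_eq)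
          have "(2 / (1 - q) + 1) * (\<kappa> * \<beta>) \<le> (2 / (1 - q) + Cm + 1) * (\<kappa> * \<beta>) * 1"
            using Cm(1) \<kappa>0 \<beta>(2) by (simp add: mult_right_mono)
          also have "\<dots> \<le> (2 / (1 - q) + Cm + 1) * (\<kappa> * \<beta>) * ((G + real Cn powr rbar) * real (Suc n) powr (- rbar))"
            using one Cm(1) \<kappa>0 \<beta>(2) q01 by (intro mult_left_mono) auto
          finally show ?thesis by (simp add: C_def mult_ac)
        qed
        ultimately have "Lp_norm p {0..<1} (\<lambda>x. f x - 0) \<le> ?bound"
          using \<kappa>0 \<beta>(2) q01 by (intro fromA[where g = "\<lambda>_. 0"]) auto
        then show ?thesis by (intro bexI[of _ "\<lambda>_. 0"]) (auto simp: zero_in_\<Phi>_set)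
      next
        case False
        define Nn where "Nn = (\<lambda>l. Cn * (l + 1)\<^sup>2 * b ^ l)"
        have "n < Nn n"
        proof -
          have "1 * (n + 1) * 1 \<le> Cn * (n + 1)\<^sup>2 * b ^ n"
            using Cn(1) b by (intro mult_mono) (auto simp: power2_eq_square)
          then show ?thesis by (simp add: Nn_def)
        qed
        \<comment> \<open>The largest \<open>l\<close> whose network has size at most \<open>n\<close>.\<close>
        then obtain l' where l': "n < Nn l'" "\<And>j. j < l' \<Longrightarrow> \<not> n < Nn j"
          using exists_least_iff[of "\<lambda>l. n < Nn l"] by blast
        have "\<not> n < Nn 0" using False by (simp add: Nn_def)
        then obtain l where l: "l' = Suc l" using l'(1) by (cases l') auto
        have le: "Nn l \<le> n" using l'(2)[of l] l by simp
        define L where "L = cutoff_level \<tau> r p l"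
        define d where "d = digit_depth \<tau> r l L"
        have sz: "d * (b ^ l * (1 + b * L)) * (b * k + b * k * k + k * (m + 1)) \<le> n"
          using Cn(2)[of l] le unfolding Nn_def L_def d_def c_def by (rule order_trans)
        note na = multiscale.network_approximation[OF ms p \<tau>(2) al[unfolded al_def] q_def[unfolded al_def] r basis Cm L_def d_def sz]
        let ?g = "multiscale.rounded b \<tau> r (\<kappa> * \<beta>) P \<delta> l L d"
        have "(2 / (1 - q) + Cm) * (\<kappa> * \<beta>) * real b powr (- real l * r) \<le> C * real (Suc n) powr (- rbar) * \<beta>"
        proof -
          have "real (Suc n) \<le> real (Nn l')" using l'(1) by simp
          also have "Nn l' = Cn * (l + 2)\<^sup>2 * b ^ (l + 1)" by (simp add: Nn_def l)
          finally have "real (Suc n) powr rbar \<le> real (Cn * (l + 2)\<^sup>2 * b ^ (l + 1)) powr rbar"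
            using rbar by (intro powr_mono2) auto
          also have "\<dots> \<le> G * real b powr (real l * r)" by (rule G(2))
          also have "\<dots> \<le> (G + real Cn powr rbar) * real b powr (real l * r)" by (intro mult_right_mono) auto
          finally have "real b powr (- real l * r) \<le> (G + real Cn powr rbar) * real (Suc n) powr (- rbar)"
            using n0 b by (simp add: powr_minus_divide divide_le_eq pos_le_divide_eq mult_ac)
          then have "(2 / (1 - q) + Cm) * (\<kappa> * \<beta>) * real b powr (- real l * r)
              \<le> (2 / (1 - q) + Cm + 1) * (\<kappa> * \<beta>) * ((G + real Cn powr rbar) * real (Suc n) powr (- rbar))"
            using Cm(1) \<kappa>0 \<beta>(2) q01 by (intro mult_mono mult_right_mono) auto
          then show ?thesis by (simp add: C_def mult_ac)
        qed
        then have "Lp_norm p {0..<1} (\<lambda>x. f x - ?g x) \<le> ?bound"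
          using na(3) Cm(1) \<kappa>0 \<beta>(2) q01 by (intro fromA) auto
        then show ?thesis using na(1,2) multiscale.measurable_rounded[OF ms] by blast
      qed
    qed
  qed
qed

section \<open>Embeddings from the direct inequality\<close>

lemma Lp_norm_triangle:
  assumes [measurable]: "f \<in> borel_measurable (lebesgue_on {0..<1})" "g \<in> borel_measurable (lebesgue_on {0..<1})"
    and p: "1 \<le> p"
  shows "Lp_norm p {0..<1} (\<lambda>x. f x + g x) \<le> Lp_norm p {0..<1} f + Lp_norm p {0..<1} g"
proof (cases "Lp_norm p {0..<1} f = \<infinity> \<or> Lp_norm p {0..<1} g = \<infinity>")
  case True
  then show ?thesis by auto
next
  case False
  have L: "Lp_norm p {0..<1} h = epowr (\<integral>\<^sup>+x. ennreal (\<bar>h x\<bar> powr p) \<partial>lebesgue_on {0..<1}) (1 / p)" for h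
    unfolding Lp_norm_def by (subst nn_integral_restrict_space) auto
  obtain A B where AB: "Lp_norm p {0..<1} f = ennreal A" "Lp_norm p {0..<1} g = ennreal B" "0 \<le> A" "0 \<le> B"
    using False by (metis ennreal_cases infinity_ennreal_def)
  have p0: "0 < p" using p by simp
  have "(\<integral>\<^sup>+x. ennreal (\<bar>f x + g x\<bar> powr p) \<partial>lebesgue_on {0..<1}) \<le> ennreal ((A + B) powr p)"
    using AB epowr_le_ennrealD[OF _ p0] by (intro minkowski p) (auto simp: L)
  then have "Lp_norm p {0..<1} (\<lambda>x. f x + g x) \<le> ennreal (A + B)"
    unfolding L using p0 AB by (intro epowr_le_ennrealI) auto
  then show ?thesis using AB by simp
qed

lemma K_functional_mono: "t \<le> t' \<Longrightarrow> K_functional X Y f t \<le> K_functional X Y f t'"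
  unfolding K_functional_def
  by (rule INF_mono, rule bexI) (auto intro!: add_left_mono mult_right_mono ennreal_leI)

lemma best_error_le: "g \<in> \<Psi> \<Longrightarrow> best_error p \<Psi> f \<le> Lp_norm p {0..<1} (\<lambda>x. f x - g x)"
  unfolding best_error_def by (rule INF_lower)

text \<open>The direct inequality for a space \<open>Y\<close>: elements of \<open>Y\<close> are approximated at the rate \<open>n\<^sup>-\<^sup>s\<close>.\<close>

locale direct_estimate =
  fixes p s C :: real and Y :: fspace and \<Phi> :: "nat \<Rightarrow> (real \<Rightarrow> real) set"
  assumes p: "1 \<le> p" and s: "0 < s" and C: "0 \<le> C" and \<Phi>0: "\<Phi> 0 = {\<lambda>_. 0}"
    and meas: "fst Y \<subseteq> borel_measurable (lebesgue_on {0..<1})"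
    and fin: "\<And>f. f \<in> fst Y \<Longrightarrow> snd Y f < \<infinity>"
    and direct: "\<And>f n. f \<in> fst Y \<Longrightarrow> \<exists>g\<in>borel_measurable borel. g \<in> \<Phi> n \<and>
       Lp_norm p {0..<1} (\<lambda>x. f x - g x) \<le> ennreal (C * real (Suc n) powr - s) * snd Y f"
begin

lemma embeds_in_approx_class: "Y \<hookrightarrow> approx_class s \<infinity> p \<Phi>"
proof -
  have norm: "approx_norm s \<infinity> p \<Phi> f \<le> ennreal C * snd Y f" if f: "f \<in> fst Y" for f
  proof -
    have "ennreal (real (Suc n) powr s) * best_error p (\<Phi> n) f \<le> ennreal C * snd Y f" for n
    proof -
      obtain g where g: "g \<in> \<Phi> n" "Lp_norm p {0..<1} (\<lambda>x. f x - g x) \<le> ennreal (C * real (Suc n) powr - s) * snd Y f"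
        using direct[OF f] by blast
      have "ennreal (real (Suc n) powr s) * best_error p (\<Phi> n) f
          \<le> ennreal (real (Suc n) powr s) * (ennreal (C * real (Suc n) powr - s) * snd Y f)"
        by (intro mult_left_mono order_trans[OF best_error_le[OF g(1)] g(2)]) simp
      also have "\<dots> = ennreal (real (Suc n) powr s * (C * real (Suc n) powr - s)) * snd Y f"
        using C by (simp add: ennreal_mult mult.assoc)
      also have "real (Suc n) powr s * (C * real (Suc n) powr - s) = C"
        by (simp add: powr_minus field_simps)
      finally show ?thesis .
    qed
    then show ?thesis by (auto simp: approx_norm_def intro: SUP_least)
  qed
  have "f \<in> fst (Lp p)" if f: "f \<in> fst Y" for f
  proof -
    obtain g where g: "g \<in> \<Phi> 0" "Lp_norm p {0..<1} (\<lambda>x. f x - g x) \<le> ennreal (C * real (Suc 0) powr - s) * snd Y f"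
      using direct[OF f] by blast
    have "Lp_norm p {0..<1} f \<le> ennreal C * snd Y f" using g by (simp add: \<Phi>0)
    also have "\<dots> < \<infinity>" using fin[OF f] by (simp add: ennreal_mult_less_top)
    finally show ?thesis using f meas by (auto simp: Lp_def)
  qed
  moreover have "approx_norm s \<infinity> p \<Phi> f < \<infinity>" if f: "f \<in> fst Y" for f
    using norm[OF f] fin[OF f] by (auto intro: le_less_trans simp: ennreal_mult_less_top)
  ultimately show ?thesis using norm by (auto simp: embeds_def approx_class_def)
qed

text \<open>A function close to some \<open>g\<close> in \<open>Y\<close> is approximated by the approximant of \<open>g\<close>, so no sums of
  elements of \<open>\<Phi> n\<close> are formed.\<close>

lemma best_error_le_K:
  assumes f: "f \<in> fst (Lp p)"
  shows "best_error p (\<Phi> n) f \<le> ennreal (C + 1) * K_functional (Lp p) Y f (real (Suc n) powr - s)"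
proof -
  let ?t = "real (Suc n) powr - s"
  have one: "ennreal (1 / (C + 1)) * ennreal (C + 1) = 1"
    by (subst ennreal_mult[symmetric]) (use C in auto)
  have "ennreal (1 / (C + 1)) * best_error p (\<Phi> n) f \<le> K_functional (Lp p) Y f ?t"
    unfolding K_functional_def
  proof (rule INF_greatest)
    fix g assume g: "g \<in> fst Y"
    obtain \<phi> where \<phi>: "\<phi> \<in> borel_measurable borel" "\<phi> \<in> \<Phi> n"
      "Lp_norm p {0..<1} (\<lambda>x. g x - \<phi> x) \<le> ennreal (C * ?t) * snd Y g"
      using direct[OF g] by blast
    have [measurable]: "\<phi> \<in> borel_measurable (lebesgue_on {0..<1})"
      using \<phi>(1) by (intro measurable_restrict_space1) (simp add: measurable_completion)
    have [measurable]: "f \<in> borel_measurable (lebesgue_on {0..<1})" "g \<in> borel_measurable (lebesgue_on {0..<1})"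
      using f g meas by (auto simp: Lp_def)
    have "best_error p (\<Phi> n) f \<le> Lp_norm p {0..<1} (\<lambda>x. (f x - g x) + (g x - \<phi> x))"
      using best_error_le[OF \<phi>(2), of p f] by simp
    also have "\<dots> \<le> Lp_norm p {0..<1} (\<lambda>x. f x - g x) + Lp_norm p {0..<1} (\<lambda>x. g x - \<phi> x)"
      by (intro Lp_norm_triangle p) measurable
    also have "\<dots> \<le> ennreal (C + 1) * Lp_norm p {0..<1} (\<lambda>x. f x - g x) + ennreal (C + 1) * (ennreal ?t * snd Y g)"
    proof (rule add_mono)
      show "Lp_norm p {0..<1} (\<lambda>x. f x - g x) \<le> ennreal (C + 1) * Lp_norm p {0..<1} (\<lambda>x. f x - g x)"
        using mult_right_mono[of 1 "ennreal (C + 1)" "Lp_norm p {0..<1} (\<lambda>x. f x - g x)"] C by simp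
      have "ennreal (C * ?t) \<le> ennreal ((C + 1) * ?t)" by (intro ennreal_leI mult_right_mono) auto
      then have "ennreal (C * ?t) * snd Y g \<le> ennreal ((C + 1) * ?t) * snd Y g" by (rule mult_right_mono) simp
      then show "Lp_norm p {0..<1} (\<lambda>x. g x - \<phi> x) \<le> ennreal (C + 1) * (ennreal ?t * snd Y g)"
        using \<phi>(3) C by (simp add: ennreal_mult mult.assoc)
    qed
    finally have "ennreal (1 / (C + 1)) * best_error p (\<Phi> n) f \<le> ennreal (1 / (C + 1)) *
       (ennreal (C + 1) * (Lp_norm p {0..<1} (\<lambda>x. f x - g x) + ennreal ?t * snd Y g))"
      by (intro mult_left_mono) (auto simp: distrib_left)
    also have "\<dots> = Lp_norm p {0..<1} (\<lambda>x. f x - g x) + ennreal ?t * snd Y g"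
      unfolding mult.assoc[symmetric] one by simp
    finally show "ennreal (1 / (C + 1)) * best_error p (\<Phi> n) f \<le> snd (Lp p) (\<lambda>x. f x - g x) + ennreal ?t * snd Y g"
      by (simp add: Lp_def)
  qed
  then have "ennreal (C + 1) * (ennreal (1 / (C + 1)) * best_error p (\<Phi> n) f) \<le> ennreal (C + 1) * K_functional (Lp p) Y f ?t"
    by (rule mult_left_mono) simp
  then show ?thesis unfolding mult.assoc[symmetric] mult.commute[of "ennreal (C + 1)" "ennreal (1 / (C + 1))"] one by simp
qed

text \<open>The sum over \<open>n\<close> is compared with the integral over \<open>t\<close> on the disjoint intervals
  \<open>((n+1)\<^sup>-\<^sup>s, \<mu> (n+1)\<^sup>-\<^sup>s)\<close> with \<open>\<mu> = ((n+2)/(n+1))\<^sup>s\<close>, whose measure with respect to \<open>dt/t\<close> is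
  of order \<open>1/(n+1)\<close>.\<close>

lemma approx_sum_le:
  assumes f: "f \<in> fst (Lp p)" and \<alpha>: "0 < \<alpha>" "\<alpha> < s" and Q: "0 < Q"
  shows "(\<Sum>n. epowr (ennreal (real (Suc n) powr \<alpha>) * best_error p (\<Phi> n) f) Q * ennreal (1 / real (Suc n)))
    \<le> ennreal (((C + 1) * 2 powr \<alpha>) powr Q * ((2 + s) / s)) *
       (\<integral>\<^sup>+t\<in>{0<..}. epowr (ennreal (t powr - (\<alpha> / s)) * K_functional (Lp p) Y f t) Q * ennreal (1 / t) \<partial>lebesgue)"
proof -
  let ?K = "K_functional (Lp p) Y f"
  let ?F = "\<lambda>t. epowr (ennreal (t powr - (\<alpha> / s)) * ?K t) Q * ennreal (1 / t)"
  define \<rho> where "\<rho> = (\<lambda>n. real (Suc n) powr - s)"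
  define \<mu> where "\<mu> = (\<lambda>n. (real (n + 2) / real (Suc n)) powr s)"
  define I where "I = (\<lambda>n. {\<rho> n<..<\<mu> n * \<rho> n})"
  define e where "e = (\<lambda>n. epowr (ennreal (2 powr - \<alpha> * real (Suc n) powr \<alpha>) * ?K (\<rho> n)) Q)"
  have \<rho>0: "0 < \<rho> n" for n by (simp add: \<rho>_def)
  have \<mu>0: "0 < \<mu> n" for n by (simp add: \<mu>_def)
  have \<mu>1: "1 + s / real (n + 2) \<le> \<mu> n" for n
  proof -
    have "ln (real (Suc n) / real (n + 2)) \<le> real (Suc n) / real (n + 2) - 1" by (intro ln_le_minus_one) simp
    then have "1 / real (n + 2) \<le> ln (real (n + 2) / real (Suc n))"
      by (simp add: ln_div field_simps)
    then have "s / real (n + 2) \<le> s * ln (real (n + 2) / real (Suc n))"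
      using s mult_left_mono[of "1 / real (n + 2)" "ln (real (n + 2) / real (Suc n))" s] by simp
    moreover have "\<mu> n = exp (s * ln (real (n + 2) / real (Suc n)))" by (simp add: \<mu>_def powr_def)
    ultimately show ?thesis using exp_ge_add_one_self[of "s * ln (real (n + 2) / real (Suc n))"] by linarith
  qed
  have \<mu>\<rho>: "\<mu> (Suc n) * \<rho> (Suc n) \<le> \<rho> n" for n
  proof -
    have "\<mu> (Suc n) * \<rho> (Suc n) = (real (n + 3) / real (n + 2) / real (n + 2)) powr s"
      by (simp add: \<mu>_def \<rho>_def powr_minus_divide powr_divide add.commute eval_nat_numeral, simp add: powr_mult)
    also have "\<dots> \<le> (1 / real (Suc n)) powr s"
    proof (intro powr_mono2)
      have "real (n + 3) * real (Suc n) \<le> real (n + 2) * real (n + 2)" by (simp add: algebra_simps)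
      then have "real (n + 3) \<le> 1 / real (Suc n) * (real (n + 2) * real (n + 2))"
        by (simp only: times_divide_eq_left mult_1 pos_le_divide_eq of_nat_0_less_iff zero_less_Suc)
      then show "real (n + 3) / real (n + 2) / real (n + 2) \<le> 1 / real (Suc n)"
        unfolding divide_divide_eq_left by (intro mult_imp_div_pos_le) auto
    qed (use s in auto)
    also have "\<dots> = \<rho> n" by (simp add: \<rho>_def powr_minus_divide powr_divide)
    finally show ?thesis .
  qed
  have \<rho>_anti: "\<rho> n \<le> \<rho> m" if "m \<le> n" for m n
    unfolding \<rho>_def using that s by (intro powr_mono2') auto
  have disj: "disjoint_family I"
  proof -
    have "I m \<inter> I n = {}" if "m < n" for m n
    proof -
      define n' where "n' = n - 1"
      have n': "n = Suc n'" "m \<le> n'" using that by (auto simp: n'_def)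
      have "\<mu> n * \<rho> n \<le> \<rho> m" using \<mu>\<rho>[of n'] \<rho>_anti[OF n'(2)] n'(1) by simp
      then show ?thesis by (auto simp: I_def)
    qed
    then show ?thesis unfolding disjoint_family_on_def by (metis Int_commute linorder_neqE_nat)
  qed
  have low: "(\<Sum>n. e n * ennreal (1 / (\<mu> n * \<rho> n)) * emeasure lebesgue (I n)) \<le> (\<integral>\<^sup>+t\<in>{0<..}. ?F t \<partial>lebesgue)"
  proof (rule nn_integral_ge_disjoint_sum[OF _ _ disj])
    show "I n \<subseteq> {0<..}" for n using \<rho>0[of n] by (auto simp: I_def)
    fix n t assume "t \<in> I n"
    then have t: "\<rho> n < t" "t < \<mu> n * \<rho> n" by (auto simp: I_def)
    then have t0: "0 < t" using \<rho>0[of n] by linarith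
    have "\<mu> n \<le> 2 powr s" unfolding \<mu>_def using s by (intro powr_mono2) (auto simp: field_simps)
    then have "t \<le> 2 powr s * \<rho> n" using t \<rho>0[of n] by (smt (verit) mult_right_mono)
    then have "(2 powr s * \<rho> n) powr - (\<alpha> / s) \<le> t powr - (\<alpha> / s)"
      using t0 \<alpha> s by (intro powr_mono2') auto
    moreover have "(2 powr s * \<rho> n) powr - (\<alpha> / s) = 2 powr - \<alpha> * real (Suc n) powr \<alpha>"
      using s by (simp add: \<rho>_def powr_mult powr_powr)
    ultimately have "e n \<le> epowr (ennreal (t powr - (\<alpha> / s)) * ?K t) Q"
      unfolding e_def using t Q by (intro epowr_mono mult_mono ennreal_leI K_functional_mono) auto
    then show "e n * ennreal (1 / (\<mu> n * \<rho> n)) \<le> ?F t"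
      using t t0 by (intro mult_mono ennreal_leI divide_left_mono) auto
  qed (simp add: I_def)
  have "(\<Sum>n. epowr (ennreal (real (Suc n) powr \<alpha>) * best_error p (\<Phi> n) f) Q * ennreal (1 / real (Suc n)))
      \<le> (\<Sum>n. ennreal (((C + 1) * 2 powr \<alpha>) powr Q * ((2 + s) / s)) * (e n * ennreal (1 / (\<mu> n * \<rho> n)) * emeasure lebesgue (I n)))"
  proof (intro suminf_le summableI)
    fix n
    have "ennreal (real (Suc n) powr \<alpha>) * best_error p (\<Phi> n) f
        \<le> ennreal (real (Suc n) powr \<alpha>) * (ennreal (C + 1) * ?K (\<rho> n))"
      unfolding \<rho>_def by (intro mult_left_mono best_error_le_K f) simp
    also have "\<dots> = ennreal ((C + 1) * 2 powr \<alpha>) * (ennreal (2 powr - \<alpha> * real (Suc n) powr \<alpha>) * ?K (\<rho> n))"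
    proof -
      have "real (Suc n) powr \<alpha> * (C + 1) = (C + 1) * 2 powr \<alpha> * (2 powr - \<alpha> * real (Suc n) powr \<alpha>)"
        by (simp add: powr_minus field_simps)
      then show ?thesis using C by (simp only: mult.assoc[symmetric] ennreal_mult[symmetric] powr_ge_zero add_nonneg_nonneg mult_nonneg_nonneg zero_le_one)
    qed
    finally have "epowr (ennreal (real (Suc n) powr \<alpha>) * best_error p (\<Phi> n) f) Q
        \<le> ennreal (((C + 1) * 2 powr \<alpha>) powr Q) * e n"
      unfolding e_def using Q C by (subst epowr_mult[symmetric]) (auto intro: epowr_mono)
    moreover have "ennreal (1 / real (Suc n)) \<le> ennreal ((2 + s) / s) * (ennreal (1 / (\<mu> n * \<rho> n)) * emeasure lebesgue (I n))"
    proof -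
      have "1 \<le> \<mu> n" using \<mu>1[of n] s by (smt (verit) divide_nonneg_nonneg of_nat_0_le_iff)
      then have le: "\<rho> n \<le> \<mu> n * \<rho> n" using \<rho>0[of n] by simp
      have em: "emeasure lebesgue (I n) = ennreal (\<mu> n * \<rho> n - \<rho> n)" using le by (simp add: I_def)
      have "1 / \<mu> n \<le> 1 / (1 + s / real (n + 2))"
        using \<mu>1[of n] \<mu>0[of n] s by (intro divide_left_mono mult_pos_pos add_pos_nonneg) auto
      also have "\<dots> = 1 - s / (real (n + 2) + s)" using s by (simp add: field_simps)
      finally have "s / (real (n + 2) + s) \<le> 1 - 1 / \<mu> n" by linarith
      moreover have "s / ((2 + s) * real (Suc n)) \<le> s / (real (n + 2) + s)"
      proof -
        have "0 \<le> real n * s" using s by simp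
        then have "real (n + 2) + s \<le> (2 + s) * real (Suc n)" by (simp add: algebra_simps)
        then show ?thesis using s by (intro divide_left_mono) auto
      qed
      moreover have "1 - 1 / \<mu> n = 1 / (\<mu> n * \<rho> n) * (\<mu> n * \<rho> n - \<rho> n)"
        using \<mu>0[of n] \<rho>0[of n] by (simp add: field_simps)
      ultimately have "(2 + s) / s * (s / ((2 + s) * real (Suc n))) \<le> (2 + s) / s * (1 / (\<mu> n * \<rho> n) * (\<mu> n * \<rho> n - \<rho> n))"
        using s by (intro mult_left_mono) auto
      also have "(2 + s) / s * (s / ((2 + s) * real (Suc n))) = 1 / real (Suc n)" using s by simp
      finally have "ennreal (1 / real (Suc n)) \<le> ennreal ((2 + s) / s * (1 / (\<mu> n * \<rho> n) * (\<mu> n * \<rho> n - \<rho> n)))"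
        by (rule ennreal_leI)
      also have "\<dots> = ennreal ((2 + s) / s) * (ennreal (1 / (\<mu> n * \<rho> n)) * ennreal (\<mu> n * \<rho> n - \<rho> n))"
        using s \<mu>0[of n] \<rho>0[of n] le by (simp only: ennreal_mult divide_nonneg_nonneg add_nonneg_nonneg less_imp_le
            zero_le_numeral mult_nonneg_nonneg zero_le_one diff_ge_0_iff_ge)
      finally show ?thesis by (simp only: em)
    qed
    ultimately have "epowr (ennreal (real (Suc n) powr \<alpha>) * best_error p (\<Phi> n) f) Q * ennreal (1 / real (Suc n))
        \<le> (ennreal (((C + 1) * 2 powr \<alpha>) powr Q) * e n) * (ennreal ((2 + s) / s) * (ennreal (1 / (\<mu> n * \<rho> n)) * emeasure lebesgue (I n)))"
      by (intro mult_mono) auto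
    also have "\<dots> = ennreal (((C + 1) * 2 powr \<alpha>) powr Q * ((2 + s) / s)) * (e n * ennreal (1 / (\<mu> n * \<rho> n)) * emeasure lebesgue (I n))"
    proof -
      have "ennreal (((C + 1) * 2 powr \<alpha>) powr Q * ((2 + s) / s)) = ennreal (((C + 1) * 2 powr \<alpha>) powr Q) * ennreal ((2 + s) / s)"
        using s by (intro ennreal_mult) auto
      then show ?thesis by (simp only: mult_ac)
    qed
    finally show "epowr (ennreal (real (Suc n) powr \<alpha>) * best_error p (\<Phi> n) f) Q * ennreal (1 / real (Suc n))
        \<le> ennreal (((C + 1) * 2 powr \<alpha>) powr Q * ((2 + s) / s)) * (e n * ennreal (1 / (\<mu> n * \<rho> n)) * emeasure lebesgue (I n))" .
  qed
  also have "\<dots> = ennreal (((C + 1) * 2 powr \<alpha>) powr Q * ((2 + s) / s)) * (\<Sum>n. e n * ennreal (1 / (\<mu> n * \<rho> n)) * emeasure lebesgue (I n))"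
    by (rule ennreal_suminf_cmult)
  also have "\<dots> \<le> ennreal (((C + 1) * 2 powr \<alpha>) powr Q * ((2 + s) / s)) * (\<integral>\<^sup>+t\<in>{0<..}. ?F t \<partial>lebesgue)"
    by (intro mult_left_mono low) simp
  finally show ?thesis .
qed

lemma embedsI_norm:
  assumes "\<And>f. f \<in> fst (Lp p) \<Longrightarrow> approx_norm \<alpha> q p \<Psi> f \<le> ennreal D * N f"
  shows "({f \<in> fst (Lp p). N f < \<infinity>}, N) \<hookrightarrow> approx_class \<alpha> q p \<Psi>"
proof -
  have "approx_norm \<alpha> q p \<Psi> f < \<infinity>" if "f \<in> fst (Lp p)" "N f < \<infinity>" for f
    using assms[OF that(1)] that(2) by (auto intro: le_less_trans simp: ennreal_mult_less_top)
  then show ?thesis unfolding embeds_def approx_class_def using assms by (auto intro!: exI[of _ D])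
qed

lemma interpolation_embeds:
  assumes \<alpha>: "0 < \<alpha>" "\<alpha> < s" and q: "0 < q"
  shows "interpolation_space (Lp p) Y (\<alpha> / s) q \<hookrightarrow> approx_class \<alpha> q p \<Phi>"
proof (cases "q = \<infinity>")
  case True
  have "approx_norm \<alpha> q p \<Phi> f \<le> ennreal (C + 1) * interpolation_norm (Lp p) Y (\<alpha> / s) q f" if f: "f \<in> fst (Lp p)" for f
  proof -
    have "ennreal (real (Suc n) powr \<alpha>) * best_error p (\<Phi> n) f
        \<le> ennreal (C + 1) * (SUP t\<in>{0<..}. ennreal (t powr - (\<alpha> / s)) * K_functional (Lp p) Y f t)" for n
    proof -
      let ?t = "real (Suc n) powr - s"
      have "ennreal (real (Suc n) powr \<alpha>) * best_error p (\<Phi> n) f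
          \<le> ennreal (real (Suc n) powr \<alpha>) * (ennreal (C + 1) * K_functional (Lp p) Y f ?t)"
        by (intro mult_left_mono best_error_le_K f) simp
      also have "\<dots> = ennreal (C + 1) * (ennreal (?t powr - (\<alpha> / s)) * K_functional (Lp p) Y f ?t)"
        using s by (simp add: powr_powr mult_ac)
      also have "\<dots> \<le> ennreal (C + 1) * (SUP t\<in>{0<..}. ennreal (t powr - (\<alpha> / s)) * K_functional (Lp p) Y f t)"
        by (intro mult_left_mono SUP_upper) auto
      finally show ?thesis .
    qed
    then show ?thesis using True by (auto simp: approx_norm_def interpolation_norm_def Lq_star_norm_def intro: SUP_least)
  qed
  then show ?thesis unfolding interpolation_space_def by (rule embedsI_norm)
next
  case False
  define Q where "Q = enn2real q"
  have Q: "0 < Q" using q False by (simp add: Q_def enn2real_positive_iff top.not_eq_extremum)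
  define D where "D = ((C + 1) * 2 powr \<alpha>) powr Q * ((2 + s) / s)"
  have D: "0 < D" using C s by (simp add: D_def)
  have "approx_norm \<alpha> q p \<Phi> f \<le> ennreal (D powr (1 / Q)) * interpolation_norm (Lp p) Y (\<alpha> / s) q f" if f: "f \<in> fst (Lp p)" for f
  proof -
    have "approx_norm \<alpha> q p \<Phi> f \<le> epowr (ennreal D *
       (\<integral>\<^sup>+t\<in>{0<..}. epowr (ennreal (t powr - (\<alpha> / s)) * K_functional (Lp p) Y f t) Q * ennreal (1 / t) \<partial>lebesgue)) (1 / Q)"
      using False Q approx_sum_le[OF f \<alpha> Q] by (auto simp: approx_norm_def Q_def[symmetric] D_def intro: epowr_mono)
    also have "\<dots> = ennreal (D powr (1 / Q)) * interpolation_norm (Lp p) Y (\<alpha> / s) q f"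
      using False Q D by (simp add: epowr_mult interpolation_norm_def Lq_star_norm_def Q_def[symmetric])
    finally show ?thesis .
  qed
  then show ?thesis unfolding interpolation_space_def by (rule embedsI_norm)
qed

end

section \<open>Fully connected networks\<close>

lemma best_error_antimono: "\<Psi> \<subseteq> \<Psi>' \<Longrightarrow> best_error p \<Psi>' f \<le> best_error p \<Psi> f"
  unfolding best_error_def by (rule INF_superset_mono) auto

lemma compl_C_le:
  assumes "is_tensor_network v"
  shows "compl_C b m v \<le> (2 * b + m + 1) * (compl_N v)\<^sup>2"
proof -
  let ?d = "tn_depth v" and ?N = "compl_N v"
  have d: "1 \<le> ?d" and rk: "\<And>\<nu>. \<nu> \<in> {1..?d} \<Longrightarrow> 1 \<le> tn_rank v \<nu>"
    using assms by (auto simp: is_tensor_network_def)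
  have le: "tn_rank v \<nu> \<le> ?N" if "\<nu> \<in> {1..?d}" for \<nu>
    unfolding compl_N_def using that by (intro member_le_sum) auto
  have "1 \<le> ?N" using le[of 1] rk[of 1] d by auto
  then have sq: "?N \<le> ?N\<^sup>2" by (simp add: power2_eq_square)
  have "(\<Sum>k=2..?d. tn_rank v (k - 1) * tn_rank v k) \<le> (\<Sum>k=2..?d. ?N * tn_rank v k)"
    by (intro sum_mono mult_right_mono le) auto
  also have "\<dots> = ?N * (\<Sum>k=2..?d. tn_rank v k)" by (simp add: sum_distrib_left)
  also have "\<dots> \<le> ?N * ?N"
    unfolding compl_N_def[of v] by (intro mult_left_mono sum_mono2) auto
  finally have s: "(\<Sum>k=2..?d. tn_rank v (k - 1) * tn_rank v k) \<le> ?N\<^sup>2" by (simp add: power2_eq_square)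
  have "compl_C b m v \<le> b * ?N\<^sup>2 + b * ?N\<^sup>2 + ?N\<^sup>2 * (m + 1)"
    unfolding compl_C_def using s le[of 1] le[of ?d] d sq
    by (intro add_mono mult_left_mono mult_right_mono) auto
  then show ?thesis by (simp add: algebra_simps)
qed

lemma \<Phi>_set_mono: "n \<le> n' \<Longrightarrow> \<Phi>_set b m \<phi> c n \<subseteq> \<Phi>_set b m \<phi> c n'"
  by (auto simp: \<Phi>_set_def intro: order_trans)

lemma \<Phi>_set_N_subset_C:
  "\<Phi>_set b m \<phi> compl_N n \<subseteq> \<Phi>_set b m \<phi> (compl_C b m) ((2 * b + m + 1) * n\<^sup>2)"
proof (cases "n = 0")
  case True
  then show ?thesis by (simp add: \<Phi>_set_def)
next
  case False
  have "compl_C b m v \<le> (2 * b + m + 1) * n\<^sup>2" if "is_tensor_network v" "compl_N v \<le> n" for v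
  proof -
    have "(2 * b + m + 1) * (compl_N v)\<^sup>2 \<le> (2 * b + m + 1) * n\<^sup>2"
      using that(2) by (intro mult_left_mono power_mono) auto
    then show ?thesis using compl_C_le[OF that(1), of b m] by (rule order_trans[rotated])
  qed
  then show ?thesis using False by (auto simp: \<Phi>_set_def)
qed

lemma square_block:
  fixes c n :: nat
  assumes "1 \<le> c"
  obtains j where "c * j\<^sup>2 \<le> n" "n < c * (j + 1)\<^sup>2"
proof -
  have "n < c * (n + 1)\<^sup>2"
  proof -
    have "1 * (n + 1) \<le> c * (n + 1)\<^sup>2"
      using assms by (intro mult_mono) (auto simp: power2_eq_square)
    then show ?thesis by simp
  qed
  then obtain j' where j': "n < c * j'\<^sup>2" "\<And>i. i < j' \<Longrightarrow> \<not> n < c * i\<^sup>2"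
    using exists_least_iff[of "\<lambda>j. n < c * j\<^sup>2"] by blast
  then obtain j where "j' = Suc j" by (cases j') auto
  then show ?thesis using that[of j] j'(1) j'(2)[of j] by simp
qed

text \<open>If \<open>\<Phi> n\<close> is contained in \<open>\<Psi> (c n\<^sup>2)\<close>, then the errors for the indices between \<open>c j\<^sup>2\<close> and
  \<open>c (j + 1)\<^sup>2\<close> are at most the one of \<open>\<Phi> j\<close>: passing to squares halves the exponent.\<close>

lemma quadratic_embedding:
  fixes \<Phi> \<Psi> :: "nat \<Rightarrow> (real \<Rightarrow> real) set"
  assumes c: "1 \<le> c" and sub: "\<And>n. \<Phi> n \<subseteq> \<Psi> (c * n\<^sup>2)" and mono: "\<And>n n'. n \<le> n' \<Longrightarrow> \<Psi> n \<subseteq> \<Psi> n'"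
    and \<alpha>: "0 < \<alpha>" and q: "0 < q"
  shows "approx_class \<alpha> q p \<Phi> \<hookrightarrow> approx_class (\<alpha> / 2) q p \<Psi>"
proof -
  define A where "A = real c powr (\<alpha> / 2)"
  have A: "0 < A" using c by (simp add: A_def)
  have compare: "ennreal (real (Suc n) powr (\<alpha> / 2)) * best_error p (\<Psi> n) f
      \<le> ennreal A * (ennreal (real (Suc j) powr \<alpha>) * best_error p (\<Phi> j) f)"
    if j: "c * j\<^sup>2 \<le> n" "n < c * (j + 1)\<^sup>2" for n j f
  proof -
    have "real (Suc n) \<le> real (c * (j + 1)\<^sup>2)" using j(2) by (simp only: of_nat_le_iff Suc_le_eq)
    then have "real (Suc n) powr (\<alpha> / 2) \<le> (real c * (real (Suc j))\<^sup>2) powr (\<alpha> / 2)"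
      using \<alpha> by (intro powr_mono2) auto
    also have "\<dots> = A * real (Suc j) powr \<alpha>"
    proof -
      have "(real (Suc j))\<^sup>2 = real (Suc j) powr 2" by simp
      then have "((real (Suc j))\<^sup>2) powr (\<alpha> / 2) = real (Suc j) powr (2 * (\<alpha> / 2))" by (simp only: powr_powr)
      then show ?thesis by (simp add: A_def powr_mult)
    qed
    finally have 1: "real (Suc n) powr (\<alpha> / 2) \<le> A * real (Suc j) powr \<alpha>" .
    have "\<Phi> j \<subseteq> \<Psi> n" using sub[of j] mono[OF j(1)] by (rule subset_trans)
    then have "best_error p (\<Psi> n) f \<le> best_error p (\<Phi> j) f" by (rule best_error_antimono)
    then have "ennreal (real (Suc n) powr (\<alpha> / 2)) * best_error p (\<Psi> n) f
        \<le> ennreal (A * real (Suc j) powr \<alpha>) * best_error p (\<Phi> j) f"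
      using 1 by (intro mult_mono ennreal_leI) auto
    then show ?thesis using A by (simp add: ennreal_mult mult.assoc)
  qed
  have "\<exists>D. \<forall>f. approx_norm (\<alpha> / 2) q p \<Psi> f \<le> ennreal D * approx_norm \<alpha> q p \<Phi> f"
  proof (cases "q = \<infinity>")
    case True
    have "ennreal (real (Suc n) powr (\<alpha> / 2)) * best_error p (\<Psi> n) f \<le> ennreal A * approx_norm \<alpha> q p \<Phi> f" for n f
    proof -
      obtain j where j: "c * j\<^sup>2 \<le> n" "n < c * (j + 1)\<^sup>2" using square_block[OF c] by blast
      have "ennreal (real (Suc j) powr \<alpha>) * best_error p (\<Phi> j) f \<le> approx_norm \<alpha> q p \<Phi> f"
        using True by (auto simp: approx_norm_def intro: SUP_upper)
      then show ?thesis by (rule order_trans[OF compare[OF j] mult_left_mono]) simp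
    qed
    then show ?thesis using True by (intro exI[of _ A]) (auto simp: approx_norm_def intro: SUP_least)
  next
    case False
    define Q where "Q = enn2real q"
    have Q: "0 < Q" using q False by (simp add: Q_def enn2real_positive_iff top.not_eq_extremum)
    define D where "D = A powr Q * (4 * real c)"
    have D: "0 < D" using A c by (simp add: D_def)
    have sum: "(\<Sum>n. epowr (ennreal (real (Suc n) powr (\<alpha> / 2)) * best_error p (\<Psi> n) f) Q * ennreal (1 / real (Suc n)))
        \<le> ennreal D * (\<Sum>j. epowr (ennreal (real (Suc j) powr \<alpha>) * best_error p (\<Phi> j) f) Q * ennreal (1 / real (Suc j)))" for f
    proof -
      define F where "F = (\<lambda>n. epowr (ennreal (real (Suc n) powr (\<alpha> / 2)) * best_error p (\<Psi> n) f) Q * ennreal (1 / real (Suc n)))"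
      define G where "G = (\<lambda>j. epowr (ennreal (real (Suc j) powr \<alpha>) * best_error p (\<Phi> j) f) Q)"
      have FG: "F n \<le> ennreal (A powr Q * (2 / (real (Suc j))\<^sup>2)) * G j"
        if j: "c * j\<^sup>2 \<le> n" "n < c * (j + 1)\<^sup>2" for n j
      proof -
        have "epowr (ennreal (real (Suc n) powr (\<alpha> / 2)) * best_error p (\<Psi> n) f) Q \<le> ennreal (A powr Q) * G j"
          unfolding G_def epowr_mult[OF A Q, symmetric] by (rule epowr_mono[OF compare[OF j] Q])
        moreover have "1 / real (Suc n) \<le> 2 / (real (Suc j))\<^sup>2"
        proof -
          have "(Suc j)\<^sup>2 \<le> 2 * (j\<^sup>2 + 1)"
          proof -
            have "2 * int j \<le> int j * int j + 1" using zero_le_square[of "int j - 1"] by (simp add: algebra_simps)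
            then have "2 * j \<le> j * j + 1" by (simp flip: of_nat_mult of_nat_le_iff[where 'a=int])
            then show ?thesis by (simp add: power2_eq_square)
          qed
          also have "\<dots> \<le> 2 * Suc n"
          proof -
            have "1 * j\<^sup>2 \<le> n" by (rule order_trans[OF mult_right_mono[OF c] j(1)]) simp
            then show ?thesis by simp
          qed
          finally have "real ((Suc j)\<^sup>2) \<le> real (2 * Suc n)" by (simp only: of_nat_le_iff)
          then have "(real (Suc j))\<^sup>2 \<le> 2 * real (Suc n)" by simp
          then show ?thesis by (simp add: field_simps)
        qed
        ultimately have "F n \<le> (ennreal (A powr Q) * G j) * ennreal (2 / (real (Suc j))\<^sup>2)"
          unfolding F_def by (intro mult_mono ennreal_leI) auto
        moreover have "ennreal (A powr Q * (2 / (real (Suc j))\<^sup>2)) = ennreal (A powr Q) * ennreal (2 / (real (Suc j))\<^sup>2)"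
          by (intro ennreal_mult) auto
        ultimately show ?thesis by (simp only: mult_ac)
      qed
      have block: "(\<Sum>n=c * j\<^sup>2..<c * (Suc j)\<^sup>2. F n) \<le> ennreal D * (G j * ennreal (1 / real (Suc j)))" for j
      proof -
        have "(\<Sum>n=c * j\<^sup>2..<c * (Suc j)\<^sup>2. F n) \<le> (\<Sum>n=c * j\<^sup>2..<c * (Suc j)\<^sup>2. ennreal (A powr Q * (2 / (real (Suc j))\<^sup>2)) * G j)"
          by (intro sum_mono FG) auto
        also have "\<dots> = of_nat (c * (2 * j + 1)) * (ennreal (A powr Q * (2 / (real (Suc j))\<^sup>2)) * G j)"
        proof -
          have "c * (Suc j)\<^sup>2 - c * j\<^sup>2 = c * (2 * j + 1)" by (simp add: power2_eq_square algebra_simps)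
          then show ?thesis by simp
        qed
        also have "\<dots> = ennreal (real (c * (2 * j + 1)) * (A powr Q * (2 / (real (Suc j))\<^sup>2))) * G j"
          by (subst ennreal_mult) (auto simp: ennreal_of_nat_eq_real_of_nat mult.assoc)
        also have "\<dots> \<le> ennreal (D * (1 / real (Suc j))) * G j"
        proof (intro mult_right_mono ennreal_leI)
          have "real (c * (2 * j + 1)) \<le> 2 * real c * real (Suc j)" by (simp add: algebra_simps)
          then have "real (c * (2 * j + 1)) * (A powr Q * (2 / (real (Suc j))\<^sup>2)) \<le> 2 * real c * real (Suc j) * (A powr Q * (2 / (real (Suc j))\<^sup>2))"
            by (intro mult_right_mono) auto
          also have "\<dots> = D * (1 / real (Suc j))" by (simp add: D_def power2_eq_square)
          finally show "real (c * (2 * j + 1)) * (A powr Q * (2 / (real (Suc j))\<^sup>2)) \<le> D * (1 / real (Suc j))" .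
        qed simp
        also have "\<dots> = ennreal D * (G j * ennreal (1 / real (Suc j)))"
          using D by (simp only: ennreal_mult less_imp_le zero_le_divide_1_iff of_nat_0_le_iff mult_ac)
        finally show ?thesis .
      qed
      have partial: "(\<Sum>n<c * J\<^sup>2. F n) \<le> (\<Sum>j<J. ennreal D * (G j * ennreal (1 / real (Suc j))))" for J
      proof (induction J)
        case (Suc J)
        have split: "{..<c * (Suc J)\<^sup>2} = {..<c * J\<^sup>2} \<union> {c * J\<^sup>2..<c * (Suc J)\<^sup>2}"
        proof -
          have "c * J\<^sup>2 \<le> c * (Suc J)\<^sup>2" by (intro mult_left_mono power_mono) auto
          then show ?thesis by (rule ivl_disj_un_one(2)[symmetric])
        qed
        have "(\<Sum>n<c * (Suc J)\<^sup>2. F n) = (\<Sum>n<c * J\<^sup>2. F n) + (\<Sum>n=c * J\<^sup>2..<c * (Suc J)\<^sup>2. F n)"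
          unfolding split by (rule sum.union_disjoint) auto
        also have "\<dots> \<le> (\<Sum>j<J. ennreal D * (G j * ennreal (1 / real (Suc j)))) + ennreal D * (G J * ennreal (1 / real (Suc J)))"
          by (intro add_mono Suc.IH block)
        finally show ?case by simp
      qed simp
      have "(\<Sum>n. F n) \<le> (\<Sum>j. ennreal D * (G j * ennreal (1 / real (Suc j))))"
      proof (subst suminf_eq_SUP, rule SUP_least)
        fix J :: nat
        have "1 * J \<le> c * J\<^sup>2" using c by (intro mult_mono) (auto simp: power2_eq_square)
        then have "(\<Sum>n<J. F n) \<le> (\<Sum>n<c * J\<^sup>2. F n)" by (intro sum_mono2) auto
        also have "\<dots> \<le> (\<Sum>j<J. ennreal D * (G j * ennreal (1 / real (Suc j))))" by (rule partial)
        also have "\<dots> \<le> (\<Sum>j. ennreal D * (G j * ennreal (1 / real (Suc j))))" by (intro sum_le_suminf summableI) auto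
        finally show "(\<Sum>n<J. F n) \<le> (\<Sum>j. ennreal D * (G j * ennreal (1 / real (Suc j))))" .
      qed
      then show ?thesis unfolding F_def G_def ennreal_suminf_cmult .
    qed
    have "approx_norm (\<alpha> / 2) q p \<Psi> f \<le> ennreal (D powr (1 / Q)) * approx_norm \<alpha> q p \<Phi> f" for f
    proof -
      have "0 < 1 / Q" using Q by simp
      from epowr_mono[OF sum this] show ?thesis
        using False unfolding epowr_mult[OF D \<open>0 < 1 / Q\<close>] by (simp add: approx_norm_def Q_def[symmetric])
    qed
    then show ?thesis by blast
  qed
  then obtain D where D: "\<And>f. approx_norm (\<alpha> / 2) q p \<Psi> f \<le> ennreal D * approx_norm \<alpha> q p \<Phi> f" by blast
  have "approx_norm (\<alpha> / 2) q p \<Psi> f < \<infinity>" if "approx_norm \<alpha> q p \<Phi> f < \<infinity>" for f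
    using D[of f] that by (auto intro: le_less_trans simp: ennreal_mult_less_top)
  then show ?thesis unfolding embeds_def approx_class_def using D by auto
qed

theorem mainTheorem2:
  fixes b m :: nat and \<phi> :: "nat \<Rightarrow> real poly" and p \<tau> r rbar :: real
  assumes "2 \<le> b"
    and "is_poly_basis m \<phi>"
    and "1 \<le> p"
    and "0 < \<tau>" and "\<tau> < p"
    and "r > 1 / \<tau> - 1 / p"
    and "0 < rbar" and "rbar < r"
  shows
    "(Besov r \<tau> (ennreal \<tau>) \<hookrightarrow> N_class b m \<phi> rbar \<infinity> p) \<and>
     (N_class b m \<phi> rbar \<infinity> p \<hookrightarrow> C_class b m \<phi> (rbar / 2) \<infinity> p) \<and>
     (Besov r \<tau> (ennreal \<tau>) \<hookrightarrow> S_class b m \<phi> rbar \<infinity> p) \<and>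
     (\<forall>(q::ennreal) (\<alpha>::real). 0 < q \<longrightarrow> 0 < \<alpha> \<longrightarrow> \<alpha> < rbar \<longrightarrow>
        (interpolation_space (Lp p) (Besov r \<tau> (ennreal \<tau>)) (\<alpha> / rbar) q
            \<hookrightarrow> N_class b m \<phi> \<alpha> q p) \<and>
        (N_class b m \<phi> \<alpha> q p \<hookrightarrow> C_class b m \<phi> (\<alpha> / 2) q p) \<and>
        (interpolation_space (Lp p) (Besov r \<tau> (ennreal \<tau>)) (\<alpha> / rbar) q
            \<hookrightarrow> S_class b m \<phi> \<alpha> q p))"
proof -
  let ?B = "Besov r \<tau> (ennreal \<tau>)"
  obtain C where C: "0 \<le> C" and dir: "\<And>f n. f \<in> fst ?B \<Longrightarrow> \<exists>g\<in>borel_measurable borel.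
     g \<in> \<Phi>_set b m \<phi> compl_N n \<and> g \<in> \<Phi>_set b m \<phi> (compl_S b m) n \<and>
     Lp_norm p {0..<1} (\<lambda>x. f x - g x) \<le> ennreal (C * real (Suc n) powr (- rbar)) * besov_norm r \<tau> (ennreal \<tau>) f"
    using direct_inequality[OF assms] by blast
  have est: "direct_estimate p rbar C ?B \<Phi>"
    if "\<Phi> = \<Phi>_set b m \<phi> compl_N \<or> \<Phi> = \<Phi>_set b m \<phi> (compl_S b m)" for \<Phi>
  proof
    show "1 \<le> p" "0 < rbar" "0 \<le> C" by fact+
    show "\<Phi> 0 = {\<lambda>_. 0}" using that by (auto simp: \<Phi>_set_def)
    show "fst ?B \<subseteq> borel_measurable (lebesgue_on {0..<1})" by (auto simp: Besov_def Lp_def)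
    show "snd ?B f < \<infinity>" if "f \<in> fst ?B" for f using that by (auto simp: Besov_def)
    show "\<exists>g\<in>borel_measurable borel. g \<in> \<Phi> n \<and>
       Lp_norm p {0..<1} (\<lambda>x. f x - g x) \<le> ennreal (C * real (Suc n) powr - rbar) * snd ?B f"
      if "f \<in> fst ?B" for f n
      using dir[OF that, of n] \<open>\<Phi> = _ \<or> \<Phi> = _\<close> by (auto simp: Besov_def)
  qed
  note N = est[OF disjI1[OF refl]] and S = est[OF disjI2[OF refl]]
  have NC: "N_class b m \<phi> \<alpha> q p \<hookrightarrow> C_class b m \<phi> (\<alpha> / 2) q p" if "0 < q" "0 < \<alpha>" for q \<alpha>
    unfolding N_class_def C_class_def
    by (rule quadratic_embedding[where c = "2 * b + m + 1"])
      (use that \<Phi>_set_N_subset_C \<Phi>_set_mono in auto)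
  show ?thesis
    using direct_estimate.embeds_in_approx_class[OF N] direct_estimate.embeds_in_approx_class[OF S]
      direct_estimate.interpolation_embeds[OF N] direct_estimate.interpolation_embeds[OF S]
      NC assms(7)
    by (simp add: N_class_def S_class_def)
qed

end
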